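(* Let $\mathfrak P$ be the partially ordered set of all Polish semigroup topologies on $I_{\mathbb N}$, ordered by containment. Then: (a) $\mathfrak P$ contains infinite (strictly) descending chains; (b) every (strictly) ascending chain in $\mathfrak P$ is finite, i.e. there is no infinite sequence $\mathcal T_0\subsetneq\mathcal T_1\subsetneq\mathcal T_2\subsetneq\cdots$ in $\mathfrak P$; (c) $\mathfrak P$ contains every finite partial order, i.e. every finite partially ordered set is order-isomorphic to a subposet of $\mathfrak P$.
   Context: $I_{\mathbb N}$ is the symmetric inverse monoid on $\mathbb N$: all bijections between subsets of $\mathbb N$ (including the empty map), with multiplication the composition of binary relations. A Polish semigroup topology on $I_{\mathbb N}$ is a Polish (separable completely metrizable) topology for which the multiplication $I_{\mathbb N}\times I_{\mathbb N}\to I_{\mathbb N}$ is (jointly) continuous. *)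

theory Defs
  imports "HOL-Analysis.Analysis"
begin

text \<open>A bijection between subsets of the naturals is identified with its graph; the product of
  the monoid is then relation composition \<^term>\<open>(O)\<close>, read from left to right.\<close>

definition sym_inv_monoid :: "(nat \<times> nat) set set" where
  "sym_inv_monoid = {r. single_valued r \<and> single_valued (r\<inverse>)}"

definition polish_topology :: "'a topology \<Rightarrow> bool" where
  "polish_topology X \<longleftrightarrow> separable_space X \<and> completely_metrizable_space X"

definition polish_semigroup_topologies :: "(nat \<times> nat) set topology set" where
  "polish_semigroup_topologies =
     {X. topspace X = sym_inv_monoid \<and> polish_topology X \<and>
         continuous_map (prod_topology X X) X (\<lambda>(r, s). r O s)}"

definition opens :: "'a topology \<Rightarrow> 'a set set" where
  "opens X = {U. openin X U}"

end

theory Submission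
  imports Defs
begin

text \<open>
  Let \<open>T\<close> be a Polish semigroup topology. Restricted to single entries it is discrete, so each
  condition \<open>(x, y) \<in> h\<close> is clopen. Relabelling shows that convergence in \<open>T\<close> implies pointwise
  convergence of the partial maps or of their inverses; passing to converses, assume the former.
  A Steinhaus-type argument in the symmetric group together with unitary dilation shows that
  pointwise convergence of the partial maps and of their inverses implies convergence in \<open>T\<close>.
  Between these two extremes, \<open>T\<close> is determined by the pairs \<open>(r, l)\<close> such that elements of rank \<open>r\<close>
  are limits of elements with \<open>l\<close> additional image points. These pairs form a down-set of
  \<open>nat \<times> nat\<close> that shrinks when \<open>T\<close> grows, so Dickson's lemma excludes ascending chains.

  Conversely, every function \<open>f\<close> on the naturals that strictly decreases until it vanishes is realized
  by a topology in which elements of rank \<open>r\<close> gain at most \<open>f r\<close> image points, and larger functions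
  give coarser topologies. The functions \<open>r \<mapsto> n - r\<close> give a descending chain, and slowly decreasing
  functions with independent lowest bits realize every finite order.
\<close>

section \<open>Convergence in Polish semigroup topologies\<close>

text \<open>Once pointwise convergence of the maps is granted, what can still distinguish two of
  these topologies is image points whose preimages escape to infinity. Multiplication by fixed
  elements on both sides relabels preimages and image points, so only two numbers matter about such
  a sequence: the rank of the limit and the number of points gained. As the topologies are
  metrizable, comparing two of them amounts to carrying a convergent sequence of one over to the
  other.

  The strict decrease of \<open>f\<close> is what makes multiplication continuous. In
  \<open>u O v\<close>, a point gained by \<open>u\<close> and passed on by an old entry of
  \<open>v\<close> is gained by the product, on top of what \<open>v\<close> gains itself. But that
  entry also counts towards the rank of \<open>v\<close>, so the allowance of \<open>v\<close>
  shrinks by at least what \<open>u\<close> has spent. A strictly decreasing function with natural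
  values must vanish eventually but may start arbitrarily high, which leaves room for infinite
  descent.\<close>

lemma sym_inv_monoid_iff:
  "r \<in> sym_inv_monoid \<longleftrightarrow>
     (\<forall>x y z. (x, y) \<in> r \<and> (x, z) \<in> r \<longrightarrow> y = z) \<and> (\<forall>x y z. (x, z) \<in> r \<and> (y, z) \<in> r \<longrightarrow> x = y)"
  unfolding sym_inv_monoid_def single_valued_def converse_iff mem_Collect_eq by blast

lemma sym_inv_monoid_fun: "r \<in> sym_inv_monoid \<Longrightarrow> (x, y) \<in> r \<Longrightarrow> (x, z) \<in> r \<Longrightarrow> y = z"
  and sym_inv_monoid_inj: "r \<in> sym_inv_monoid \<Longrightarrow> (x, z) \<in> r \<Longrightarrow> (y, z) \<in> r \<Longrightarrow> x = y"
  unfolding sym_inv_monoid_iff by blast+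

lemma sym_inv_monoid_comp: "r \<in> sym_inv_monoid \<Longrightarrow> s \<in> sym_inv_monoid \<Longrightarrow> r O s \<in> sym_inv_monoid"
  unfolding sym_inv_monoid_iff by blast

lemma sym_inv_monoid_converse [simp]: "r\<inverse> \<in> sym_inv_monoid \<longleftrightarrow> r \<in> sym_inv_monoid"
  unfolding sym_inv_monoid_iff by blast

lemma sym_inv_monoid_subset: "r \<in> sym_inv_monoid \<Longrightarrow> s \<subseteq> r \<Longrightarrow> s \<in> sym_inv_monoid"
  unfolding sym_inv_monoid_iff by blast

lemma sym_inv_monoid_Id_on [simp]: "Id_on A \<in> sym_inv_monoid"
  unfolding sym_inv_monoid_iff by blast

lemma sym_inv_monoid_empty [simp]: "{} \<in> sym_inv_monoid"
  unfolding sym_inv_monoid_iff by blast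

lemma sym_inv_monoid_graph: "inj_on f A \<Longrightarrow> {(x, f x) |x. x \<in> A} \<in> sym_inv_monoid"
  unfolding sym_inv_monoid_iff inj_on_def by auto

lemma sym_inv_monoid_Un:
  "r \<in> sym_inv_monoid \<Longrightarrow> s \<in> sym_inv_monoid \<Longrightarrow> Domain r \<inter> Domain s = {} \<Longrightarrow> Range r \<inter> Range s = {} \<Longrightarrow>
   r \<union> s \<in> sym_inv_monoid"
  unfolding sym_inv_monoid_iff by blast

lemma sym_inv_monoid_singleton [simp]: "{(x, y)} \<in> sym_inv_monoid"
  unfolding sym_inv_monoid_iff by auto

lemma sym_inv_monoid_finite_iff: "r \<in> sym_inv_monoid \<Longrightarrow> finite (Range r) \<longleftrightarrow> finite r"
proof
  assume r: "r \<in> sym_inv_monoid" and "finite (Range r)"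
  moreover have "inj_on snd r"
    using r by (auto simp: inj_on_def intro: sym_inv_monoid_inj)
  ultimately show "finite r"
    by (simp add: Range_snd finite_image_iff)
qed (auto simp: Range_snd)

lemma sym_inv_monoid_card_Range: "r \<in> sym_inv_monoid \<Longrightarrow> card (Range r) = card r"
  unfolding Range_snd by (rule card_image) (auto simp: inj_on_def intro: sym_inv_monoid_inj)

text \<open>Being undefined at \<open>x\<close> counts as an isolated value, so this is convergence
  in a power of a discrete space with one extra point. In particular singletons
  \<open>{(x, f n)}\<close> with \<open>f\<close> strictly increasing do not tend to the empty
  relation in this sense.\<close>

definition dom_conv :: "(nat \<Rightarrow> (nat \<times> nat) set) \<Rightarrow> (nat \<times> nat) set \<Rightarrow> bool" where
  "dom_conv h g \<longleftrightarrow> (\<forall>x. \<forall>\<^sub>F n in sequentially. h n `` {x} = g `` {x})"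

definition bi_conv :: "(nat \<Rightarrow> (nat \<times> nat) set) \<Rightarrow> (nat \<times> nat) set \<Rightarrow> bool" where
  "bi_conv h g \<longleftrightarrow> dom_conv h g \<and> dom_conv (\<lambda>n. (h n)\<inverse>) (g\<inverse>)"

lemma dom_conv_subseq: "dom_conv h g \<Longrightarrow> strict_mono k \<Longrightarrow> dom_conv (h \<circ> k) g"
  unfolding dom_conv_def using eventually_subseq by fastforce

lemma dom_conv_mem: "dom_conv h g \<Longrightarrow> (x, y) \<in> g \<Longrightarrow> \<forall>\<^sub>F n in sequentially. (x, y) \<in> h n"
  unfolding dom_conv_def by (erule allE [of _ x], erule eventually_mono) blast

lemma dom_conv_notin: "dom_conv h g \<Longrightarrow> x \<notin> Domain g \<Longrightarrow> \<forall>\<^sub>F n in sequentially. x \<notin> Domain (h n)"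
  unfolding dom_conv_def by (erule allE [of _ x], erule eventually_mono) blast

lemma dom_convI:
  assumes "\<And>n. h n \<in> sym_inv_monoid"
    and "\<And>x y. (x, y) \<in> g \<Longrightarrow> \<forall>\<^sub>F n in sequentially. (x, y) \<in> h n"
    and "\<And>x. x \<notin> Domain g \<Longrightarrow> \<forall>\<^sub>F n in sequentially. x \<notin> Domain (h n)"
  shows "dom_conv h g"
  unfolding dom_conv_def
proof
  fix x
  show "\<forall>\<^sub>F n in sequentially. h n `` {x} = g `` {x}"
  proof (cases "x \<in> Domain g")
    case True
    then obtain y where y: "(x, y) \<in> g"
      by blast
    have ev: "\<forall>\<^sub>F n in sequentially. h n `` {x} = {y}"
      using assms(2)[OF y] by (rule eventually_mono) (use assms(1) sym_inv_monoid_fun in blast)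
    \<comment> \<open>Uniqueness of the value is inherited from the \<open>h n\<close>;
      \<open>g\<close> is not assumed to lie in the monoid.\<close>
    have "z = y" if "(x, z) \<in> g" for z
    proof -
      have "\<forall>\<^sub>F n in sequentially. z = y"
        using eventually_conj[OF assms(2)[OF y] assms(2)[OF that]]
        by (rule eventually_mono) (use assms(1) sym_inv_monoid_fun in blast)
      then show ?thesis
        by simp
    qed
    then have "g `` {x} = {y}"
      using y by blast
    then show ?thesis
      using ev by simp
  next
    case False
    then show ?thesis
      using assms(3)[OF False] by (elim eventually_mono) blast
  qed
qed

section \<open>Choice of subsequences and limits in metrizable spaces\<close>

lemma subseq_chain:
  fixes P :: "nat \<Rightarrow> bool" and Q :: "nat \<Rightarrow> nat \<Rightarrow> bool"
  assumes "\<exists>\<^sub>F n in sequentially. P n"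
    and "\<And>m. P m \<Longrightarrow> \<forall>\<^sub>F n in sequentially. Q m n"
  obtains k :: "nat \<Rightarrow> nat" where "strict_mono k" "\<And>i. P (k i)" "\<And>i. Q (k i) (k (Suc i))"
proof -
  have 0: "\<exists>x. P x"
    using frequently_ex[OF assms(1)] .
  have "\<exists>y. P y \<and> x < y \<and> Q x y" if "P x" for x
  proof -
    have "\<forall>\<^sub>F n in sequentially. x < n \<and> Q x n"
      using assms(2)[OF that] eventually_gt_at_top[of x] by eventually_elim auto
    from frequently_eventually_conj[OF assms(1) this] show ?thesis
      by (auto dest!: frequently_ex)
  qed
  then obtain k where k: "\<And>n. P (k n)" and kk: "\<And>n. k n < k (Suc n) \<and> Q (k n) (k (Suc n))"
    using dependent_nat_choice[of "\<lambda>_. P" "\<lambda>_ x y. x < y \<and> Q x y", OF 0] by auto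
  show ?thesis
    by (rule that[of k]) (use k kk in \<open>auto simp: strict_mono_Suc_iff\<close>)
qed

lemma frequently_subseq:
  assumes "\<exists>\<^sub>F n in sequentially. P n"
  obtains k :: "nat \<Rightarrow> nat" where "strict_mono k" "\<And>i. P (k i)"
  using subseq_chain[of P "\<lambda>_ _. True"] assms by auto

text \<open>Here the extra condition depends on the position in the subsequence; in
  \<open>subseq_chain\<close> it depends on the index chosen just before.\<close>

lemma subseq_index:
  fixes P :: "nat \<Rightarrow> bool" and Q :: "nat \<Rightarrow> nat \<Rightarrow> bool"
  assumes "\<exists>\<^sub>F n in sequentially. P n" "\<And>i. \<forall>\<^sub>F n in sequentially. Q i n"
  obtains k :: "nat \<Rightarrow> nat" where "strict_mono k" "\<And>i. P (k i)" "\<And>i. Q i (k i)"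
proof -
  have ex: "\<exists>y. (P y \<and> Q i y) \<and> x < y" for i x
    using frequently_eventually_conj[OF assms(1) eventually_conj[OF assms(2)[of i] eventually_gt_at_top[of x]]]
    by (auto dest!: frequently_ex)
  then have "\<exists>x. P x \<and> Q 0 x"
    by blast
  then obtain k where k: "\<And>n. P (k n) \<and> Q n (k n)" and kk: "\<And>n. k n < k (Suc n)"
    using dependent_nat_choice[of "\<lambda>n x. P x \<and> Q n x" "\<lambda>_ x y. x < y"] ex by auto
  show ?thesis
    by (rule that[of k]) (use k kk in \<open>auto simp: strict_mono_Suc_iff\<close>)
qed

text \<open>Balls of radius \<open>1 / Suc n\<close>. They allow a convergent sequence to be built
  recursively, its \<open>n\<close>-th term being any point of \<open>B n\<close>.\<close>

lemma limitin_shrinking: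
  assumes "metrizable_space X" "x \<in> topspace X"
  obtains B where "\<And>n::nat. openin X (B n)" "\<And>n. x \<in> B n"
    "\<And>f. (\<And>n. f n \<in> B n) \<Longrightarrow> limitin X f x sequentially"
proof -
  obtain M d where "Metric_space M d" and X: "X = Metric_space.mtopology M d"
    using assms(1) by (auto simp: metrizable_space_def)
  then interpret Metric_space M d
    by simp
  have x: "x \<in> M"
    using assms(2) X by simp
  have "limitin X f x sequentially" if f: "\<And>n. f n \<in> mball x (1 / Suc n)" for f
    unfolding X limit_metric_sequentially
  proof (intro conjI allI impI)
    fix e :: real assume "e > 0"
    then obtain N where N: "1 / Suc N < e"
      using nat_approx_posE by blast
    have "f n \<in> M \<and> d (f n) x < e" if "n \<ge> N" for n
    proof -
      have "1 / Suc n \<le> 1 / Suc N"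
        using that by (simp add: frac_le)
      then show ?thesis
        using f[of n] N by (auto simp: commute)
    qed
    then show "\<exists>N. \<forall>n\<ge>N. f n \<in> M \<and> d (f n) x < e"
      by blast
  qed (rule x)
  moreover have "openin X (mball x (1 / Suc n))" "x \<in> mball x (1 / Suc n)" for n
    using x by (auto simp: X)
  ultimately show ?thesis
    by (rule that[rotated 2])
qed

lemma limitin_diagonal:
  assumes "metrizable_space X" "limitin X w x sequentially" "\<And>n. limitin X (v n) (w n) sequentially"
  obtains j where "limitin X (\<lambda>n. v n (j n)) x sequentially" "\<And>n. j n \<ge> n"
proof -
  obtain M d where "Metric_space M d" and X: "X = Metric_space.mtopology M d"
    using assms(1) by (auto simp: metrizable_space_def)
  then interpret Metric_space M d
    by simp
  have wM: "w n \<in> M" for n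
    using assms(3) X limitin_topspace by fastforce
  have "\<exists>j\<ge>n. v n j \<in> M \<and> d (v n j) (w n) < 1 / Suc n" for n
  proof -
    have "\<exists>N. \<forall>j\<ge>N. v n j \<in> M \<and> d (v n j) (w n) < 1 / Suc n"
      using assms(3)[of n] unfolding X limit_metric_sequentially by auto
    then show ?thesis
      by (meson linear)
  qed
  then obtain j where j: "\<And>n. j n \<ge> n" "\<And>n. v n (j n) \<in> M" "\<And>n. d (v n (j n)) (w n) < 1 / Suc n"
    by metis
  have x: "x \<in> M"
    using assms(2) X limitin_topspace by fastforce
  have lim: "(\<lambda>n. d (w n) x) \<longlonglongrightarrow> 0"
    using assms(2) unfolding X limitin_metric_dist_null by simp
  have "(\<lambda>n. d (v n (j n)) x) \<longlonglongrightarrow> 0"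
  proof (rule tendsto_sandwich[OF _ _ tendsto_const])
    have "(\<lambda>n. 1 / real (Suc n)) \<longlonglongrightarrow> 0"
      using LIMSEQ_inverse_real_of_nat by (simp add: inverse_eq_divide)
    from tendsto_add[OF this lim] show "(\<lambda>n. 1 / real (Suc n) + d (w n) x) \<longlonglongrightarrow> 0"
      by simp
    have "d (v n (j n)) x \<le> 1 / real (Suc n) + d (w n) x" for n
      using triangle[OF j(2)[of n] wM[of n] x] j(3)[of n] by linarith
    then show "\<forall>\<^sub>F n in sequentially. d (v n (j n)) x \<le> 1 / real (Suc n) + d (w n) x"
      by simp
  qed (simp add: nonneg)
  then have "limitin X (\<lambda>n. v n (j n)) x sequentially"
    unfolding X limitin_metric_dist_null using x j(2) by simp
  then show ?thesis
    using that j(1) by blast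
qed

locale polish_inv_monoid =
  fixes T :: "(nat \<times> nat) set topology"
  assumes polish: "T \<in> polish_semigroup_topologies"
begin

lemma topspace_T [simp]: "topspace T = sym_inv_monoid"
  using polish by (simp add: polish_semigroup_topologies_def)

lemma metrizable_T: "metrizable_space T"
  using polish by (simp add: polish_semigroup_topologies_def polish_topology_def
      completely_metrizable_imp_metrizable_space)

lemma lim_in: "limitin T h g sequentially \<Longrightarrow> g \<in> sym_inv_monoid"
  using limitin_topspace by fastforce

lemma lim_unique: "limitin T h g sequentially \<Longrightarrow> limitin T h g' sequentially \<Longrightarrow> g = g'"
  by (rule limitin_Hausdorff_unique[OF _ _ sequentially_bot metrizable_imp_Hausdorff_space[OF metrizable_T]])

lemma mult_nhds:
  assumes "g \<in> sym_inv_monoid" "k \<in> sym_inv_monoid" "openin T U" "g O k \<in> U"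
  obtains V W where "openin T V" "openin T W" "g \<in> V" "k \<in> W" "\<And>a b. a \<in> V \<Longrightarrow> b \<in> W \<Longrightarrow> a O b \<in> U"
proof -
  have c: "continuous_map (prod_topology T T) T (\<lambda>(r, s). r O s)"
    using polish by (simp add: polish_semigroup_topologies_def)
  define S where "S = {p \<in> topspace (prod_topology T T). (\<lambda>(r, s). r O s) p \<in> U}"
  have "openin (prod_topology T T) S"
    unfolding S_def using openin_continuous_map_preimage[OF c assms(3)] .
  moreover have "(g, k) \<in> S"
    using assms by (simp add: S_def)
  ultimately obtain V W where VW: "openin T V" "openin T W" "g \<in> V" "k \<in> W" "V \<times> W \<subseteq> S"
    unfolding openin_prod_topology_alt by metis
  have "a O b \<in> U" if "a \<in> V" "b \<in> W" for a b
    using VW(5) that by (auto simp: S_def)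
  with VW(1-4) show ?thesis
    by (rule that)
qed

lemma lim_mult:
  assumes "limitin T h g sequentially" "limitin T k l sequentially"
  shows "limitin T (\<lambda>n. h n O k n) (g O l) sequentially"
  unfolding limitin_def
proof (intro conjI allI impI)
  show "g O l \<in> topspace T"
    using assms lim_in sym_inv_monoid_comp by auto
  fix U assume U: "openin T U \<and> g O l \<in> U"
  obtain V W where VW: "openin T V" "openin T W" "g \<in> V" "l \<in> W" "\<And>a b. a \<in> V \<Longrightarrow> b \<in> W \<Longrightarrow> a O b \<in> U"
    using mult_nhds[OF lim_in[OF assms(1)] lim_in[OF assms(2)]] U by metis
  show "\<forall>\<^sub>F n in sequentially. h n O k n \<in> U"
    using limitinD[OF assms(1) VW(1,3)] limitinD[OF assms(2) VW(2,4)]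
    by eventually_elim (rule VW(5))
qed

lemma lim_const: "g \<in> sym_inv_monoid \<Longrightarrow> limitin T (\<lambda>_. g) g sequentially"
  by simp

lemma lim_mult_left: "p \<in> sym_inv_monoid \<Longrightarrow> limitin T h g sequentially \<Longrightarrow> limitin T (\<lambda>n. p O h n) (p O g) sequentially"
  by (intro lim_mult lim_const)

lemma lim_mult_right: "p \<in> sym_inv_monoid \<Longrightarrow> limitin T h g sequentially \<Longrightarrow> limitin T (\<lambda>n. h n O p) (g O p) sequentially"
  by (intro lim_mult lim_const)

text \<open>Cutting an element down to the entry \<open>(x, y)\<close> leaves only two possible values, which a
  Hausdorff topology separates.\<close>

lemma lim_entry:
  assumes "\<And>n. h n \<in> sym_inv_monoid" "limitin T h g sequentially"
  shows "\<forall>\<^sub>F n in sequentially. (x, y) \<in> h n \<longleftrightarrow> (x, y) \<in> g"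
proof (rule ccontr)
  assume neg: "\<not> ?thesis"
  define P where "P n \<longleftrightarrow> ((x, y) \<in> h n) \<noteq> ((x, y) \<in> g)" for n
  have "\<exists>\<^sub>F n in sequentially. P n"
    using neg by (simp add: frequently_def P_def)
  then obtain k :: "nat \<Rightarrow> nat" where k: "strict_mono k" "\<And>i. P (k i)"
    by (rule frequently_subseq) blast
  define c where "c r = {(x, x)} O r O {(y, y)}" for r :: "(nat \<times> nat) set"
  have c: "c r = (if (x, y) \<in> r then {(x, y)} else {})" for r
    unfolding c_def by auto
  have l: "limitin T (\<lambda>n. c (h n)) (c g) sequentially"
    unfolding c_def using assms(2) by (intro lim_mult_left lim_mult_right) auto
  have "limitin T ((\<lambda>n. c (h n)) \<circ> k) (c g) sequentially"
    by (rule limitin_subsequence[OF k(1) l])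
  moreover have "((\<lambda>n. c (h n)) \<circ> k) = (\<lambda>_. if (x, y) \<in> g then {} else {(x, y)})"
    using k(2) by (auto simp: c fun_eq_iff P_def)
  moreover have "limitin T (\<lambda>_. if (x, y) \<in> g then {} else {(x, y)}) (if (x, y) \<in> g then {} else {(x, y)}) sequentially"
    by (intro lim_const) auto
  ultimately have "c g = (if (x, y) \<in> g then {} else {(x, y)})"
    using lim_unique by simp
  then show False
    by (auto simp: c split: if_splits)
qed

text \<open>By \<open>lim_entry\<close> the entries of \<open>g\<close> are attained eventually, so
  the failure occurs at some \<open>x\<close> outside \<open>Domain g\<close> where infinitely many
  \<open>h n\<close> are defined. Again by \<open>lim_entry\<close>, their values at
  \<open>x\<close> leave every finite set; multiplying by \<open>{(x, x)}\<close> discards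
  everything else.\<close>

lemma not_dom_conv:
  assumes "\<And>n. h n \<in> sym_inv_monoid" "limitin T h g sequentially" "\<not> dom_conv h g"
  obtains x :: nat and f :: "nat \<Rightarrow> nat" where "strict_mono f" "limitin T (\<lambda>n. {(x, f n)}) {} sequentially"
proof -
  have "\<exists>x. x \<notin> Domain g \<and> (\<exists>\<^sub>F n in sequentially. x \<in> Domain (h n))"
  proof (rule ccontr)
    assume *: "\<not> ?thesis"
    have "dom_conv h g"
    proof (rule dom_convI)
      show "\<forall>\<^sub>F n in sequentially. (x, y) \<in> h n" if "(x, y) \<in> g" for x y
        using lim_entry[OF assms(1,2), of x y] that by simp
      show "\<forall>\<^sub>F n in sequentially. x \<notin> Domain (h n)" if "x \<notin> Domain g" for x
        using * that by (auto simp: frequently_def)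
    qed (rule assms(1))
    then show False
      using assms(3) by simp
  qed
  then obtain x where x: "x \<notin> Domain g" and fr: "\<exists>\<^sub>F n in sequentially. x \<in> Domain (h n)"
    by blast
  have ev: "\<forall>\<^sub>F n in sequentially. h n `` {x} \<inter> {..N} = {}" for N
  proof -
    have "\<forall>\<^sub>F n in sequentially. \<forall>y\<in>{..N}. (x, y) \<notin> h n"
    proof (intro eventually_ball_finite ballI)
      fix y
      show "\<forall>\<^sub>F n in sequentially. (x, y) \<notin> h n"
        using lim_entry[OF assms(1,2), of x y] by (rule eventually_mono) (use x in blast)
    qed simp
    then show ?thesis
      by (rule eventually_mono) blast
  qed
  define v where "v n = (SOME y. (x, y) \<in> h n)" for n
  have v: "(x, v n) \<in> h n" if "x \<in> Domain (h n)" for n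
    unfolding v_def using that by (rule DomainE) (rule someI)
  define P where "P n \<longleftrightarrow> x \<in> Domain (h n)" for n
  define Q where "Q m n \<longleftrightarrow> h n `` {x} \<inter> {..v m} = {}" for m n
  have "\<exists>\<^sub>F n in sequentially. P n" "\<And>m. \<forall>\<^sub>F n in sequentially. Q m n"
    using fr ev by (simp_all add: P_def Q_def)
  then obtain k :: "nat \<Rightarrow> nat" where k: "strict_mono k" "\<And>i. P (k i)" "\<And>i. Q (k i) (k (Suc i))"
    using subseq_chain[of P Q] by metis
  define f where "f i = v (k i)" for i
  have f: "(x, f i) \<in> h (k i)" for i
    unfolding f_def using k(2)[of i] by (auto simp: P_def intro: v)
  have "strict_mono f"
    unfolding strict_mono_Suc_iff
  proof
    fix n
    have "f (Suc n) \<notin> {..f n}"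
      using k(3)[of n] f[of "Suc n"] unfolding Q_def f_def by blast
    then show "f n < f (Suc n)"
      by simp
  qed
  moreover have "limitin T ((\<lambda>n. {(x, x)} O h n) \<circ> k) ({(x, x)} O g) sequentially"
    by (rule limitin_subsequence[OF k(1) lim_mult_left[OF _ assms(2)]]) simp
  moreover have "{(x, x)} O g = {}"
    using x by auto
  moreover have "{(x, x)} O h (k n) = {(x, f n)}" for n
  proof -
    have "h (k n) `` {x} = {f n}"
      using f[of n] sym_inv_monoid_fun[OF assms(1)[of "k n"] f[of n]] by blast
    moreover have "{(x, x)} O r = Pair x ` (r `` {x})" for r :: "(nat \<times> nat) set"
      by auto
    ultimately show ?thesis
      by simp
  qed
  then have "((\<lambda>n. {(x, x)} O h n) \<circ> k) = (\<lambda>n. {(x, f n)})"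
    by (simp add: comp_def)
  ultimately have "limitin T (\<lambda>n. {(x, f n)}) {} sequentially"
    by simp
  with \<open>strict_mono f\<close> show ?thesis
    by (rule that)
qed

end

text \<open>Converse is an anti-automorphism of the monoid, so this transport keeps the class of
  topologies and exchanges convergence of the maps with convergence of their inverses.\<close>

definition converse_topology :: "(nat \<times> nat) set topology \<Rightarrow> (nat \<times> nat) set topology" where
  "converse_topology T = pullback_topology UNIV converse T"

lemma openin_converse_topology: "openin (converse_topology T) U \<longleftrightarrow> openin T (converse -` U)"
  unfolding converse_topology_def openin_pullback_topology
proof
  assume "openin T (converse -` U)"
  moreover have "U = converse -` (converse -` U)"
    by (simp add: vimage_def)
  ultimately show "\<exists>V. openin T V \<and> U = converse -` V \<inter> UNIV"
    by auto
next
  assume "\<exists>V. openin T V \<and> U = converse -` V \<inter> UNIV"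
  then obtain V where V: "openin T V" "U = converse -` V"
    by auto
  moreover have "converse -` U = V"
    by (simp add: V(2) vimage_def)
  ultimately show "openin T (converse -` U)"
    by simp
qed

lemma converse_topology_converse [simp]: "converse_topology (converse_topology T) = T"
  unfolding topology_eq openin_converse_topology by (simp add: vimage_def)

lemma limitin_converse_topology:
  "limitin (converse_topology T) h g sequentially \<longleftrightarrow> limitin T (\<lambda>n. (h n)\<inverse>) (g\<inverse>) sequentially"
proof -
  have "limitin (converse_topology T) h g sequentially" if l: "limitin T (\<lambda>n. (h n)\<inverse>) (g\<inverse>) sequentially" for T h g
    unfolding limitin_def
  proof (intro conjI allI impI)
    show "g \<in> topspace (converse_topology T)"
      using limitin_topspace[OF l] by (simp add: converse_topology_def topspace_pullback_topology)
    fix U assume "openin (converse_topology T) U \<and> g \<in> U"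
    then have "\<forall>\<^sub>F n in sequentially. (h n)\<inverse> \<in> converse -` U"
      by (intro limitinD[OF l]) (auto simp: openin_converse_topology)
    then show "\<forall>\<^sub>F n in sequentially. h n \<in> U"
      by simp
  qed
  from this[of "converse_topology T" "\<lambda>n. (h n)\<inverse>" "g\<inverse>"] this[of T h g]
  show ?thesis
    unfolding converse_topology_converse converse_converse by blast
qed

section \<open>Pointwise convergence of the maps or of their inverses\<close>

lemma homeomorphic_maps_converse_topology:
  "homeomorphic_maps (converse_topology T) T converse converse"
proof -
  have "continuous_map (converse_topology T) T converse" for T
    unfolding continuous_map_def
  proof (intro conjI allI impI)
    show "converse \<in> topspace (converse_topology T) \<rightarrow> topspace T"
      by (auto simp: converse_topology_def topspace_pullback_topology)
    fix U assume U: "openin T U"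
    have "{x \<in> topspace (converse_topology T). x\<inverse> \<in> U} = converse -` U"
      using openin_subset[OF U] by (auto simp: converse_topology_def topspace_pullback_topology)
    moreover have "converse -` (converse -` U) = U"
      by (simp add: vimage_def)
    ultimately show "openin (converse_topology T) {x \<in> topspace (converse_topology T). x\<inverse> \<in> U}"
      using U by (simp add: openin_converse_topology)
  qed
  from this[of T] this[of "converse_topology T"] show ?thesis
    by (simp add: homeomorphic_maps_def)
qed

lemma opens_converse_topology_subset:
  "opens (converse_topology S) \<subseteq> opens (converse_topology T) \<longleftrightarrow> opens S \<subseteq> opens T"
proof -
  have "opens (converse_topology S) \<subseteq> opens (converse_topology T)" if "opens S \<subseteq> opens T" for S T
    using that by (auto simp: opens_def openin_converse_topology)
  from this[of S T] this[of "converse_topology S" "converse_topology T"] show ?thesis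
    by auto
qed

lemma converse_topology_polish:
  assumes "T \<in> polish_semigroup_topologies"
  shows "converse_topology T \<in> polish_semigroup_topologies"
proof -
  let ?C = "converse_topology T"
  interpret polish_inv_monoid T
    by unfold_locales fact
  have hom: "?C homeomorphic_space T"
    using homeomorphic_maps_converse_topology homeomorphic_space_def by blast
  have c1: "continuous_map ?C T converse" and c2: "continuous_map T ?C converse"
    using homeomorphic_maps_converse_topology by (auto simp: homeomorphic_maps_def)
  have m: "continuous_map (prod_topology T T) T (\<lambda>(r, s). r O s)"
    using assms by (simp add: polish_semigroup_topologies_def)
  \<comment> \<open>Converse reverses products, so the factors are swapped before they are
    multiplied in \<open>T\<close>.\<close>
  have "continuous_map (prod_topology ?C ?C) (prod_topology T T) (\<lambda>p. ((snd p)\<inverse>, (fst p)\<inverse>))"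
    using continuous_map_compose[OF continuous_map_snd c1] continuous_map_compose[OF continuous_map_fst c1]
    by (auto simp: continuous_map_paired o_def)
  from continuous_map_compose[OF continuous_map_compose[OF this m] c2]
  have "continuous_map (prod_topology ?C ?C) ?C (\<lambda>p. ((snd p)\<inverse> O (fst p)\<inverse>)\<inverse>)"
    by (simp add: o_def)
  moreover have "(\<lambda>p::(nat \<times> nat) set \<times> (nat \<times> nat) set. ((snd p)\<inverse> O (fst p)\<inverse>)\<inverse>) = (\<lambda>(r, s). r O s)"
    by (auto simp: fun_eq_iff converse_relcomp)
  moreover have "topspace ?C = sym_inv_monoid"
    by (auto simp: converse_topology_def topspace_pullback_topology)
  moreover have "completely_metrizable_space ?C" "separable_space ?C"
    using assms hom homeomorphic_completely_metrizable_space homeomorphic_separable_space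
    by (auto simp: polish_semigroup_topologies_def polish_topology_def)
  ultimately show ?thesis
    by (simp add: polish_semigroup_topologies_def polish_topology_def)
qed

definition left_determined :: "(nat \<times> nat) set topology \<Rightarrow> bool" where
  "left_determined T \<longleftrightarrow> (\<forall>h g. (\<forall>n. h n \<in> sym_inv_monoid) \<and> limitin T h g sequentially \<longrightarrow> dom_conv h g)"

context polish_inv_monoid begin

text \<open>If neither alternative held, the singletons \<open>{(x, f n)}\<close> and \<open>{(f' n, x')}\<close> would both tend to
  the empty relation; after relabelling, so would their product, the constant \<open>{(x, x')}\<close>.\<close>

lemma left_determined_or: "left_determined T \<or> left_determined (converse_topology T)"
proof (rule ccontr)
  assume *: "\<not> ?thesis"
  interpret C: polish_inv_monoid "converse_topology T"
    using converse_topology_polish[OF polish] by unfold_locales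
  obtain x f where f: "strict_mono (f :: nat \<Rightarrow> nat)" "limitin T (\<lambda>n. {(x :: nat, f n)}) {} sequentially"
    using * not_dom_conv unfolding left_determined_def by metis
  obtain x' f' where f': "strict_mono (f' :: nat \<Rightarrow> nat)"
      "limitin (converse_topology T) (\<lambda>n. {(x' :: nat, f' n)}) {} sequentially"
    using * C.not_dom_conv unfolding left_determined_def by metis
  have l': "limitin T (\<lambda>n. {(f' n, x')}) {} sequentially"
  proof -
    have "{(x', f' n)}\<inverse> = {(f' n, x')}" for n
      by auto
    then show ?thesis
      using f'(2) by (simp add: limitin_converse_topology)
  qed
  \<comment> \<open>Both functions are strictly increasing, so matching their \<open>n\<close>-th
    values is a partial bijection. It joins the two escaping points of the singletons, and the
    escape cancels.\<close>
  define q where "q = {(f n, f' n) |n. True}"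
  have q: "q \<in> sym_inv_monoid"
    using strict_mono_eq[OF f(1)] strict_mono_eq[OF f'(1)] unfolding q_def sym_inv_monoid_iff by auto
  have "limitin T (\<lambda>n. ({(x, f n)} O q) O {(f' n, x')}) (({} O q) O {}) sequentially"
    by (intro lim_mult lim_mult_right f(2) l' q)
  moreover have "({(x, f n)} O q) O {(f' n, x')} = {(x, x')}" for n
    using strict_mono_eq[OF f(1)] unfolding q_def by auto
  ultimately have "limitin T (\<lambda>n. {(x, x')}) {} sequentially"
    by simp
  then have "{(x, x')} = {}"
    using lim_unique[OF lim_const[OF sym_inv_monoid_singleton]] by blast
  then show False
    by simp
qed

end

section \<open>Pointwise convergence of the maps and of their inverses\<close>

definition Sym_on :: "nat set \<Rightarrow> (nat \<Rightarrow> nat) set" where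
  "Sym_on X = {p. bij p \<and> (\<forall>x. x \<notin> X \<longrightarrow> p x = x)}"

lemma Sym_on_mem_iff: "p \<in> Sym_on X \<Longrightarrow> p x \<in> X \<longleftrightarrow> x \<in> X"
proof -
  assume p: "p \<in> Sym_on X"
  then have i: "inj p"
    by (simp add: Sym_on_def bij_is_inj)
  show ?thesis
  proof
    show "x \<in> X" if "p x \<in> X"
      using p that by (auto simp: Sym_on_def)
    show "p x \<in> X" if "x \<in> X"
    proof (rule ccontr)
      assume "p x \<notin> X"
      then have "p (p x) = p x"
        using p by (simp add: Sym_on_def)
      then have "p x = x"
        using i by (simp add: inj_eq)
      then show False
        using \<open>p x \<notin> X\<close> that by simp
    qed
  qed
qed

lemma Sym_on_inv: "p \<in> Sym_on X \<Longrightarrow> inv p \<in> Sym_on X"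
  by (auto simp: Sym_on_def bij_imp_bij_inv bij_is_inj inv_f_eq)

lemma infinite_nat_bij_betw:
  fixes A B :: "nat set"
  assumes "infinite A" "infinite B"
  obtains f where "bij_betw f A B"
  by (metis assms bij_betw_inv bij_betw_trans bij_enumerate)

lemma infinite_nat_split:
  fixes A :: "nat set"
  assumes "infinite A"
  obtains A1 where "A1 \<subseteq> A" "infinite A1" "infinite (A - A1)"
proof -
  obtain A1 A2 where A: "A1 \<subseteq> A" "A2 \<subseteq> A" "infinite A1" "infinite A2" "A1 \<inter> A2 = {}"
    using infinite_split[OF assms] .
  then have "A2 \<subseteq> A - A1"
    by blast
  then show ?thesis
    using that[OF A(1,3)] A(4) finite_subset by blast
qed

lemma infinite_odd_nat: "infinite {n::nat. odd n}"
proof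
  assume "finite {n::nat. odd n}"
  moreover have "range (\<lambda>k::nat. Suc (2 * k)) \<subseteq> {n. odd n}"
    by auto
  ultimately have "finite (range (\<lambda>k::nat. Suc (2 * k)))"
    by (rule finite_subset[rotated])
  then show False
    by (simp add: finite_image_iff inj_on_def)
qed

text \<open>The infinite complements inside \<open>X\<close> are in bijection with each other, and
  the identity serves outside \<open>X\<close>.\<close>

lemma Sym_on_extend:
  assumes "P \<subseteq> X" "Q \<subseteq> X" "infinite (X - P)" "infinite (X - Q)" "bij_betw \<phi> P Q"
  obtains e where "e \<in> Sym_on X" "\<And>x. x \<in> P \<Longrightarrow> e x = \<phi> x"
proof -
  obtain \<psi> where \<psi>: "bij_betw \<psi> (X - P) (X - Q)"
    using infinite_nat_bij_betw assms(3,4) by blast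
  define e where "e x = (if x \<in> P then \<phi> x else if x \<in> X then \<psi> x else x)" for x
  have "bij_betw e P Q"
    using assms(5) by (rule bij_betw_cong[THEN iffD1, rotated]) (simp add: e_def)
  moreover have "bij_betw e (X - P) (X - Q)"
    using \<psi> by (rule bij_betw_cong[THEN iffD1, rotated]) (simp add: e_def)
  moreover have "bij_betw e (- X) (- X)"
    using bij_betw_id[of "- X"] by (rule bij_betw_cong[THEN iffD1, rotated]) (use assms(1) in \<open>auto simp: e_def\<close>)
  ultimately have "bij_betw e (P \<union> (X - P) \<union> - X) (Q \<union> (X - Q) \<union> - X)"
    using assms(2) by (intro bij_betw_combine) auto
  moreover have "P \<union> (X - P) \<union> - X = UNIV" "Q \<union> (X - Q) \<union> - X = UNIV"
    using assms by auto
  ultimately have "e \<in> Sym_on X"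
    using assms(1) by (auto simp: Sym_on_def e_def)
  then show ?thesis
    by (rule that) (simp add: e_def)
qed

text \<open>The index type is left open because \<open>b\<close> will be indexed by
  \<open>int * nat\<close> as well as by \<open>nat\<close>.\<close>

definition lift_perm :: "('i \<Rightarrow> nat) \<Rightarrow> ('i \<Rightarrow> 'i) \<Rightarrow> nat \<Rightarrow> nat" where
  "lift_perm b f y = (if y \<in> range b then b (f (inv b y)) else y)"

lemma lift_perm_range: "inj b \<Longrightarrow> lift_perm b f (b i) = b (f i)"
  and lift_perm_other: "y \<notin> range b \<Longrightarrow> lift_perm b f y = y"
  by (simp_all add: lift_perm_def)

lemma lift_perm_Sym_on:
  assumes "inj b" "bij f" "range b \<subseteq> X"
  shows "lift_perm b f \<in> Sym_on X"
proof -
  have "lift_perm b f \<circ> lift_perm b (inv f) = id" if "bij f" for f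
  proof
    fix y
    show "(lift_perm b f \<circ> lift_perm b (inv f)) y = id y"
      using assms(1) bij_is_surj[OF that]
      by (cases "y \<in> range b") (auto simp: lift_perm_range lift_perm_other surj_f_inv_f)
  qed
  from this[OF assms(2)] this[OF bij_imp_bij_inv[OF assms(2)]] have "bij (lift_perm b f)"
    using assms(2) by (intro o_bij[of "lift_perm b (inv f)"]) (simp_all add: inv_inv_eq)
  then show ?thesis
    using assms(3) unfolding Sym_on_def by (auto intro!: lift_perm_other)
qed

text \<open>The branches of the binary tree are almost disjoint.\<close>

lemma almost_disjoint_family:
  obtains B :: "nat set \<Rightarrow> nat set" where "\<And>x. infinite (B x)" "\<And>x y. x \<noteq> y \<Longrightarrow> finite (B x \<inter> B y)"
    "\<And>x. B x \<subseteq> {n. even n}"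
proof -
  \<comment> \<open>The code of the vertex at level \<open>n\<close> on the branch \<open>x\<close>.
    Doubling keeps the odd numbers off all branches, which later makes complements of branches
    overlap in an infinite set.\<close>
  define c where "c x n = 2 * prod_encode (n, set_encode (x \<inter> {..<n}))" for x :: "nat set" and n
  have c: "m = n \<and> x \<inter> {..<n} = y \<inter> {..<n}" if "c x m = c y n" for x y m n
    using that by (auto simp: c_def set_encode_eq)
  show ?thesis
  proof (rule that[of "\<lambda>x. range (c x)"])
    have "inj (c x)" for x
      using c by (auto simp: inj_on_def)
    then show "infinite (range (c x))" for x
      using range_inj_infinite by blast
    show "finite (range (c x) \<inter> range (c y))" if "x \<noteq> y" for x y
    proof -
      have "\<exists>i. i \<in> x \<longleftrightarrow> i \<notin> y"
        using that by blast
      then obtain i where i: "i \<in> x \<longleftrightarrow> i \<notin> y"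
        by blast
      have "range (c x) \<inter> range (c y) \<subseteq> c x ` {..i}"
      proof
        fix z assume "z \<in> range (c x) \<inter> range (c y)"
        then obtain m n where mn: "z = c x m" "z = c y n"
          by blast
        then have "m = n" "x \<inter> {..<n} = y \<inter> {..<n}"
          using c[of x m y n] by auto
        then have "m \<le> i"
          using i by (metis IntI Int_iff lessThan_iff not_less)
        then show "z \<in> c x ` {..i}"
          using mn by simp
      qed
      then show ?thesis
        using finite_subset by blast
    qed
  qed (auto simp: c_def)
qed

section \<open>Words of bounded length in a set with countably many covering translates\<close>

primrec words :: "(nat \<Rightarrow> nat) set \<Rightarrow> nat \<Rightarrow> (nat \<Rightarrow> nat) set" where
  "words W 0 = {id}"
| "words W (Suc k) = {w \<circ> v |w v. w \<in> W \<and> v \<in> words W k}"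

lemma words_comp: "a \<in> words W k \<Longrightarrow> b \<in> words W l \<Longrightarrow> a \<circ> b \<in> words W (k + l)"
proof (induction k arbitrary: a)
  case (Suc k)
  then obtain w v where a: "a = w \<circ> v" "w \<in> W" "v \<in> words W k"
    by auto
  then have "a \<circ> b = w \<circ> (v \<circ> b)"
    by (simp only: comp_assoc)
  moreover have "v \<circ> b \<in> words W (k + l)"
    using Suc.IH[OF a(3) Suc.prems(2)] .
  ultimately show ?case
    using a(2) by (simp only: add_Suc words.simps) blast
qed simp

lemma words_one: "w \<in> W \<Longrightarrow> w \<in> words W 1"
  by auto

text \<open>Symmetric neighbourhoods of the identity in a separable group topology have these properties.\<close>

locale steinhaus =
  fixes W :: "(nat \<Rightarrow> nat) set" and g :: "nat \<Rightarrow> nat \<Rightarrow> nat"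
  assumes bij_W: "w \<in> W \<Longrightarrow> bij w" and inv_W: "w \<in> W \<Longrightarrow> inv w \<in> W"
    and bij_g: "bij (g n)" and cover: "bij p \<Longrightarrow> \<exists>n. inv (g n) \<circ> p \<in> W"
begin

lemma words_inv: "a \<in> words W k \<Longrightarrow> bij a \<and> inv a \<in> words W k"
proof (induction k arbitrary: a)
  case (Suc k)
  then obtain w v where a: "a = w \<circ> v" "w \<in> W" "v \<in> words W k"
    by auto
  then have "bij w" "bij v" "inv v \<in> words W k" "inv w \<in> words W 1"
    using Suc.IH bij_W inv_W words_one by blast+
  then show ?case
    unfolding a(1) using words_comp[of "inv v" W k "inv w" 1]
    by (metis Suc_eq_plus1 bij_comp o_inv_distrib)
qed (simp add: inv_id)

lemma words_bij: "a \<in> words W k \<Longrightarrow> bij a"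
  using words_inv by blast

text \<open>The translating permutation \<open>g n\<close> cancels in the quotient, leaving the
  inverse of one element of \<open>W\<close> times another.\<close>

lemma same_translate:
  assumes "bij p" "bij q" "inv (g n) \<circ> p \<in> W" "inv (g n) \<circ> q \<in> W"
  shows "inv p \<circ> q \<in> words W 2"
proof -
  have "inv (inv (g n) \<circ> p) \<circ> (inv (g n) \<circ> q) = inv p \<circ> q"
    using assms(1) bij_g[of n]
    by (simp add: o_inv_distrib bij_imp_bij_inv inv_inv_eq fun_eq_iff bij_is_surj surj_f_inv_f)
  moreover have "inv (inv (g n) \<circ> p) \<in> words W 1" "inv (g n) \<circ> q \<in> words W 1"
    using inv_W[OF assms(3)] words_one assms(4) by blast+
  ultimately show ?thesis
    using words_comp by (metis one_add_one)
qed

text \<open>There are more sets of naturals than translates, so two members of the family share a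
  translate.\<close>

lemma uncountable_family:
  fixes P :: "nat set \<Rightarrow> nat \<Rightarrow> nat"
  assumes "\<And>x. bij (P x)"
  obtains x y where "x \<noteq> y" "inv (P x) \<circ> P y \<in> words W 2"
proof -
  obtain n where n: "\<And>x. inv (g (n x)) \<circ> P x \<in> W"
    using cover[OF assms] by metis
  have "\<not> inj n"
  proof
    assume "inj n"
    then have "inv n ` UNIV = (UNIV :: nat set set)"
      by (simp add: inj_imp_surj_inv)
    then show False
      using Cantors_theorem[of "UNIV :: nat set"] by (simp add: Pow_UNIV)
  qed
  then obtain x y where "n x = n y" "x \<noteq> y"
    by (auto simp: inj_def)
  then show ?thesis
    using that same_translate[OF assms assms n[of x], of y] n[of y] by simp
qed

text \<open>Were no row full, a permutation failing on the \<open>n\<close>-th row for the \<open>n\<close>-th translate would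
  lie in no translate at all.\<close>

lemma full_row:
  obtains n where "\<And>h. h \<in> Sym_on (range (\<lambda>k. prod_encode (n, k))) \<Longrightarrow>
    \<exists>w\<in>words W 2. \<forall>k. w (prod_encode (n, k)) = h (prod_encode (n, k))"
proof -
  define A where "A n = range (\<lambda>k. prod_encode (n, k))" for n
  have A: "x \<in> A n \<longleftrightarrow> fst (prod_decode x) = n" for x n
  proof
    assume "fst (prod_decode x) = n"
    then have "x = prod_encode (n, snd (prod_decode x))"
      by (metis prod.collapse prod_decode_inverse)
    then show "x \<in> A n"
      unfolding A_def by blast
  qed (auto simp: A_def)
  have "\<exists>n. \<forall>h\<in>Sym_on (A n). \<exists>p. bij p \<and> (\<forall>x\<in>A n. p x = h x) \<and> inv (g n) \<circ> p \<in> W"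
  proof (rule ccontr)
    assume "\<not> ?thesis"
    then obtain h where h: "\<And>n. h n \<in> Sym_on (A n)"
      and no: "\<And>n p. bij p \<Longrightarrow> (\<forall>x\<in>A n. p x = h n x) \<Longrightarrow> inv (g n) \<circ> p \<notin> W"
      by metis
    define glue where "glue h x = h (fst (prod_decode x)) x" for h :: "nat \<Rightarrow> nat \<Rightarrow> nat" and x
    have row: "fst (prod_decode (h n x)) = n" if "\<And>n. h n \<in> Sym_on (A n)" "fst (prod_decode x) = n" for h n x
      using Sym_on_mem_iff[OF that(1)[of n], of x] that(2) by (simp add: A)
    have h': "inv (h n) \<in> Sym_on (A n)" for n
      by (rule Sym_on_inv[OF h])
    have bijh: "bij (h n)" for n
      using h[of n] by (simp add: Sym_on_def)
    have "glue h \<circ> glue (\<lambda>n. inv (h n)) = id" "glue (\<lambda>n. inv (h n)) \<circ> glue h = id"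
      using row[OF h] row[OF h'] bijh
      by (auto simp: fun_eq_iff glue_def bij_is_surj surj_f_inv_f bij_is_inj inv_f_f)
    then have "bij (glue h)"
      by (intro o_bij)
    moreover have "\<forall>x\<in>A n. glue h x = h n x" for n
      by (auto simp: A glue_def)
    ultimately have "inv (g n) \<circ> glue h \<notin> W" for n
      using no by blast
    then show False
      using cover[OF \<open>bij (glue h)\<close>] by blast
  qed
  then obtain n where n: "\<And>h. h \<in> Sym_on (A n) \<Longrightarrow> \<exists>p. bij p \<and> (\<forall>x\<in>A n. p x = h x) \<and> inv (g n) \<circ> p \<in> W"
    by blast
  \<comment> \<open>Dividing by an element of the same translate that fixes the row pointwise
    removes \<open>g n\<close> without changing the action on the row.\<close>
  have "id \<in> Sym_on (A n)"
    by (simp add: Sym_on_def)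
  then obtain p1 where p1: "bij p1" "\<And>x. x \<in> A n \<Longrightarrow> p1 x = x" "inv (g n) \<circ> p1 \<in> W"
    using n[of id] by auto
  have "\<exists>w\<in>words W 2. \<forall>x\<in>A n. w x = h x" if h: "h \<in> Sym_on (A n)" for h
  proof -
    obtain p where p: "bij p" "\<And>x. x \<in> A n \<Longrightarrow> p x = h x" "inv (g n) \<circ> p \<in> W"
      using n[OF h] by blast
    have "inv p1 (p x) = h x" if "x \<in> A n" for x
    proof -
      have "h x \<in> A n"
        using Sym_on_mem_iff[OF h] that by simp
      then show ?thesis
        using p1 p(2)[OF that] by (metis bij_is_inj inv_f_f)
    qed
    then show ?thesis
      using same_translate[OF p1(1) p(1) p1(3) p(3)] by (intro bexI[of _ "inv p1 \<circ> p"]) auto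
  qed
  then show ?thesis
    using that unfolding A_def by (metis (no_types, lifting) rangeI)
qed

text \<open>A word \<open>w\<close> from \<open>full_row\<close> is known on the row
  \<open>A\<close> only. Let \<open>p\<close> be an involution in \<open>words W 2\<close> that is
  the identity off \<open>A\<close> and swaps \<open>b i\<close> with \<open>c i\<close>. In
  \<open>w p (inv w) p\<close> the unknown action off \<open>A\<close> cancels, while on the row
  \<open>f\<close> survives on the \<open>b\<close>-copy and \<open>inv f\<close> on the
  \<open>c\<close>-copy. The length is 8 = 2 + 2 + 2 + 2.\<close>

lemma twisted_pairs:
  obtains b c :: "int \<times> nat \<Rightarrow> nat" where "inj b" "inj c" "range b \<inter> range c = {}"
    "\<And>f. bij f \<Longrightarrow> lift_perm b f \<circ> lift_perm c (inv f) \<in> words W 8"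
proof -
  obtain n where full: "\<And>h. h \<in> Sym_on (range (\<lambda>k. prod_encode (n, k))) \<Longrightarrow>
    \<exists>w\<in>words W 2. \<forall>k. w (prod_encode (n, k)) = h (prod_encode (n, k))"
    using full_row by blast
  define a where "a k = prod_encode (n, k)" for k
  define A where "A = range a"
  have inj_a: "inj a"
    by (auto simp: inj_on_def a_def)
  have full: "\<exists>w\<in>words W 2. \<forall>x\<in>A. w x = h x" if "h \<in> Sym_on A" for h
    using full[of h] that by (auto simp: A_def a_def)
  define flip where "flip k = (if even k then Suc k else k - 1)" for k :: nat
  have flip: "flip (flip k) = k" "flip k div 2 = k div 2" for k
    by (auto simp: flip_def elim!: evenE oddE)
  define s where "s x = lift_perm a (\<lambda>k. if k div 2 \<in> x then flip k else k)" for x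
  have s_a: "s x (a k) = (if k div 2 \<in> x then a (flip k) else a k)" for x k
    by (simp add: s_def lift_perm_range[OF inj_a])
  have s_out: "s x y = y" if "y \<notin> A" for x y
    using that by (simp add: s_def lift_perm_other A_def)
  have ss: "s x (s x y) = y" for x y
    by (cases "y \<in> A") (auto simp: A_def s_a flip s_out)
  have bij_s: "bij (s x)" for x
    by (rule involuntory_imp_bij) (rule ss)
  have inv_s: "inv (s x) = s x" for x
    using ss by (metis bij_s bij_inv_eq_iff ext)
  \<comment> \<open>Whichever two sets are selected by the counting argument, almost disjointness
    leaves infinitely many pairs that are swapped by exactly one of the two involutions.\<close>
  obtain B :: "nat set \<Rightarrow> nat set" where B: "\<And>x. infinite (B x)" "\<And>x y. x \<noteq> y \<Longrightarrow> finite (B x \<inter> B y)"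
    using almost_disjoint_family by metis
  obtain x y where xy: "x \<noteq> y" "inv (s (B x)) \<circ> s (B y) \<in> words W 2"
    using uncountable_family[of "\<lambda>x. s (B x)", OF bij_s] by blast
  define p where "p = s (B x) \<circ> s (B y)"
  have p: "p \<in> words W 2"
    using xy(2) by (simp add: inv_s p_def)
  define E where "E = B x - B y"
  have "infinite E"
    using B(1)[of x] B(2)[OF xy(1)] by (metis E_def Diff_Diff_Int finite_Diff2 Int_commute)
  have pa: "p (a k) = a (flip k)" if "k div 2 \<in> E" for k
    using that by (simp add: p_def s_a E_def)
  have pout: "p y = y" if "y \<notin> A" for y
    using that by (simp add: p_def s_out)
  have pA: "p y \<in> A" if "y \<in> A" for y
    using that by (auto simp: A_def p_def s_a)
  have pp: "p (p y) = y" for y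
    by (cases "y \<in> A") (auto simp: A_def p_def s_a flip s_out)
  \<comment> \<open>Indexing by \<open>int * nat\<close> arranges the pairs as a two-sided sequence
    of copies of the naturals, ready for the shift in \<open>small_support\<close>.\<close>
  define e :: "int \<times> nat \<Rightarrow> nat" where "e = enumerate E \<circ> to_nat"
  have inj_e: "inj e"
    unfolding e_def by (intro inj_compose bij_betw_imp_inj_on[OF bij_enumerate[OF \<open>infinite E\<close>]] inj_to_nat)
  have eE: "e i \<in> E" for i
    unfolding e_def using \<open>infinite E\<close> by (simp add: enumerate_in_set)
  define b c where "b i = a (2 * e i)" and "c i = a (Suc (2 * e i))" for i :: "int \<times> nat"
  have inj_b: "inj b" and inj_c: "inj c"
    by (auto simp: inj_on_def b_def c_def inj_eq[OF inj_a] inj_eq[OF inj_e])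
  have bc: "b i \<noteq> c j" for i j
    by (simp add: b_def c_def inj_eq[OF inj_a]) presburger
  have pb: "p (b i) = c i" and pc: "p (c i) = b i" for i
    using pa[of "2 * e i"] pa[of "Suc (2 * e i)"] eE[of i] by (simp_all add: b_def c_def flip_def)
  have bA: "range b \<subseteq> A" and cA: "range c \<subseteq> A"
    by (auto simp: A_def b_def c_def)
  have cr: "c i \<in> A" "c i \<notin> range b" "b i \<notin> range c" for i
    using cA bc by (blast, metis imageE, metis imageE)
  have "lift_perm b f \<circ> lift_perm c (inv f) \<in> words W 8" if f: "bij f" for f
  proof -
    obtain w where w: "w \<in> words W 2" "\<And>x. x \<in> A \<Longrightarrow> w x = lift_perm b f x"
      using full[OF lift_perm_Sym_on[OF inj_b f bA]] by blast
    have bw: "bij w"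
      using words_bij[OF w(1)] .
    have wb: "w (b i) = b (f i)" for i
    proof -
      have "b i \<in> A"
        using bA by blast
      then show ?thesis
        using w(2) by (simp add: lift_perm_range[OF inj_b])
    qed
    have wo: "w y = y" if "y \<in> A" "y \<notin> range b" for y
      using w(2)[OF that(1)] that(2) by (simp add: lift_perm_other)
    have iwb: "inv w (b i) = b (inv f i)" for i
      using wb[of "inv f i"] f bw by (metis bij_inv_eq_iff)
    have iwo: "inv w y = y" if "y \<in> A" "y \<notin> range b" for y
      using wo[OF that] bw by (metis bij_inv_eq_iff)
    have iwA: "inv w y \<notin> A" if "y \<notin> A" for y
    proof
      assume "inv w y \<in> A"
      then have "w (inv w y) \<in> A"
        using w(2) Sym_on_mem_iff[OF lift_perm_Sym_on[OF inj_b f bA]] by simp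
      then show False
        using that bw by (simp add: bij_is_surj surj_f_inv_f)
    qed
    have "(w \<circ> p \<circ> (inv w \<circ> p)) y = (lift_perm b f \<circ> lift_perm c (inv f)) y" for y
    proof -
      consider (b) i where "y = b i" | (c) i where "y = c i" | (A) "y \<in> A" "y \<notin> range b" "y \<notin> range c" | (out) "y \<notin> A"
        by blast
      then show ?thesis
      proof cases
        case b
        show ?thesis
          using b cr[of i] by (simp add: pb pc iwo wb lift_perm_other lift_perm_range[OF inj_b])
      next
        case c
        show ?thesis
          using c cr by (simp add: pb pc iwb wo lift_perm_other lift_perm_range[OF inj_c])
      next
        case A
        have "p y \<notin> range b"
          using A(3) pp pb by (metis imageE rangeI)
        then show ?thesis
          using A by (simp add: iwo pA pp wo lift_perm_other)
      next
        case out
        then have "y \<notin> range b" "y \<notin> range c"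
          using bA cA by auto
        then show ?thesis
          using out bw by (simp add: pout iwA lift_perm_other bij_is_surj surj_f_inv_f)
      qed
    qed
    then have "w \<circ> p \<circ> (inv w \<circ> p) = lift_perm b f \<circ> lift_perm c (inv f)"
      by (rule ext)
    moreover have "w \<circ> p \<circ> (inv w \<circ> p) \<in> words W (2 + 2 + (2 + 2))"
      using w(1) p words_inv[OF w(1)] by (intro words_comp) auto
    ultimately show ?thesis
      by simp
  qed
  then show ?thesis
    using that[OF inj_b inj_c] bc by blast
qed

text \<open>On the \<open>b\<close>-copy the map \<open>f \<mapsto> \<psi> f\<close> is a
  homomorphism, on the \<open>c\<close>-copy it reverses products. So
  \<open>\<psi> f \<circ> \<psi> t \<circ> \<psi> (inv (f \<circ> t))\<close> is trivial on the
  former and a commutator of \<open>f\<close> and \<open>t\<close> on the latter. With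
  \<open>f\<close> acting as \<open>h\<close> on all copies from 0 on and \<open>t\<close> the
  shift, the commutator telescopes to \<open>h\<close> on copy -1 alone. The length is 24 = 3 *
  8.\<close>

lemma small_support:
  obtains B where "infinite B" "infinite (- B)" "Sym_on B \<subseteq> words W 24"
proof -
  obtain b c :: "int \<times> nat \<Rightarrow> nat" where inj_b: "inj b" and inj_c: "inj c" and bc: "range b \<inter> range c = {}"
    and psi: "\<And>f. bij f \<Longrightarrow> lift_perm b f \<circ> lift_perm c (inv f) \<in> words W 8"
    using twisted_pairs by metis
  define \<psi> where "\<psi> f = lift_perm b f \<circ> lift_perm c (inv f)" for f
  have bc': "b i \<notin> range c" "c i \<notin> range b" for i
    using bc by blast+
  have \<psi>b: "\<psi> f (b i) = b (f i)" for f i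
    using lift_perm_other[OF bc'(1)] by (simp add: \<psi>_def lift_perm_range[OF inj_b])
  have \<psi>c: "\<psi> f (c i) = c (inv f i)" for f i
    using lift_perm_other[OF bc'(2)] by (simp add: \<psi>_def lift_perm_range[OF inj_c])
  have \<psi>o: "\<psi> f y = y" if "y \<notin> range b" "y \<notin> range c" for f y
    using that by (simp add: \<psi>_def lift_perm_other)
  define \<beta> where "\<beta> x = c (- 1, x)" for x
  have inj_\<beta>: "inj \<beta>"
    using inj_c by (auto simp: \<beta>_def inj_on_def)
  have lift: "lift_perm \<beta> h \<in> words W 24" if h: "bij h" for h
  proof -
    define f where "f = (\<lambda>(i :: int, x). if i \<ge> 0 then (i, h x) else (i, x))"
    define f' where "f' = (\<lambda>(i :: int, x). if i \<ge> 0 then (i, inv h x) else (i, x))"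
    define t where "t = (\<lambda>(i :: int, x :: nat). (i + 1, x))"
    define t' where "t' = (\<lambda>(i :: int, x :: nat). (i - 1, x))"
    have ff: "f \<circ> f' = id" "f' \<circ> f = id"
      using h by (auto simp: f_def f'_def fun_eq_iff bij_is_surj surj_f_inv_f bij_is_inj inv_f_f)
    have tt: "t \<circ> t' = id" "t' \<circ> t = id"
      by (auto simp: t_def t'_def fun_eq_iff)
    have bf: "bij f" and bt: "bij t"
      using ff tt by (auto intro: o_bij)
    have inv_f: "inv f = f'" and inv_t: "inv t = t'"
      using ff tt by (auto intro: inv_unique_comp)
    have bft: "bij (f \<circ> t)"
      using bf bt by (simp add: bij_comp)
    have inv_ft: "inv (f \<circ> t) = t' \<circ> f'"
      using bf bt by (simp add: o_inv_distrib inv_f inv_t)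
    have inv_inv_ft: "inv (inv (f \<circ> t)) = f \<circ> t"
      using bft by (simp add: inv_inv_eq)
    have "(\<psi> f \<circ> \<psi> t \<circ> \<psi> (inv (f \<circ> t))) y = lift_perm \<beta> h y" for y
    proof -
      consider (b) i where "y = b i" | (c) i x where "y = c (i, x)" | (o) "y \<notin> range b" "y \<notin> range c"
        by (metis imageE prod.collapse)
      then show ?thesis
      proof cases
        case b
        have "f (t (inv (f \<circ> t) i)) = i"
          using bft by (metis comp_apply bij_is_surj surj_f_inv_f)
        moreover have "y \<notin> range \<beta>"
          using b bc by (auto simp: \<beta>_def)
        ultimately show ?thesis
          using b by (simp add: \<psi>b lift_perm_other)
      next
        case c
        have "(\<psi> f \<circ> \<psi> t \<circ> \<psi> (inv (f \<circ> t))) y = c (f' (t' (f (t (i, x)))))"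
          using c by (simp add: \<psi>c inv_inv_ft inv_f inv_t)
        also have "\<dots> = (if i = - 1 then \<beta> (h x) else y)"
          using c h by (auto simp: f_def f'_def t_def t'_def \<beta>_def bij_is_inj inv_f_f)
        also have "\<dots> = lift_perm \<beta> h y"
        proof (cases "i = - 1")
          case True
          then show ?thesis
            using c lift_perm_range[OF inj_\<beta>, of h x] by (simp add: \<beta>_def)
        next
          case False
          then have "y \<notin> range \<beta>"
            using c inj_c by (auto simp: \<beta>_def inj_eq)
          then show ?thesis
            using False by (simp add: lift_perm_other)
        qed
        finally show ?thesis .
      next
        case o
        then have "y \<notin> range \<beta>"
          by (auto simp: \<beta>_def)
        then show ?thesis
          using o by (simp add: \<psi>o lift_perm_other)
      qed
    qed
    then have "\<psi> f \<circ> \<psi> t \<circ> \<psi> (inv (f \<circ> t)) = lift_perm \<beta> h"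
      by (rule ext)
    moreover have "\<psi> f \<circ> \<psi> t \<circ> \<psi> (inv (f \<circ> t)) \<in> words W (8 + 8 + 8)"
      using psi bf bt bft bij_imp_bij_inv unfolding \<psi>_def by (intro words_comp) blast+
    ultimately show ?thesis
      by simp
  qed
  show ?thesis
  proof (rule that[of "range \<beta>"])
    show "infinite (range \<beta>)"
      using inj_\<beta> range_inj_infinite by blast
    have "infinite (range b)"
      using inj_b finite_imageD by (metis finite_prod infinite_UNIV_nat infinite_UNIV_int UNIV_Times_UNIV finite_cartesian_product_iff UNIV_not_empty)
    moreover have "range b \<subseteq> - range \<beta>"
      using bc by (auto simp: \<beta>_def)
    ultimately show "infinite (- range \<beta>)"
      using finite_subset by blast
    show "Sym_on (range \<beta>) \<subseteq> words W 24"
    proof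
      fix p assume p: "p \<in> Sym_on (range \<beta>)"
      have inv\<beta>: "\<beta> (inv \<beta> y) = y" if "y \<in> range \<beta>" for y
        using that by (simp add: f_inv_into_f)
      have pr: "p (\<beta> x) \<in> range \<beta>" if "p \<in> Sym_on (range \<beta>)" for p x
        using Sym_on_mem_iff[OF that] by simp
      define h where "h = inv \<beta> \<circ> p \<circ> \<beta>"
      define h' where "h' = inv \<beta> \<circ> inv p \<circ> \<beta>"
      have bp: "bij p"
        using p by (simp add: Sym_on_def)
      have "h \<circ> h' = id" "h' \<circ> h = id"
        using pr[OF p] pr[OF Sym_on_inv[OF p]] inj_\<beta> bp
        by (auto simp: fun_eq_iff h_def h'_def inv\<beta> bij_is_surj surj_f_inv_f bij_is_inj inv_f_f)
      then have "bij h"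
        by (rule o_bij[rotated])
      moreover have "p = lift_perm \<beta> h"
      proof
        fix y
        show "p y = lift_perm \<beta> h y"
        proof (cases "y \<in> range \<beta>")
          case True
          then obtain x where "y = \<beta> x"
            by blast
          then show ?thesis
            using inv\<beta>[OF pr[OF p, of x]] by (simp add: lift_perm_range[OF inj_\<beta>] h_def)
        next
          case False
          then show ?thesis
            using p by (simp add: Sym_on_def lift_perm_other)
        qed
      qed
      ultimately show "p \<in> words W 24"
        using lift by simp
    qed
  qed
qed

text \<open>\<open>C\<close> is the image of \<open>B\<close> under a word \<open>u\<close> of
  length 2, so conjugation gives 28 = 2 + 24 + 2. To control the position of \<open>C\<close>,
  permutations \<open>P x\<close> move \<open>B\<close> onto complements of almost disjoint sets;
  two of them share a translate, and \<open>u\<close> is their quotient. Complements of two such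
  sets together miss only a finite set, and they have all odd numbers in common.\<close>

lemma overlapping_supports:
  obtains B C where "infinite (B \<inter> C)" "finite (- (B \<union> C))" "Sym_on B \<subseteq> words W 24" "Sym_on C \<subseteq> words W 28"
proof -
  obtain B where B: "infinite B" "infinite (- B)" "Sym_on B \<subseteq> words W 24"
    using small_support by blast
  obtain M :: "nat set \<Rightarrow> nat set" where M: "\<And>x. infinite (M x)" "\<And>x y. x \<noteq> y \<Longrightarrow> finite (M x \<inter> M y)"
    "\<And>x. M x \<subseteq> {n. even n}"
    using almost_disjoint_family by metis
  note odd = infinite_odd_nat
  have "\<exists>p. bij p \<and> p ` B = - M x" for x
  proof -
    have "{n. odd n} \<subseteq> - M x"
      using M(3)[of x] by auto
    then have "infinite (- M x)"
      using odd finite_subset by blast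
    then obtain \<phi> where \<phi>: "bij_betw \<phi> B (- M x)"
      using infinite_nat_bij_betw[OF B(1)] by blast
    obtain p where p: "p \<in> Sym_on UNIV" "\<And>y. y \<in> B \<Longrightarrow> p y = \<phi> y"
      by (rule Sym_on_extend[of B UNIV "- M x" \<phi>]) (use B M(1) \<phi> in \<open>auto simp: Compl_eq_Diff_UNIV[symmetric] double_complement\<close>)
    have "p ` B = \<phi> ` B"
      using p(2) by auto
    then have "bij p \<and> p ` B = - M x"
      using p(1) \<phi> by (simp add: Sym_on_def bij_betw_def)
    then show ?thesis
      by blast
  qed
  then obtain P where P: "\<And>x. bij (P x)" "\<And>x. P x ` B = - M x"
    by metis
  obtain x y where xy: "x \<noteq> y" "inv (P x) \<circ> P y \<in> words W 2"
    using uncountable_family[of P] P(1) by metis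
  define u where "u = inv (P x) \<circ> P y"
  have bu: "bij u"
    unfolding u_def using P(1) by (simp add: bij_comp bij_imp_bij_inv)
  define C where "C = u ` B"
  have PC: "P x ` C = - M y"
  proof -
    have "P x ` C = P x ` (inv (P x) ` (P y ` B))"
      by (simp add: C_def u_def image_image)
    also have "\<dots> = P y ` B"
      by (rule image_f_inv_f[OF bij_is_surj[OF P(1)]])
    finally show ?thesis
      using P(2) by simp
  qed
  have injx: "inj (P x)"
    using P(1) by (simp add: bij_is_inj)
  have "P x ` (B \<inter> C) = - (M x \<union> M y)"
    using P(2)[of x] PC injx by (simp add: image_Int)
  moreover have "{n. odd n} \<subseteq> - (M x \<union> M y)"
    using M(3)[of x] M(3)[of y] by auto
  then have "infinite (- (M x \<union> M y))"
    using odd finite_subset by blast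
  ultimately have "infinite (B \<inter> C)"
    by (metis finite_imageI)
  moreover have "P x ` (- (B \<union> C)) = M x \<inter> M y"
    unfolding bij_image_Compl_eq[OF P(1)] image_Un P(2) PC by blast
  then have "finite (- (B \<union> C))"
    using M(2)[OF xy(1)] injx by (metis finite_imageD inj_on_subset subset_UNIV)
  moreover have "Sym_on C \<subseteq> words W 28"
  proof
    fix q assume q: "q \<in> Sym_on C"
    have "inv u \<circ> q \<circ> u \<in> Sym_on B"
    proof -
      have "bij (inv u \<circ> q \<circ> u)"
        using q bu by (simp add: Sym_on_def bij_comp bij_imp_bij_inv)
      moreover have "(inv u \<circ> q \<circ> u) z = z" if "z \<notin> B" for z
      proof -
        have "u z \<notin> C"
          using that bu by (auto simp: C_def bij_is_inj inj_eq)
        then show ?thesis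
          using q bu by (simp add: Sym_on_def bij_is_inj inv_f_f)
      qed
      ultimately show ?thesis
        by (simp add: Sym_on_def)
    qed
    then have "inv u \<circ> q \<circ> u \<in> words W 24"
      using B(3) by blast
    moreover have "u \<in> words W 2" "inv u \<in> words W 2"
      using xy(2) words_inv[OF xy(2)] by (auto simp: u_def)
    ultimately have "u \<circ> (inv u \<circ> q \<circ> u) \<circ> inv u \<in> words W (2 + 24 + 2)"
      by (intro words_comp)
    moreover have "u \<circ> (inv u \<circ> q \<circ> u) \<circ> inv u = q"
      using bu by (simp add: fun_eq_iff bij_is_surj surj_f_inv_f)
    ultimately show "q \<in> words W 28"
      by simp
  qed
  ultimately show ?thesis
    using that B(3) by blast
qed

text \<open>\<open>Sym_on (B \<union> C)\<close> is generated in boundedly many steps: carry the image of \<open>C - B\<close> back to its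
  place, using the infinite intersection as room to manoeuvre.\<close>

lemma cofinite_support:
  obtains F where "finite F" "\<And>p. bij p \<Longrightarrow> (\<And>x. x \<in> F \<Longrightarrow> p x = x) \<Longrightarrow> p \<in> words W 104"
proof -
  obtain B C where I: "infinite (B \<inter> C)" and fin: "finite (- (B \<union> C))"
    and SB: "Sym_on B \<subseteq> words W 24" and SC: "Sym_on C \<subseteq> words W 28"
    using overlapping_supports by blast
  have "p \<in> words W 104" if bp: "bij p" and pY: "\<And>x. x \<in> - (B \<union> C) \<Longrightarrow> p x = x" for p
  proof -
    have pS: "p \<in> Sym_on (B \<union> C)"
      using bp pY by (simp add: Sym_on_def)
    define Q where "Q = p ` (C - B)"
    have QY: "Q \<subseteq> B \<union> C"
      using Sym_on_mem_iff[OF pS] by (auto simp: Q_def)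
    obtain I1 where I1: "I1 \<subseteq> B \<inter> C" "infinite I1" "infinite (B \<inter> C - I1)"
      using infinite_nat_split[OF I] by blast
    \<comment> \<open>Extending a map to a permutation of \<open>B\<close> requires infinitely many
      points of \<open>B\<close> outside the set moved. If \<open>Q\<close> leaves too few,
      infinitely many points of \<open>C - B\<close> avoid \<open>Q\<close>, and \<open>c0\<close>
      carries some of them onto \<open>I1\<close>, which is thereby freed.\<close>
    have "\<exists>c0\<in>Sym_on C. infinite (B - c0 ` Q)"
    proof (cases "infinite (B - Q)")
      case True
      then show ?thesis
        by (intro bexI[of _ id]) (auto simp: Sym_on_def)
    next
      case False
      have "p ` B \<subseteq> (B \<union> C) - Q"
        using Sym_on_mem_iff[OF pS] bp by (auto simp: Q_def bij_is_inj inj_eq)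
      moreover have "infinite (p ` B)"
        using bp I by (metis bij_is_inj finite_Int finite_imageD inj_on_subset subset_UNIV)
      ultimately have "infinite ((B \<union> C) - Q)"
        using finite_subset by blast
      moreover have "(B \<union> C) - Q = (B - Q) \<union> (C - B - Q)"
        by auto
      ultimately have "infinite (C - B - Q)"
        using False by simp
      then obtain R where R: "R \<subseteq> C - B - Q" "infinite R" "infinite (C - B - Q - R)"
        using infinite_nat_split by blast
      obtain \<phi> where \<phi>: "bij_betw \<phi> R I1"
        using infinite_nat_bij_betw[OF R(2) I1(2)] by blast
      have "C - B - Q - R \<subseteq> C - R" "B \<inter> C - I1 \<subseteq> C - I1"
        by blast+
      then have "infinite (C - R)" "infinite (C - I1)"
        using R(3) I1(3) finite_subset by blast+
      then obtain c0 where c0: "c0 \<in> Sym_on C" "\<And>x. x \<in> R \<Longrightarrow> c0 x = \<phi> x"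
        using Sym_on_extend[of R C I1 \<phi>] R(1) I1(1) \<phi> by blast
      have "I1 \<subseteq> B - c0 ` Q"
      proof
        fix y assume y: "y \<in> I1"
        then obtain x where x: "x \<in> R" "c0 x = y"
          using \<phi> c0(2) by (auto simp: bij_betw_def)
        have "y \<notin> c0 ` Q"
        proof
          assume "y \<in> c0 ` Q"
          then obtain x' where "x' \<in> Q" "c0 x' = c0 x"
            using x by auto
          then have "x \<in> Q"
            using c0(1) by (simp add: Sym_on_def bij_is_inj inj_eq)
          then show False
            using x(1) R(1) by blast
        qed
        then show "y \<in> B - c0 ` Q"
          using y I1(1) by blast
      qed
      then have "infinite (B - c0 ` Q)"
        using I1(2) finite_subset by blast
      then show ?thesis
        using c0(1) by blast
    qed
    then obtain c0 where c0: "c0 \<in> Sym_on C" "infinite (B - c0 ` Q)"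
      by blast
    define Q1 where "Q1 = c0 ` Q"
    have Q1Y: "Q1 \<subseteq> B \<union> C"
    proof
      fix y assume "y \<in> Q1"
      then obtain x where x: "x \<in> Q" "y = c0 x"
        by (auto simp: Q1_def)
      show "y \<in> B \<union> C"
        using x QY c0(1) Sym_on_mem_iff[OF c0(1), of x] by (cases "x \<in> C") (auto simp: Sym_on_def)
    qed
    \<comment> \<open>\<open>b\<close> will push \<open>Q1 \<inter> B\<close> into
      \<open>I1\<close>. Then the whole image of \<open>C - B\<close> lies in \<open>C\<close>, and
      a permutation of \<open>C\<close> can bring it back; the rest of \<open>B \<inter> C\<close>
      remains as free room.\<close>
    obtain \<phi> :: "nat \<Rightarrow> nat" where \<phi>: "inj \<phi>" "range \<phi> \<subseteq> I1"
      using infinite_countable_subset[OF I1(2)] by blast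
    have "bij_betw \<phi> (Q1 \<inter> B) (\<phi> ` (Q1 \<inter> B))"
      using \<phi>(1) by (auto simp: bij_betw_def inj_on_def)
    moreover have "infinite (B - Q1 \<inter> B)"
      using c0(2) by (simp add: Q1_def Diff_Int)
    moreover have "infinite (B - \<phi> ` (Q1 \<inter> B))"
    proof -
      have "B \<inter> C - I1 \<subseteq> B - \<phi> ` (Q1 \<inter> B)"
        using \<phi>(2) by auto
      then show ?thesis
        using I1(3) finite_subset by blast
    qed
    moreover have "\<phi> ` (Q1 \<inter> B) \<subseteq> B"
      using \<phi>(2) I1(1) by auto
    ultimately obtain b where b: "b \<in> Sym_on B" "\<And>x. x \<in> Q1 \<inter> B \<Longrightarrow> b x = \<phi> x"
      using Sym_on_extend[of "Q1 \<inter> B" B "\<phi> ` (Q1 \<inter> B)" \<phi>] by blast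
    define t where "t = b \<circ> c0 \<circ> p"
    have bt: "bij t"
      using b c0 bp by (simp add: t_def Sym_on_def bij_comp)
    have tQ: "t ` (C - B) = b ` Q1"
      by (simp add: t_def Q1_def Q_def image_comp)
    have bQ: "b x \<in> C \<and> (b x \<in> B \<longrightarrow> b x \<in> I1)" if "x \<in> Q1" for x
    proof (cases "x \<in> B")
      case True
      then have "b x \<in> I1"
        using b(2) that \<phi>(2) by auto
      then show ?thesis
        using I1(1) by auto
    next
      case False
      then show ?thesis
        using b(1) that Q1Y by (auto simp: Sym_on_def)
    qed
    have "bij_betw (inv t) (t ` (C - B)) (C - B)"
      using bt by (metis bij_betw_inv_into_subset bij_betw_imp_inj_on bij_betw_def bij_is_inj inj_on_subset inv_into_image_cancel inj_imp_inv_eq bij_imp_bij_inv image_inv_f_f subset_UNIV)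
    moreover have "t ` (C - B) \<subseteq> C"
      using bQ by (auto simp: tQ)
    moreover have "infinite (C - t ` (C - B))"
    proof -
      have "B \<inter> C - I1 \<subseteq> C - t ` (C - B)"
        using bQ by (auto simp: tQ)
      then show ?thesis
        using I1(3) finite_subset by blast
    qed
    moreover have "infinite (C - (C - B))"
      using I by (simp add: Diff_Diff_Int Int_commute)
    ultimately obtain c where c: "c \<in> Sym_on C" "\<And>x. x \<in> t ` (C - B) \<Longrightarrow> c x = inv t x"
      using Sym_on_extend[of "t ` (C - B)" C "C - B" "inv t"] by blast
    \<comment> \<open>\<open>s\<close> undoes \<open>p\<close> on \<open>C - B\<close>, so what
      remains is supported in \<open>B\<close>. The lengths are 80 = 28 + 24 + 28 for
      \<open>s\<close> and 24 for the remainder, in total 104.\<close>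
    define s where "s = c \<circ> b \<circ> c0"
    have sp: "s \<circ> p \<in> Sym_on B"
    proof -
      have "bij (s \<circ> p)"
        using b c c0 bp by (simp add: s_def Sym_on_def bij_comp)
      moreover have "(s \<circ> p) x = x" if "x \<notin> B" for x
      proof (cases "x \<in> C")
        case True
        then have "c (t x) = inv t (t x)"
          using c(2) that by blast
        then have "c (t x) = x"
          using bt by (simp add: bij_is_inj inv_f_f)
        then show ?thesis
          by (simp add: s_def t_def)
      next
        case False
        then show ?thesis
          using pY[of x] that b(1) c(1) c0(1) by (simp add: s_def Sym_on_def)
      qed
      ultimately show ?thesis
        by (simp add: Sym_on_def)
    qed
    have "s \<in> words W (28 + 24 + 28)"
      unfolding s_def using b(1) c(1) c0(1) SB SC by (intro words_comp) blast+
    then have "inv s \<in> words W 80" "bij s"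
      using words_inv by auto
    then have "inv s \<circ> (s \<circ> p) \<in> words W (80 + 24)"
      using sp SB by (intro words_comp) blast+
    moreover have "inv s \<circ> (s \<circ> p) = p"
      using \<open>bij s\<close> by (simp add: fun_eq_iff bij_is_inj inv_f_f)
    ultimately show ?thesis
      by simp
  qed
  then show ?thesis
    using that fin by blast
qed

end

section \<open>From permutations to partial bijections\<close>

definition graph :: "(nat \<Rightarrow> nat) \<Rightarrow> (nat \<times> nat) set" where
  "graph p = {(x, p x) |x. True}"

lemma graph_comp: "graph (p \<circ> q) = graph q O graph p"
  by (auto simp: graph_def)

lemma graph_id: "graph id = Id"
  by (auto simp: graph_def)

lemma graph_in: "bij p \<Longrightarrow> graph p \<in> sym_inv_monoid"
  by (auto simp: graph_def sym_inv_monoid_iff bij_is_inj inj_eq)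

lemma separable_metrizable_countable_base:
  assumes "metrizable_space X" "separable_space X"
  obtains \<B> where "countable \<B>" "\<And>V. V \<in> \<B> \<Longrightarrow> openin X V"
    "\<And>U x. openin X U \<Longrightarrow> x \<in> U \<Longrightarrow> \<exists>V\<in>\<B>. x \<in> V \<and> V \<subseteq> U"
proof -
  obtain M d where "Metric_space M d" and X: "X = Metric_space.mtopology M d"
    using assms(1) by (auto simp: metrizable_space_def)
  then interpret Metric_space M d
    by simp
  obtain D where D: "countable D" "D \<subseteq> M" "X closure_of D = M"
    using assms(2) by (auto simp: separable_space_def X)
  define \<B> where "\<B> = (\<lambda>(x, n::nat). mball x (1 / Suc n)) ` (D \<times> UNIV)"
  show ?thesis
  proof (rule that[of \<B>])
    show "countable \<B>"
      using D(1) by (simp add: \<B>_def)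
    show "openin X V" if "V \<in> \<B>" for V
      using that by (auto simp: \<B>_def X)
    fix U x assume U: "openin X U" "x \<in> U"
    then have x: "x \<in> M"
      using openin_subset[OF U(1)] by (auto simp: X)
    obtain r where r: "r > 0" "mball x r \<subseteq> U"
      using U unfolding X openin_mtopology by blast
    obtain n where n: "1 / Suc n < r / 2"
      using r(1) nat_approx_posE by (metis half_gt_zero)
    have "x \<in> X closure_of D"
      using D(3) x by simp
    moreover have "openin X (mball x (1 / Suc n))" "x \<in> mball x (1 / Suc n)"
      using x by (auto simp: X)
    ultimately obtain y where y: "y \<in> D" "y \<in> mball x (1 / Suc n)"
      unfolding in_closure_of by blast
    have "mball y (1 / Suc n) \<subseteq> mball x r"
    proof
      fix z assume z: "z \<in> mball y (1 / Suc n)"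
      then have "d x z \<le> d x y + d y z"
        using x y by (intro triangle) auto
      also have "\<dots> < r"
        using y(2) z n by auto
      finally show "z \<in> mball x r"
        using x z by auto
    qed
    moreover have "x \<in> mball y (1 / Suc n)"
      using y(2) by (auto simp: commute)
    ultimately show "\<exists>V\<in>\<B>. x \<in> V \<and> V \<subseteq> U"
      using y(1) r(2) by (intro bexI[of _ "mball y (1 / Suc n)"]) (auto simp: \<B>_def)
  qed
qed

text \<open>The unitary dilation of a partial isometry, on two copies of the naturals (the even and the odd numbers).\<close>

definition dilation :: "(nat \<times> nat) set \<Rightarrow> nat \<Rightarrow> nat" where
  "dilation s x = (let i = x div 2 in
     if even x then (if s `` {i} = {} then 2 * i + 1 else 2 * the_elem (s `` {i}))
     else (if s\<inverse> `` {i} = {} then 2 * i else 2 * the_elem (s\<inverse> `` {i}) + 1))"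

lemma dilation_even:
  assumes "s \<in> sym_inv_monoid"
  shows "(i, j) \<in> s \<Longrightarrow> dilation s (2 * i) = 2 * j" "i \<notin> Domain s \<Longrightarrow> dilation s (2 * i) = Suc (2 * i)"
proof -
  show "dilation s (2 * i) = 2 * j" if "(i, j) \<in> s"
  proof -
    have "s `` {i} = {j}"
      using that sym_inv_monoid_fun[OF assms] by blast
    then show ?thesis
      by (simp add: dilation_def)
  qed
  show "dilation s (2 * i) = Suc (2 * i)" if "i \<notin> Domain s"
  proof -
    have "s `` {i} = {}"
      using that by blast
    then show ?thesis
      by (simp add: dilation_def)
  qed
qed

lemma dilation_odd:
  assumes "s \<in> sym_inv_monoid"
  shows "(i, j) \<in> s \<Longrightarrow> dilation s (Suc (2 * j)) = Suc (2 * i)" "j \<notin> Range s \<Longrightarrow> dilation s (Suc (2 * j)) = 2 * j"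
proof -
  show "dilation s (Suc (2 * j)) = Suc (2 * i)" if "(i, j) \<in> s"
  proof -
    have "s\<inverse> `` {j} = {i}"
      using that sym_inv_monoid_inj[OF assms] by blast
    then show ?thesis
      by (simp add: dilation_def)
  qed
  show "dilation s (Suc (2 * j)) = 2 * j" if "j \<notin> Range s"
  proof -
    have "s\<inverse> `` {j} = {}"
      using that by blast
    then show ?thesis
      by (simp add: dilation_def)
  qed
qed

lemma dilation_converse:
  assumes s: "s \<in> sym_inv_monoid"
  shows "dilation s (dilation (s\<inverse>) x) = x"
proof -
  have s': "s\<inverse> \<in> sym_inv_monoid"
    using s by simp
  show ?thesis
  proof (cases "even x")
    case True
    then obtain j where x: "x = 2 * j"
      by blast
    show ?thesis
    proof (cases "j \<in> Range s")
      case True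
      then obtain i where "(i, j) \<in> s"
        by blast
      then show ?thesis
        using dilation_even(1)[OF s', of j i] dilation_even(1)[OF s, of i j] by (simp add: x)
    next
      case False
      then show ?thesis
        using dilation_even(2)[OF s', of j] dilation_odd(2)[OF s, of j] by (simp add: x)
    qed
  next
    case False
    then obtain i where x: "x = Suc (2 * i)"
      by (metis oddE Suc_eq_plus1)
    show ?thesis
    proof (cases "i \<in> Domain s")
      case True
      then obtain j where "(i, j) \<in> s"
        by blast
      then show ?thesis
        using dilation_odd(1)[OF s', of j i] dilation_odd(1)[OF s, of i j] by (simp add: x)
    next
      case False
      then show ?thesis
        using dilation_odd(2)[OF s', of i] dilation_even(2)[OF s, of i] by (simp add: x)
    qed
  qed
qed

lemma bij_dilation: "s \<in> sym_inv_monoid \<Longrightarrow> bij (dilation s)"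
  using dilation_converse[of s] dilation_converse[of "s\<inverse>"]
  by (intro o_bij[of "dilation (s\<inverse>)"]) (auto simp: fun_eq_iff)

lemma dilation_compress:
  assumes s: "s \<in> sym_inv_monoid"
  shows "{(x, 2 * x) |x. True} O graph (dilation s) O {(2 * y, y) |y. True} = s"
proof (intro equalityI subrelI)
  fix x y assume "(x, y) \<in> {(x, 2 * x) |x. True} O graph (dilation s) O {(2 * y, y) |y. True}"
  then have d: "dilation s (2 * x) = 2 * y"
    by (auto simp: graph_def)
  then have "x \<in> Domain s"
    using dilation_even(2)[OF s, of x] by (metis dvd_triv_left even_Suc)
  then obtain j where j: "(x, j) \<in> s"
    by blast
  then show "(x, y) \<in> s"
    using dilation_even(1)[OF s j] d by simp
next
  fix x y assume "(x, y) \<in> s"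
  then have "dilation s (2 * x) = 2 * y"
    by (rule dilation_even(1)[OF s])
  then show "(x, y) \<in> {(x, 2 * x) |x. True} O graph (dilation s) O {(2 * y, y) |y. True}"
    by (auto simp: graph_def intro!: relcompI[of x "2 * x"] relcompI[of "2 * x" "2 * y"]) 
qed

text \<open>The value at \<open>x\<close> depends only on the image and the preimage of the single
  point \<open>x div 2\<close>, so convergence in both directions is exactly what is
  required.\<close>

lemma dilation_conv:
  assumes "bi_conv h g"
  shows "\<forall>\<^sub>F n in sequentially. dilation (h n) x = dilation g x"
proof -
  have "\<forall>\<^sub>F n in sequentially. h n `` {x div 2} = g `` {x div 2}" "\<forall>\<^sub>F n in sequentially. (h n)\<inverse> `` {x div 2} = g\<inverse> `` {x div 2}"
    using assms unfolding bi_conv_def dom_conv_def by blast+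
  then show ?thesis
    by eventually_elim (simp only: dilation_def Let_def)
qed

context polish_inv_monoid begin

text \<open>Continuity of multiplication at the identity, iterated. \<open>W\<close> is quantified
  after \<open>U\<close> because the set to which this is applied is built from
  \<open>U\<close>.\<close>

lemma small_words:
  assumes "openin T V" "Id \<in> V"
  shows "\<exists>U. openin T U \<and> Id \<in> U \<and> (\<forall>W. graph ` W \<subseteq> U \<longrightarrow> graph ` words W k \<subseteq> V)"
  using assms
proof (induction k arbitrary: V)
  case 0
  then show ?case
    by (intro exI[of _ V]) (simp add: graph_id del: id_apply)
next
  case (Suc k)
  have I: "Id \<in> sym_inv_monoid"
    by (auto simp: sym_inv_monoid_iff)
  have "Id O Id \<in> V"
    using Suc.prems by simp
  then obtain V1 V2 where V: "openin T V1" "openin T V2" "Id \<in> V1" "Id \<in> V2" "\<And>a b. a \<in> V1 \<Longrightarrow> b \<in> V2 \<Longrightarrow> a O b \<in> V"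
    using mult_nhds[OF I I Suc.prems(1)] by metis
  obtain U where U: "openin T U" "Id \<in> U" "\<And>W. graph ` W \<subseteq> U \<Longrightarrow> graph ` words W k \<subseteq> V1"
    using Suc.IH[OF V(1,3)] by blast
  show ?case
  proof (intro exI[of _ "U \<inter> V2"] conjI allI impI)
    show "graph ` words W (Suc k) \<subseteq> V" if W: "graph ` W \<subseteq> U \<inter> V2" for W
    proof
      fix r assume "r \<in> graph ` words W (Suc k)"
      then obtain w v where "r = graph v O graph w" "w \<in> W" "v \<in> words W k"
        by (auto simp: graph_comp)
      moreover have "graph ` words W k \<subseteq> V1"
        using U(3) W by blast
      ultimately show "r \<in> V"
        using V(5) W by blast
    qed
  qed (use U V in auto)
qed

text \<open>Inversion is not known to be continuous in \<open>T\<close>, so a permutation and its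
  inverse have to be approximated simultaneously: one representative is chosen for each pair of
  basic open sets that admits one.\<close>

lemma countable_cover:
  assumes "openin T U" "Id \<in> U"
  obtains d :: "nat \<Rightarrow> nat \<Rightarrow> nat" where "\<And>n. bij (d n)"
    "\<And>p. bij p \<Longrightarrow> \<exists>n. graph (inv (d n) \<circ> p) \<in> U \<and> graph (inv (inv (d n) \<circ> p)) \<in> U"
proof -
  have "separable_space T"
    using polish by (simp add: polish_semigroup_topologies_def polish_topology_def)
  then obtain \<B> where \<B>: "countable \<B>" "\<And>V. V \<in> \<B> \<Longrightarrow> openin T V"
    "\<And>V r. openin T V \<Longrightarrow> r \<in> V \<Longrightarrow> \<exists>B\<in>\<B>. r \<in> B \<and> B \<subseteq> V"
    using separable_metrizable_countable_base[OF metrizable_T] by metis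
  define good where "good P d \<longleftrightarrow> bij d \<and> graph d \<in> fst P \<and> graph (inv d) \<in> snd P"
    for P :: "(nat \<times> nat) set set \<times> (nat \<times> nat) set set" and d :: "nat \<Rightarrow> nat"
  define D where "D = insert id ((\<lambda>P. SOME d. good P d) ` {P \<in> \<B> \<times> \<B>. \<exists>d. good P d})"
  have "countable D"
    using \<B>(1) by (auto simp: D_def intro!: countable_image countable_subset[of _ "\<B> \<times> \<B>"])
  then obtain d :: "nat \<Rightarrow> nat \<Rightarrow> nat" where d: "range d = D"
    using uncountable_def[of D] by (auto simp: D_def)
  show ?thesis
  proof (rule that[of d])
    show "bij (d n)" for n
    proof -
      have "d n \<in> D"
        using d by blast
      then consider "d n = id" | P where "\<exists>e. good P e" "d n = (SOME e. good P e)"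
        unfolding D_def by blast
      then show ?thesis
      proof cases
        case 2
        then show ?thesis
          using someI_ex[OF 2(1)] by (simp add: good_def)
      qed simp
    qed
    fix p :: "nat \<Rightarrow> nat" assume p: "bij p"
    have p': "bij (inv p)"
      by (rule bij_imp_bij_inv[OF p])
    have "graph p O graph (inv p) = Id"
      using p by (auto simp: graph_def bij_is_inj inv_f_f)
    then obtain A1 A2 where A: "openin T A1" "openin T A2" "graph p \<in> A1" "graph (inv p) \<in> A2"
      "\<And>a b. a \<in> A1 \<Longrightarrow> b \<in> A2 \<Longrightarrow> a O b \<in> U"
      using mult_nhds[OF graph_in[OF p] graph_in[OF p'] assms(1)] assms(2) by metis
    obtain B1 B2 where B: "B1 \<in> \<B>" "graph p \<in> B1" "B1 \<subseteq> A1" "B2 \<in> \<B>" "graph (inv p) \<in> B2" "B2 \<subseteq> A2"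
      using \<B>(3) A(1-4) by metis
    have "good (B1, B2) p"
      using p B by (simp add: good_def)
    then have g: "good (B1, B2) (SOME d. good (B1, B2) d)"
      by (rule someI[of "good (B1, B2)"])
    have "(SOME d. good (B1, B2) d) \<in> D"
      using B(1,4) g by (auto simp: D_def intro!: image_eqI)
    then obtain n where n: "d n = (SOME d. good (B1, B2) d)"
      using d by (metis imageE)
    have dn: "bij (d n)" "graph (d n) \<in> A1" "graph (inv (d n)) \<in> A2"
      using g B(3,6) unfolding n good_def by auto
    have "graph (inv (d n) \<circ> p) \<in> U"
      using A(3,5) dn by (simp add: graph_comp)
    moreover have "inv (inv (d n) \<circ> p) = inv p \<circ> d n"
      using p dn(1) by (simp add: o_inv_distrib bij_imp_bij_inv inv_inv_eq)
    then have "graph (inv (inv (d n) \<circ> p)) \<in> U"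
      using A(4,5) dn by (simp add: graph_comp)
    ultimately show "\<exists>n. graph (inv (d n) \<circ> p) \<in> U \<and> graph (inv (inv (d n) \<circ> p)) \<in> U"
      by blast
  qed
qed

text \<open>Take \<open>U\<close> so small that words of length 104 stay in \<open>V\<close>. The
  part of \<open>U\<close> closed under inverses satisfies \<open>steinhaus\<close>, so its words of
  that length include all permutations fixing some finite set, hence almost all
  \<open>p n\<close>.\<close>

lemma lim_graph_id:
  fixes p :: "nat \<Rightarrow> nat \<Rightarrow> nat"
  assumes p: "\<And>n. bij (p n)" "\<And>x. \<forall>\<^sub>F n in sequentially. p n x = x"
  shows "limitin T (\<lambda>n. graph (p n)) Id sequentially"
  unfolding limitin_def
proof (intro conjI allI impI)
  show "Id \<in> topspace T"
    by (auto simp: sym_inv_monoid_iff)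
  fix V assume V: "openin T V \<and> Id \<in> V"
  obtain U where U: "openin T U" "Id \<in> U" "\<And>W. graph ` W \<subseteq> U \<Longrightarrow> graph ` words W 104 \<subseteq> V"
    using small_words V by meson
  obtain d :: "nat \<Rightarrow> nat \<Rightarrow> nat" where d: "\<And>n. bij (d n)"
    "\<And>p. bij p \<Longrightarrow> \<exists>n. graph (inv (d n) \<circ> p) \<in> U \<and> graph (inv (inv (d n) \<circ> p)) \<in> U"
    using countable_cover[OF U(1,2)] by metis
  define W where "W = {w. bij w \<and> graph w \<in> U \<and> graph (inv w) \<in> U}"
  interpret steinhaus W d
  proof
    show "\<exists>n. inv (d n) \<circ> p \<in> W" if "bij p" for p
      using d(2)[OF that] d(1) that by (auto simp: W_def bij_comp bij_imp_bij_inv)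
  qed (use d(1) in \<open>auto simp: W_def bij_imp_bij_inv inv_inv_eq\<close>)
  obtain F where F: "finite F" "\<And>p. bij p \<Longrightarrow> (\<And>x. x \<in> F \<Longrightarrow> p x = x) \<Longrightarrow> p \<in> words W 104"
    using cofinite_support by blast
  have "\<forall>\<^sub>F n in sequentially. \<forall>x\<in>F. p n x = x"
    using F(1) p(2) by (intro eventually_ball_finite) auto
  then show "\<forall>\<^sub>F n in sequentially. graph (p n) \<in> V"
  proof (rule eventually_mono)
    fix n assume "\<forall>x\<in>F. p n x = x"
    then have "p n \<in> words W 104"
      using F(2) p(1) by blast
    moreover have "graph ` W \<subseteq> U"
      by (auto simp: W_def)
    ultimately show "graph (p n) \<in> V"
      using U(3) by blast
  qed
qed

text \<open>The dilations converge in the symmetric group, and \<open>h n\<close> is a corner of its dilation.\<close>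

lemma lim_bi_conv:
  assumes h: "\<And>n. h n \<in> sym_inv_monoid" and g: "g \<in> sym_inv_monoid" and conv: "bi_conv h g"
  shows "limitin T h g sequentially"
proof -
  define p where "p n = inv (dilation g) \<circ> dilation (h n)" for n
  have bg: "bij (dilation g)"
    by (rule bij_dilation[OF g])
  have "limitin T (\<lambda>n. graph (p n)) Id sequentially"
  proof (rule lim_graph_id)
    show "bij (p n)" for n
      unfolding p_def by (intro bij_comp bij_imp_bij_inv bij_dilation h g)
    show "\<forall>\<^sub>F n in sequentially. p n x = x" for x
      using dilation_conv[OF conv, of x] by (rule eventually_mono) (simp add: p_def bij_is_inj[OF bg])
  qed
  from lim_mult_right[OF graph_in[OF bg] this]
  have "limitin T (\<lambda>n. graph (p n) O graph (dilation g)) (Id O graph (dilation g)) sequentially" .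
  moreover have "graph (p n) O graph (dilation g) = graph (dilation (h n))" for n
    unfolding graph_comp[symmetric] p_def
    by (rule arg_cong[of _ _ graph]) (simp add: fun_eq_iff surj_f_inv_f[OF bij_is_surj[OF bg]])
  ultimately have lim: "limitin T (\<lambda>n. graph (dilation (h n))) (graph (dilation g)) sequentially"
    by simp
  have "{(x, 2 * x) |x::nat. True} \<in> sym_inv_monoid" "{(2 * y, y) |y::nat. True} \<in> sym_inv_monoid"
    by (auto simp: sym_inv_monoid_iff)
  from lim_mult_left[OF this(1) lim_mult_right[OF this(2) lim]] show ?thesis
    unfolding dilation_compress[OF h] dilation_compress[OF g] .
qed

end

section \<open>Gaining image points\<close>

text \<open>The \<open>l\<close> additional image points stay put, while their preimages, distinct
  for all pairs \<open>(n, j)\<close>, escape to infinity. As maps these elements therefore converge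
  pointwise to the identity on \<open>r\<close> points.\<close>

definition far_ext :: "nat \<Rightarrow> nat \<Rightarrow> nat \<Rightarrow> (nat \<times> nat) set" where
  "far_ext r l n = Id_on {..<r} \<union> {(r + prod_encode (n, j), r + j) |j. j < l}"

text \<open>In \<open>T\<close>, elements of rank \<open>r\<close> can be approached by elements with \<open>l\<close> additional image points.\<close>

definition gain :: "(nat \<times> nat) set topology \<Rightarrow> nat \<Rightarrow> nat \<Rightarrow> bool" where
  "gain T r l \<longleftrightarrow> limitin T (far_ext r l) (Id_on {..<r}) sequentially"

lemma far_ext_in [simp]: "far_ext r l n \<in> sym_inv_monoid"
  unfolding far_ext_def sym_inv_monoid_iff by auto

lemma Range_far_ext: "Range (far_ext r l n) = {..<r + l}"
proof -
  have "y \<in> Range (far_ext r l n)" if "y < r + l" for y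
  proof (cases "y < r")
    case False
    then have "(r + prod_encode (n, y - r), y) \<in> far_ext r l n"
      using that unfolding far_ext_def by (auto intro!: exI[of _ "y - r"])
    then show ?thesis
      by blast
  qed (auto simp: far_ext_def)
  moreover have "Range (far_ext r l n) \<subseteq> {..<r + l}"
    by (auto simp: far_ext_def)
  ultimately show ?thesis
    by auto
qed

locale left_topology = polish_inv_monoid +
  assumes left: "left_determined T"
begin

lemma lim_dom_conv: "(\<And>n. h n \<in> sym_inv_monoid) \<Longrightarrow> limitin T h g sequentially \<Longrightarrow> dom_conv h g"
  using left by (auto simp: left_determined_def)

text \<open>Both factors of \<open>h n = (h n O (w n)\<inverse>) O w n\<close> converge.\<close>

lemma lim_of_Range_subset:
  assumes h: "\<And>n. h n \<in> sym_inv_monoid" and hg: "dom_conv h g" and w: "\<And>n. w n \<in> sym_inv_monoid"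
    and wg: "limitin T w g sequentially" and R: "\<And>n. Range (h n) \<subseteq> Range (w n)"
  shows "limitin T h g sequentially"
proof -
  define u where "u n = h n O (w n)\<inverse>" for n
  have u: "u n \<in> sym_inv_monoid" for n
    unfolding u_def using h w by (simp add: sym_inv_monoid_comp)
  have dw: "dom_conv w g"
    using lim_dom_conv w wg by blast
  have diag: "\<forall>\<^sub>F n in sequentially. (x, x) \<in> u n" if "(x, y) \<in> g" for x y
    using dom_conv_mem[OF hg that] dom_conv_mem[OF dw that] by eventually_elim (auto simp: u_def)
  have "dom_conv u (Id_on (Domain g))"
  proof (rule dom_convI)
    show "\<forall>\<^sub>F n in sequentially. x \<notin> Domain (u n)" if "x \<notin> Domain (Id_on (Domain g))" for x
    proof -
      have "x \<notin> Domain g"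
        using that by auto
      from dom_conv_notin[OF hg this] show ?thesis
        by (rule eventually_mono) (auto simp: u_def)
    qed
  qed (use u diag in auto)
  moreover have "dom_conv (\<lambda>n. (u n)\<inverse>) ((Id_on (Domain g))\<inverse>)"
  proof (rule dom_convI)
    show "\<forall>\<^sub>F n in sequentially. x \<notin> Domain ((u n)\<inverse>)" if "x \<notin> Domain ((Id_on (Domain g))\<inverse>)" for x
    proof -
      have "x \<notin> Domain g"
        using that by auto
      from dom_conv_notin[OF dw this] show ?thesis
        by (rule eventually_mono) (auto simp: u_def)
    qed
  qed (use u diag in auto)
  ultimately have "limitin T u (Id_on (Domain g)) sequentially"
    using u by (intro lim_bi_conv) (auto simp: bi_conv_def)
  from lim_mult[OF this wg] have "limitin T (\<lambda>n. u n O w n) (Id_on (Domain g) O g) sequentially" .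
  moreover have "Id_on (Domain g) O g = g"
    by auto
  moreover have "u n O w n = h n" for n
  proof
    show "u n O w n \<subseteq> h n"
      unfolding u_def using sym_inv_monoid_fun[OF w[of n]] by blast
    show "h n \<subseteq> u n O w n"
    proof clarify
      fix x y assume xy: "(x, y) \<in> h n"
      then obtain z where "(z, y) \<in> w n"
        using R[of n] by blast
      with xy show "(x, y) \<in> u n O w n"
        unfolding u_def by blast
    qed
  qed
  ultimately show ?thesis
    by simp
qed

text \<open>Relabelling by \<open>p\<close> on the left and \<open>q\<close> on the right carries
  the standard sequence over to any limit of the same rank and any set of new points of the same
  size.\<close>

lemma gain_realize:
  assumes "gain T (card g) (card Z)" "g \<in> sym_inv_monoid" "finite g" "finite Z" "Z \<inter> Range g = {}"
  obtains w where "\<And>n. w n \<in> sym_inv_monoid" "\<And>n. finite (w n)" "\<And>n. Range (w n) = Range g \<union> Z"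
    "limitin T w g sequentially"
proof -
  define r where "r = card g"
  define l where "l = card Z"
  obtain e where e: "bij_betw e {..<r} g"
    using ex_bij_betw_nat_finite[OF \<open>finite g\<close>] by (auto simp: r_def atLeast0LessThan)
  obtain z where z: "bij_betw z {..<l} Z"
    using ex_bij_betw_nat_finite[OF \<open>finite Z\<close>] by (auto simp: l_def atLeast0LessThan)
  define a b where "a = fst \<circ> e" and "b = snd \<circ> e"
  have inj: "i = j" if "i < r" "j < r" "a i = a j \<or> b i = b j" for i j
  proof -
    have "e i \<in> g" "e j \<in> g"
      using e that by (auto dest: bij_betwE)
    then have "e i = e j"
      using that(3) sym_inv_monoid_fun[OF assms(2)] sym_inv_monoid_inj[OF assms(2)]
      by (cases "e i"; cases "e j") (auto simp: a_def b_def)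
    then show ?thesis
      using e that by (auto simp: bij_betw_def inj_on_def)
  qed
  have ge: "g = {(a i, b i) |i. i < r}"
    using e by (auto simp: bij_betw_def a_def b_def)
  have Ze: "Z = {z j |j. j < l}"
    using z by (auto simp: bij_betw_def)
  have zinj: "i = j" if "i < l" "j < l" "z i = z j" for i j
    using z that by (auto simp: bij_betw_def inj_on_def)
  have zb: "z j \<noteq> b i" if "i < r" "j < l" for i j
    using assms(5) that by (auto simp: ge Ze)
  have "infinite (- Domain g)"
    using assms(3) by (simp add: finite_Domain Compl_eq_Diff_UNIV)
  then obtain c :: "nat \<Rightarrow> nat" where c: "inj c" "range c \<subseteq> - Domain g"
    using infinite_countable_subset by blast
  have ca: "c i \<noteq> a j" if "j < r" for i j
    using c(2) that by (auto simp: ge)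
  define p where "p = {(a i, i) |i. i < r} \<union> {(c k, r + k) |k. True}"
  define q where "q = {(i, b i) |i. i < r} \<union> {(r + j, z j) |j. j < l}"
  have p: "p \<in> sym_inv_monoid"
    unfolding p_def sym_inv_monoid_iff using inj injD[OF c(1)] ca ca[THEN not_sym] by auto
  have q: "q \<in> sym_inv_monoid"
    unfolding q_def sym_inv_monoid_iff using inj zinj zb by auto metis+
  define w where "w n = {(a i, b i) |i. i < r} \<union> {(c (prod_encode (n, j)), z j) |j. j < l}" for n
  have pq: "p O far_ext r l n O q = w n" for n
    unfolding p_def q_def far_ext_def w_def by (auto simp: relcomp_unfold) 
  have pg: "p O Id_on {..<r} O q = g"
    unfolding ge p_def q_def by auto
  have "limitin T (\<lambda>n. p O (far_ext r l n O q)) (p O Id_on {..<r} O q) sequentially"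
    using assms(1) unfolding gain_def r_def[symmetric] l_def[symmetric]
    by (intro lim_mult_left lim_mult_right p q)
  then have "limitin T w g sequentially"
    unfolding pq pg by simp
  moreover have "w n \<in> sym_inv_monoid" for n
    using sym_inv_monoid_comp[OF p sym_inv_monoid_comp[OF far_ext_in[of r l n] q]] unfolding pq .
  moreover have "finite (w n)" "Range (w n) = Range g \<union> Z" for n
    by (auto simp: w_def ge Ze)
  ultimately show ?thesis
    using that by blast
qed

text \<open>The way back from an arbitrary sequence to the standard one. By \<open>lim_entry\<close>
  the preimages of points of \<open>Z\<close> leave every finite set; a subsequence makes them
  distinct, and relabelling yields \<open>far_ext\<close>. Restricting to \<open>R\<close> lowers
  the rank, which also gives access to infinite \<open>g\<close>.\<close>

lemma gainI:
  assumes h: "\<And>n. h n \<in> sym_inv_monoid" and hg: "limitin T h g sequentially"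
    and fr: "\<exists>\<^sub>F n in sequentially. Z \<subseteq> Range (h n)" and Z: "finite Z" "Z \<inter> Range g = {}" "card Z = l"
    and R: "finite R" "R \<subseteq> Range g" "card R = r"
  shows "gain T r l"
proof -
  have g: "g \<in> sym_inv_monoid"
    using lim_in hg by blast
  obtain b where b: "bij_betw b {..<r} R"
    using ex_bij_betw_nat_finite[OF R(1)] R(3) by (auto simp: atLeast0LessThan)
  obtain z where z: "bij_betw z {..<l} Z"
    using ex_bij_betw_nat_finite[OF Z(1)] Z(3) by (auto simp: atLeast0LessThan)
  have bg: "b i \<in> Range g" if "i < r" for i
    using b R(2) that by (auto dest: bij_betwE)
  define a where "a i = (SOME x. (x, b i) \<in> g)" for i
  have a: "(a i, b i) \<in> g" if "i < r" for i
    using bg[OF that] unfolding a_def by (auto intro: someI)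
  have binj: "i = j" if "i < r" "j < r" "b i = b j" for i j
    using b that by (auto simp: bij_betw_def inj_on_def)
  have ainj: "i = j" if "i < r" "j < r" "a i = a j" for i j
    using a[OF that(1)] a[OF that(2)] that binj sym_inv_monoid_fun[OF g] by metis
  have zinj: "i = j" if "i < l" "j < l" "z i = z j" for i j
    using z that by (auto simp: bij_betw_def inj_on_def)
  have zZ: "z j \<in> Z" if "j < l" for j
    using z that by (auto dest: bij_betwE)
  have zg: "z j \<notin> Range g" if "j < l" for j
    using zZ[OF that] Z(2) by blast
  have zb: "z j \<noteq> b i" if "i < r" "j < l" for i j
    using zg[OF that(2)] bg[OF that(1)] by metis
  define P where "P n \<longleftrightarrow> Z \<subseteq> Range (h n) \<and> (\<forall>i<r. (a i, b i) \<in> h n)" for n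
  have "\<forall>\<^sub>F n in sequentially. \<forall>i\<in>{..<r}. (a i, b i) \<in> h n"
  proof (intro eventually_ball_finite ballI)
    fix i assume "i \<in> {..<r}"
    then show "\<forall>\<^sub>F n in sequentially. (a i, b i) \<in> h n"
      using lim_entry[OF h hg, of "a i" "b i"] a[of i] by simp
  qed simp
  from frequently_eventually_conj[OF fr this] have frP: "\<exists>\<^sub>F n in sequentially. P n"
    by (rule frequently_elim1) (auto simp: P_def)
  define \<alpha> where "\<alpha> n j = (SOME x. (x, z j) \<in> h n)" for n j
  have \<alpha>: "(\<alpha> n j, z j) \<in> h n" if "P n" "j < l" for n j
  proof -
    have "z j \<in> Range (h n)"
      using that zZ by (auto simp: P_def)
    then show ?thesis
      unfolding \<alpha>_def by (auto intro: someI)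
  qed
  have \<alpha>a: "\<alpha> n j \<noteq> a i" if "P n" "j < l" "i < r" for n i j
    using \<alpha>[OF that(1,2)] zb[OF that(3,2)] sym_inv_monoid_fun[OF h] that unfolding P_def by metis
  \<comment> \<open>\<open>M m\<close> bounds the preimages of \<open>Z\<close> at stage
    \<open>m\<close>, and \<open>Q\<close> puts those of the next chosen stage beyond it, so that
    different stages never share a preimage.\<close>
  define M where "M n = Max (insert 0 (\<alpha> n ` {..<l}))" for n
  have M: "\<alpha> n j \<le> M n" if "j < l" for n j
    unfolding M_def using that by auto
  define Q where "Q m n \<longleftrightarrow> (\<forall>x\<in>{..M m}. \<forall>j\<in>{..<l}. (x, z j) \<notin> h n)" for m n
  have "\<forall>\<^sub>F n in sequentially. Q m n" for m
    unfolding Q_def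
  proof (intro eventually_ball_finite ballI)
    fix x j assume "j \<in> {..<l}"
    then show "\<forall>\<^sub>F n in sequentially. (x, z j) \<notin> h n"
      using lim_entry[OF h hg, of x "z j"] zg[of j] by (auto elim!: eventually_mono)
  qed auto
  then obtain k :: "nat \<Rightarrow> nat" where k: "strict_mono k" "\<And>i. P (k i)" "\<And>i. Q (k i) (k (Suc i))"
    using subseq_chain[of P Q, OF frP] by metis
  define \<beta> where "\<beta> i j = \<alpha> (k i) j" for i j
  have step: "M (k i) < \<beta> (Suc i) j" if "j < l" for i j
  proof (rule ccontr)
    assume "\<not> ?thesis"
    then show False
      using k(3)[of i] \<alpha>[OF k(2) that, of "Suc i"] that by (auto simp: Q_def \<beta>_def)
  qed
  have lt: "M (k i) < \<beta> i' j" if "i < i'" "j < l" for i i' j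
    using that(1)
  proof (induction i' rule: less_Suc_induct)
    case (1 i)
    then show ?case
      using step that by blast
  next
    case (2 i j' k')
    then show ?case
      using M[of j "k j'"] that(2) unfolding \<beta>_def by (meson order.strict_trans le_less_trans)
  qed
  have \<beta>inj: "i = i' \<and> j = j'" if "\<beta> i j = \<beta> i' j'" "j < l" "j' < l" for i i' j j'
  proof -
    have "\<not> i < i'" "\<not> i' < i"
      using lt[of i i' j'] lt[of i' i j] M[of j "k i"] M[of j' "k i'"] that by (auto simp: \<beta>_def)
    then have "i = i'"
      by simp
    moreover have "z j = z j'"
      using \<alpha>[OF k(2)[of i] that(2)] \<alpha>[OF k(2)[of i] that(3)] that(1) sym_inv_monoid_fun[OF h]
      unfolding \<open>i = i'\<close> \<beta>_def by metis
    ultimately show ?thesis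
      using zinj that by blast
  qed
  have \<beta>a: "\<beta> i' j \<noteq> a i" if "j < l" "i < r" for i i' j
    using \<alpha>a k(2) that by (simp add: \<beta>_def)
  \<comment> \<open>A single injective \<open>p\<close> has to relabel all stages at once; this is
    why the preimages were spaced out.\<close>
  define p where "p = {(i, a i) |i. i < r} \<union> {(r + prod_encode (i, j), \<beta> i j) |i j. j < l}"
  define q where "q = {(b i, i) |i. i < r} \<union> {(z j, r + j) |j. j < l}"
  have p: "p \<in> sym_inv_monoid"
    unfolding sym_inv_monoid_iff
  proof (intro conjI allI impI)
    fix x y z assume "(x, y) \<in> p \<and> (x, z) \<in> p"
    then show "y = z"
      by (auto simp: p_def)
  next
    fix x y z assume "(x, z) \<in> p \<and> (y, z) \<in> p"
    then show "x = y"
      by (auto simp: p_def \<beta>a \<beta>a[THEN not_sym] dest: ainj \<beta>inj)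
  qed
  have q: "q \<in> sym_inv_monoid"
    unfolding sym_inv_monoid_iff
  proof (intro conjI allI impI)
    fix x y z assume "(x, y) \<in> q \<and> (x, z) \<in> q"
    then show "y = z"
      by (auto simp: q_def zb zb[THEN not_sym] dest: binj zinj)
  next
    fix x y z assume "(x, z) \<in> q \<and> (y, z) \<in> q"
    then show "x = y"
      by (auto simp: q_def)
  qed
  have "p O h (k n) O q = far_ext r l n" for n
  proof
    have kb: "(a i, b i) \<in> h (k n)" if "i < r" for i
      using k(2) that by (auto simp: P_def)
    have kz: "(\<beta> n j, z j) \<in> h (k n)" if "j < l" for j
      using \<alpha>[OF k(2) that] by (simp add: \<beta>_def)
    show "far_ext r l n \<subseteq> p O h (k n) O q"
    proof
      fix xy assume "xy \<in> far_ext r l n"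
      then consider i where "i < r" "xy = (i, i)" | j where "j < l" "xy = (r + prod_encode (n, j), r + j)"
        by (auto simp: far_ext_def)
      then show "xy \<in> p O h (k n) O q"
      proof cases
        case 1
        then have "(i, a i) \<in> p" "(b i, i) \<in> q"
          by (auto simp: p_def q_def)
        then show ?thesis
          using kb 1 by blast
      next
        case 2
        then have "(r + prod_encode (n, j), \<beta> n j) \<in> p" "(z j, r + j) \<in> q"
          by (auto simp: p_def q_def)
        then show ?thesis
          using kz 2 by blast
      qed
    qed
    show "p O h (k n) O q \<subseteq> far_ext r l n"
    proof clarify
      fix x u v y assume xu: "(x, u) \<in> p" and uv: "(u, v) \<in> h (k n)" and vy: "(v, y) \<in> q"
      consider (b) i where "i < r" "v = b i" "y = i" | (z) j where "j < l" "v = z j" "y = r + j"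
        using vy by (auto simp: q_def)
      then show "(x, y) \<in> far_ext r l n"
      proof cases
        case b
        then have "u = a i"
          using sym_inv_monoid_inj[OF h uv] kb by blast
        then have "x = i"
          using xu b ainj \<beta>a by (auto simp: p_def) metis+
        then show ?thesis
          using b by (auto simp: far_ext_def)
      next
        case z
        then have "u = \<beta> n j"
          using sym_inv_monoid_inj[OF h uv] kz by blast
        then have "x = r + prod_encode (n, j)"
          using xu z(1) by (auto simp: p_def \<beta>a dest!: \<beta>inj)
        then show ?thesis
          using z by (auto simp: far_ext_def)
      qed
    qed
  qed
  then have "((\<lambda>n. p O h n O q) \<circ> k) = far_ext r l"
    by (simp add: comp_def)
  moreover have "p O g O q = Id_on {..<r}"
  proof
    show "Id_on {..<r} \<subseteq> p O g O q"
      unfolding p_def q_def using a by blast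
    show "p O g O q \<subseteq> Id_on {..<r}"
    proof clarify
      fix x u v y assume xu: "(x, u) \<in> p" and uv: "(u, v) \<in> g" and vy: "(v, y) \<in> q"
      have "v \<noteq> z j" if "j < l" for j
        using zg[OF that] uv by blast
      then have y: "y < r" "v = b y"
        using vy by (auto simp: q_def)
      then have "u = a y"
        using sym_inv_monoid_inj[OF g uv] a by blast
      then have "x = y"
        using xu y ainj \<beta>a by (auto simp: p_def) metis+
      then show "(x, y) \<in> Id_on {..<r}"
        using y by auto
    qed
  qed
  moreover have "limitin T ((\<lambda>n. p O h n O q) \<circ> k) (p O g O q) sequentially"
    by (rule limitin_subsequence[OF k(1)]) (intro lim_mult_left lim_mult_right p q hg)
  ultimately show ?thesis
    by (simp add: gain_def)
qed

text \<open>\<open>gainI\<close> for the standard sequence itself, with some of its points ignored.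
  This is the down-set property.\<close>

lemma gain_mono:
  assumes "gain T r l" "r' \<le> r" "l' \<le> l"
  shows "gain T r' l'"
proof (rule gainI)
  show "limitin T (far_ext r l) (Id_on {..<r}) sequentially"
    using assms(1) by (simp add: gain_def)
  show "\<exists>\<^sub>F n in sequentially. {r..<r + l'} \<subseteq> Range (far_ext r l n)"
    by (rule eventually_frequently) (use assms(3) in \<open>auto simp: Range_far_ext\<close>)
  show "{..<r'} \<subseteq> Range (Id_on {..<r})"
    using assms(2) by auto
qed auto

text \<open>Distant fixed points disappear both as arguments and as values, so
  \<open>lim_bi_conv\<close> applies. Thus a finite element can be given a cofinite image at no cost
  in any topology of the class.\<close>

lemma lim_cofinite_ext:
  assumes "w \<in> sym_inv_monoid" "finite w"
  obtains N where "\<And>j. w \<union> Id_on {N + j..} \<in> sym_inv_monoid"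
    "limitin T (\<lambda>j. w \<union> Id_on {N + j..}) w sequentially"
proof -
  have "finite (Domain w \<union> Range w)"
    using assms(2) by (simp add: finite_Domain finite_Range)
  then obtain N where N: "\<And>x. x \<in> Domain w \<union> Range w \<Longrightarrow> x < N"
    by (meson finite_nat_set_iff_bounded)
  have i: "w \<union> Id_on {N + j..} \<in> sym_inv_monoid" for j
  proof (rule sym_inv_monoid_Un[OF assms(1) sym_inv_monoid_Id_on])
    show "Domain w \<inter> Domain (Id_on {N + j..}) = {}" "Range w \<inter> Range (Id_on {N + j..}) = {}"
      using N by fastforce+
  qed
  have ev: "\<forall>\<^sub>F j in sequentially. x \<notin> {N + j..}" for x
    using eventually_gt_at_top[of x] by eventually_elim auto
  have "bi_conv (\<lambda>j. w \<union> Id_on {N + j..}) w"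
    unfolding bi_conv_def
  proof
    show "dom_conv (\<lambda>j. w \<union> Id_on {N + j..}) w"
    proof (rule dom_convI)
      show "\<forall>\<^sub>F j in sequentially. x \<notin> Domain (w \<union> Id_on {N + j..})" if "x \<notin> Domain w" for x
        using ev[of x] by (rule eventually_mono) (use that in auto)
    qed (use i in auto)
    show "dom_conv (\<lambda>j. (w \<union> Id_on {N + j..})\<inverse>) (w\<inverse>)"
    proof (rule dom_convI)
      show "\<forall>\<^sub>F j in sequentially. x \<notin> Domain ((w \<union> Id_on {N + j..})\<inverse>)" if "x \<notin> Domain (w\<inverse>)" for x
        using ev[of x] by (rule eventually_mono) (use that in auto)
      show "(w \<union> Id_on {N + j..})\<inverse> \<in> sym_inv_monoid" for j
        using i[of j] by simp
    qed auto
  qed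
  from lim_bi_conv[OF i assms(1) this] i show ?thesis
    by (rule that[rotated])
qed

text \<open>Gain the points of \<open>F\<close> outside \<open>Range g\<close>, then adjoin distant
  fixed points; both changes can be kept inside \<open>B\<close>. The bound \<open>N0\<close> makes
  the thresholds increase in the recursion that follows.\<close>

lemma full_range_step:
  assumes "g \<in> sym_inv_monoid" "finite g" "\<And>l. gain T (card g) l" "openin T B" "g \<in> B" "finite F"
  obtains v N where "v \<in> sym_inv_monoid" "v \<in> B" "F \<union> Range g \<union> {N..} \<subseteq> Range v" "N \<ge> N0"
proof -
  obtain w where w: "\<And>n. w n \<in> sym_inv_monoid" "\<And>n. finite (w n)" "\<And>n. Range (w n) = Range g \<union> (F - Range g)"
    "limitin T w g sequentially"
    by (rule gain_realize[of g "F - Range g"]) (use assms in auto)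
  have "\<forall>\<^sub>F n in sequentially. w n \<in> B"
    using limitinD[OF w(4) assms(4,5)] .
  then obtain n where n: "w n \<in> B"
    using eventually_happens'[OF sequentially_bot] by blast
  obtain N where N: "\<And>j. w n \<union> Id_on {N + j..} \<in> sym_inv_monoid"
    "limitin T (\<lambda>j. w n \<union> Id_on {N + j..}) (w n) sequentially"
    using lim_cofinite_ext[OF w(1,2)] by blast
  have "\<forall>\<^sub>F j in sequentially. w n \<union> Id_on {N + j..} \<in> B \<and> j \<ge> N0"
    using limitinD[OF N(2) assms(4) n] eventually_ge_at_top[of N0] by eventually_elim auto
  then obtain j where j: "w n \<union> Id_on {N + j..} \<in> B" "j \<ge> N0"
    using eventually_happens'[OF sequentially_bot] by blast
  show ?thesis
  proof (rule that[OF N(1)[of j] j(1)])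
    show "F \<union> Range g \<union> {N + j..} \<subseteq> Range (w n \<union> Id_on {N + j..})"
      using w(3)[of n] by auto
    show "N0 \<le> N + j"
      using j(2) by simp
  qed
qed

text \<open>The approximants below miss only finitely many image points each; choosing the points they
  must hit in time leaves a common infinite part of the images, which is then relabelled.\<close>

lemma full_range_finite:
  assumes g: "g \<in> sym_inv_monoid" "finite g" and gn: "\<And>l. gain T (card g) l"
  obtains w where "\<And>n. w n \<in> sym_inv_monoid" "\<And>n. Range (w n) = UNIV" "limitin T w g sequentially"
proof -
  obtain B where B: "\<And>n::nat. openin T (B n)" "\<And>n. g \<in> B n"
    "\<And>f. (\<And>n. f n \<in> B n) \<Longrightarrow> limitin T f g sequentially"
    using limitin_shrinking[OF metrizable_T, of g] g by auto
  \<comment> \<open>In a state \<open>(F, v, N)\<close> the image of \<open>v\<close> contains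
    \<open>F\<close> and everything from \<open>N\<close> on. Points added to \<open>F\<close> later
    are at least \<open>N\<close>, so they lie in the images of all earlier approximants
    too.\<close>
  define P where "P n s \<longleftrightarrow> (case s of (F, v, N) \<Rightarrow> finite F \<and> v \<in> sym_inv_monoid \<and> v \<in> B n \<and>
     F \<union> Range g \<union> {N..} \<subseteq> Range v \<and> F \<inter> Range g = {} \<and> n \<le> card F)" for n and s :: "nat set \<times> (nat \<times> nat) set \<times> nat"
  define Q where "Q s s' \<longleftrightarrow> (case s of (F, v, N) \<Rightarrow> case s' of (F', v', N') \<Rightarrow>
     F \<subseteq> F' \<and> F' \<subseteq> F \<union> {N..} \<and> N \<le> N')" for s s' :: "nat set \<times> (nat \<times> nat) set \<times> nat"
  obtain v N where "v \<in> sym_inv_monoid" "v \<in> B 0" "{} \<union> Range g \<union> {N..} \<subseteq> Range v"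
    using full_range_step[OF g gn B(1)[of 0] B(2)[of 0], of "{}" 0] by auto
  then have "P 0 ({}, v, N)"
    by (auto simp: P_def)
  then have "\<exists>s. P 0 s"
    by blast
  moreover have "\<exists>s'. P (Suc n) s' \<and> Q s s'" if s: "P n s" for n s
  proof -
    obtain F v N where [simp]: "s = (F, v, N)"
      by (cases s)
    have "finite (F \<union> Range g)"
      using s g by (auto simp: P_def finite_Range)
    then obtain c where c: "c \<notin> F \<union> Range g" "c \<ge> N"
      by (metis finite_nat_set_iff_bounded linorder_not_less max.cobounded1 max.cobounded2)
    have fin: "finite (insert c F)"
      using s by (auto simp: P_def)
    obtain v' N' where v': "v' \<in> sym_inv_monoid" "v' \<in> B (Suc n)" "insert c F \<union> Range g \<union> {N'..} \<subseteq> Range v'" "N' \<ge> N"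
      using full_range_step[OF g gn B(1)[of "Suc n"] B(2)[of "Suc n"] fin, of N] by blast
    have "P (Suc n) (insert c F, v', N')"
      using s c v' by (auto simp: P_def)
    moreover have "Q s (insert c F, v', N')"
      using c v' by (auto simp: Q_def)
    ultimately show ?thesis
      by blast
  qed
  ultimately obtain s where s: "\<And>n. P n (s n)" "\<And>n. Q (s n) (s (Suc n))"
    using dependent_nat_choice[of P "\<lambda>_. Q"] by blast
  define F v N where "F n = fst (s n)" and "v n = fst (snd (s n))" and "N n = snd (snd (s n))" for n
  have P: "finite (F n)" "v n \<in> sym_inv_monoid" "v n \<in> B n" "F n \<union> Range g \<union> {N n..} \<subseteq> Range (v n)"
    "F n \<inter> Range g = {}" "n \<le> card (F n)" for n
    using s(1)[of n] by (simp_all add: P_def F_def v_def N_def split_beta)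
  have Q: "F n \<subseteq> F (Suc n)" "F (Suc n) \<subseteq> F n \<union> {N n..}" "N n \<le> N (Suc n)" for n
    using s(2)[of n] by (simp_all add: Q_def F_def v_def N_def split_beta)
  have Fm: "F m \<subseteq> F n" if "m \<le> n" for m n
    using Q(1) that by (rule lift_Suc_mono_le)
  have Nm: "N m \<le> N n" if "m \<le> n" for m n
    using Q(3) that by (rule lift_Suc_mono_le)
  have up: "F n \<subseteq> F m \<union> {N m..}" if "m \<le> n" for m n
    using that
  proof (induction n rule: dec_induct)
    case (step n)
    then show ?case
      using Q(2)[of n] Nm[of m n] by fastforce
  qed auto
  define D where "D = (\<Union>n. F n)"
  have Dv: "D \<subseteq> Range (v m)" for m
  proof
    fix x assume "x \<in> D"
    then obtain n where n: "x \<in> F n"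
      by (auto simp: D_def)
    have "x \<in> F m \<union> {N m..}"
    proof (cases "n \<le> m")
      case True
      then show ?thesis
        using n Fm[OF True] by blast
    next
      case False
      then have "m \<le> n"
        by simp
      then show ?thesis
        using n up by blast
    qed
    then show "x \<in> Range (v m)"
      using P(4)[of m] by blast
  qed
  have "infinite D"
  proof
    assume "finite D"
    then have "Suc (card D) \<le> card D"
      using card_mono[of D "F (Suc (card D))"] P(6)[of "Suc (card D)"] by (fastforce simp: D_def)
    then show False
      by simp
  qed
  moreover have "infinite (- Range g)"
    using g by (simp add: finite_Range Compl_eq_Diff_UNIV)
  ultimately obtain \<phi> where \<phi>: "bij_betw \<phi> D (- Range g)"
    by (metis bij_betw_inv bij_betw_trans bij_enumerate)
  have Dg: "D \<inter> Range g = {}"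
    using P(5) by (auto simp: D_def)
  \<comment> \<open>Fixing the image of \<open>g\<close> preserves the limit; spreading
    \<open>D\<close> over its complement makes every image full.\<close>
  define q where "q = Id_on (Range g) \<union> {(d, \<phi> d) |d. d \<in> D}"
  have q: "q \<in> sym_inv_monoid"
    unfolding q_def
  proof (rule sym_inv_monoid_Un[OF sym_inv_monoid_Id_on sym_inv_monoid_graph])
    show "inj_on \<phi> D"
      using \<phi> by (simp add: bij_betw_def)
    show "Range (Id_on (Range g)) \<inter> Range {(x, \<phi> x) |x. x \<in> D} = {}"
      using bij_betwE[OF \<phi>] by auto
  qed (use Dg in auto)
  show ?thesis
  proof (rule that[of "\<lambda>n. v n O q"])
    show "v n O q \<in> sym_inv_monoid" for n
      using P(2) q by (rule sym_inv_monoid_comp)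
    show "Range (v n O q) = UNIV" for n
    proof (intro equalityI subsetI UNIV_I)
      fix y
      have "\<exists>d. (d, y) \<in> q \<and> d \<in> Range (v n)"
      proof (cases "y \<in> Range g")
        case True
        then have "(y, y) \<in> q" "y \<in> Range (v n)"
          using P(4)[of n] by (auto simp: q_def)
        then show ?thesis
          by blast
      next
        case False
        then have "y \<in> \<phi> ` D"
          using \<phi> by (auto simp: bij_betw_def)
        then obtain d where "d \<in> D" "y = \<phi> d"
          by blast
        then show ?thesis
          using Dv[of n] by (auto simp: q_def)
      qed
      then show "y \<in> Range (v n O q)"
        by blast
    qed
    have "limitin T v g sequentially"
      using B(3) P(3) by blast
    from lim_mult_right[OF q this] have "limitin T (\<lambda>n. v n O q) (g O q) sequentially" .
    moreover have "g O q = g"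
      using Dg unfolding q_def by auto
    ultimately show "limitin T (\<lambda>n. v n O q) g sequentially"
      by simp
  qed
qed

lemma lim_initial_part:
  assumes "g \<in> sym_inv_monoid"
  shows "limitin T (\<lambda>n. g \<inter> {..<n} \<times> UNIV) g sequentially"
proof (rule lim_bi_conv)
  show i: "g \<inter> {..<n} \<times> UNIV \<in> sym_inv_monoid" for n
    using sym_inv_monoid_subset[OF assms] by blast
  have ev: "\<forall>\<^sub>F n in sequentially. x < n" for x :: nat
    by (rule eventually_gt_at_top)
  show "bi_conv (\<lambda>n. g \<inter> {..<n} \<times> UNIV) g"
    unfolding bi_conv_def
  proof
    show "dom_conv (\<lambda>n. g \<inter> {..<n} \<times> UNIV) g"
    proof (rule dom_convI)
      show "\<forall>\<^sub>F n in sequentially. (x, y) \<in> g \<inter> {..<n} \<times> UNIV" if "(x, y) \<in> g" for x y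
        using ev[of x] that by (auto elim!: eventually_mono)
      show "\<forall>\<^sub>F n in sequentially. x \<notin> Domain (g \<inter> {..<n} \<times> UNIV)" if "x \<notin> Domain g" for x
        using that by (intro always_eventually) blast
    qed (rule i)
    show "dom_conv (\<lambda>n. (g \<inter> {..<n} \<times> UNIV)\<inverse>) (g\<inverse>)"
    proof (rule dom_convI)
      show "(g \<inter> {..<n} \<times> UNIV)\<inverse> \<in> sym_inv_monoid" for n
        using i[of n] by simp
      show "\<forall>\<^sub>F n in sequentially. (y, x) \<in> (g \<inter> {..<n} \<times> UNIV)\<inverse>" if "(y, x) \<in> g\<inverse>" for x y
        using ev[of x] that by (auto elim!: eventually_mono)
      show "\<forall>\<^sub>F n in sequentially. y \<notin> Domain ((g \<inter> {..<n} \<times> UNIV)\<inverse>)" if "y \<notin> Domain (g\<inverse>)" for y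
        using that by (intro always_eventually) blast
    qed
  qed
qed fact

lemma finite_initial_part: "g \<in> sym_inv_monoid \<Longrightarrow> finite (g \<inter> {..<n} \<times> UNIV)" for n :: nat
proof -
  assume g: "g \<in> sym_inv_monoid"
  have "inj_on fst (g \<inter> {..<n} \<times> UNIV)"
    using sym_inv_monoid_fun[OF g] by (auto simp: inj_on_def)
  moreover have "fst ` (g \<inter> {..<n} \<times> UNIV) \<subseteq> {..<n}"
    by auto
  ultimately show ?thesis
    using finite_imageD finite_subset by blast
qed

text \<open>An infinite \<open>g\<close> is the limit of its finite initial parts, of unbounded
  rank, hence the assumption on all \<open>r\<close>. Elements with full image dominate every
  sequence in \<open>lim_of_Range_subset\<close>.\<close>

lemma full_range:
  assumes g: "g \<in> sym_inv_monoid" and gn: "\<And>l. finite g \<Longrightarrow> gain T (card g) l" "\<And>r l. infinite g \<Longrightarrow> gain T r l"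
  obtains w where "\<And>n. w n \<in> sym_inv_monoid" "\<And>n. Range (w n) = UNIV" "limitin T w g sequentially"
proof (cases "finite g")
  case True
  then show ?thesis
    using full_range_finite[OF g True gn(1)] that by blast
next
  case False
  have "\<exists>w. \<forall>n. w n \<in> sym_inv_monoid \<and> Range (w n) = UNIV \<and> limitin T w (g \<inter> {..<m} \<times> UNIV) sequentially" for m
    using full_range_finite[OF sym_inv_monoid_subset[OF g Int_lower1] finite_initial_part[OF g] gn(2)[OF False]]
    by metis
  then obtain w where w: "\<And>m n. w m n \<in> sym_inv_monoid" "\<And>m n. Range (w m n) = UNIV"
    "\<And>m. limitin T (w m) (g \<inter> {..<m} \<times> UNIV) sequentially"
    by metis
  obtain j where "limitin T (\<lambda>n. w n (j n)) g sequentially"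
    using limitin_diagonal[OF metrizable_T lim_initial_part[OF g] w(3)] by metis
  then show ?thesis
    using that[of "\<lambda>n. w n (j n)"] w by blast
qed

text \<open>Gain one point at rank \<open>r\<close>: the approximants have rank
  \<open>Suc r\<close>, where the induction hypothesis gains the other \<open>l\<close>. A diagonal
  sequence does both.\<close>

lemma gain_all:
  assumes "\<And>r. gain T r 1"
  shows "gain T r l"
proof (induction l arbitrary: r)
  case 0
  then show ?case
    using gain_mono[OF assms] by auto
next
  case (Suc l)
  have c: "card (far_ext r 1 n) = Suc r" for n
    using sym_inv_monoid_card_Range[OF far_ext_in, of r 1 n] by (simp add: Range_far_ext)
  then have fin: "finite (far_ext r 1 n)" for n
    by (metis card.infinite nat.distinct(1))
  have cZ: "card {Suc r..<Suc r + l} = l"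
    by simp
  have "\<exists>w. (\<forall>n. w n \<in> sym_inv_monoid \<and> Range (w n) = {..<r + Suc l}) \<and> limitin T w (far_ext r 1 m) sequentially" for m
  proof -
    obtain w where w: "\<And>n. w n \<in> sym_inv_monoid" "\<And>n. finite (w n)"
      "\<And>n. Range (w n) = Range (far_ext r 1 m) \<union> {Suc r..<Suc r + l}"
      "limitin T w (far_ext r 1 m) sequentially"
      by (rule gain_realize[of "far_ext r 1 m" "{Suc r..<Suc r + l}"]) (use Suc c fin in \<open>auto simp: Range_far_ext\<close>)
    have "{..<r + 1} \<union> {Suc r..<Suc r + l} = {..<r + Suc l}"
      by auto
    then have "Range (w n) = {..<r + Suc l}" for n
      using w(3)[of n] unfolding Range_far_ext by simp
    then show ?thesis
      using w(1,4) by blast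
  qed
  then obtain w where w: "\<And>m n. w m n \<in> sym_inv_monoid" "\<And>m n. Range (w m n) = {..<r + Suc l}"
     "\<And>m. limitin T (w m) (far_ext r 1 m) sequentially"
    by metis
  have "limitin T (far_ext r 1) (Id_on {..<r}) sequentially"
    using assms[of r] by (simp add: gain_def)
  from limitin_diagonal[OF metrizable_T this w(3)]
  obtain j where j: "limitin T (\<lambda>n. w n (j n)) (Id_on {..<r}) sequentially"
    by blast
  show ?case
  proof (rule gainI[OF _ j])
    show "\<exists>\<^sub>F n in sequentially. {r..<r + Suc l} \<subseteq> Range (w n (j n))"
      by (rule eventually_frequently) (auto simp: w)
    show "{..<r} \<subseteq> Range (Id_on {..<r})"
      by auto
  qed (auto simp: w)
qed

end

section \<open>Ascending chains\<close>

context left_topology begin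

text \<open>The main case is that of a finite \<open>g\<close> with bounded gain. Along a subsequence, the images of the
  \<open>h n\<close> then converge to that of \<open>g\<close> together with a finite set \<open>Z\<close>. In \<open>S\<close> some sequence tends to \<open>g\<close>
  gaining precisely \<open>Z\<close>, and adjoining far away fixed points to its terms makes their images cover
  those of the \<open>h n\<close>.\<close>

lemma lim_transfer:
  assumes S: "left_topology S" and gTS: "\<And>r l. gain T r l \<Longrightarrow> gain S r l"
    and h: "\<And>n. h n \<in> sym_inv_monoid" and hg: "limitin T h g sequentially"
  obtains k where "strict_mono k" "limitin S (h \<circ> k) g sequentially"
proof -
  interpret S: left_topology S
    by fact
  have g: "g \<in> sym_inv_monoid"
    using lim_in hg by blast
  have dc: "dom_conv h g"
    using lim_dom_conv h hg by blast
  have id: thesis if "limitin S h g sequentially"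
    using that by (intro \<open>\<And>k. strict_mono k \<Longrightarrow> limitin S (h \<circ> k) g sequentially \<Longrightarrow> thesis\<close>[of id])
      (auto simp: strict_mono_def)
  \<comment> \<open>For infinite \<open>g\<close> a single point is the right test: gaining one at
    every rank gives unlimited gain by \<open>gain_all\<close>, and failure at one rank
    \<open>r\<close> forbids any gain, since \<open>g\<close> has \<open>r\<close> image points to
    restrict to.\<close>
  consider (all) "finite g \<Longrightarrow> \<forall>l. gain T (card g) l" "infinite g \<Longrightarrow> \<forall>r. gain T r 1"
    | (fin) l where "finite g" "\<not> gain T (card g) l"
    | (inf) r where "infinite g" "\<not> gain T r 1"
    by blast
  then show thesis
  proof cases
    case all
    have "gain S (card g) l" if "finite g" for l
      using all(1) that gTS by blast
    moreover have "gain S r l" if "infinite g" for r l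
      using all(2) that gTS gain_all by blast
    ultimately obtain w where "\<And>n. w n \<in> sym_inv_monoid" "\<And>n. Range (w n) = UNIV" "limitin S w g sequentially"
      using S.full_range[OF g] by metis
    then have "limitin S h g sequentially"
      using S.lim_of_Range_subset[OF h dc, of w] by simp
    then show ?thesis
      by (rule id)
  next
    case fin
    define \<Z> where "\<Z> Z \<longleftrightarrow> finite Z \<and> Z \<inter> Range g = {} \<and> (\<exists>\<^sub>F n in sequentially. Z \<subseteq> Range (h n))" for Z
    have gZ: "gain T (card g) (card Z)" if "\<Z> Z" for Z
      using that sym_inv_monoid_card_Range[OF g] fin(1)
      by (intro gainI[OF h hg, of Z _ "Range g"]) (auto simp: \<Z>_def finite_Range)
    have "card Z < l" if "\<Z> Z" for Z
      using gain_mono[OF gZ[OF that], of "card g" l] fin(2) by (auto simp: not_less[symmetric])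
    moreover have "\<Z> {}"
      by (simp add: \<Z>_def)
    \<comment> \<open>The bound \<open>l\<close> provides a largest \<open>Z\<close>; maximality
      makes every further point disappear eventually along the indices at which \<open>Z\<close> is
      gained.\<close>
    ultimately obtain Z where Z: "\<Z> Z" and Zmax: "\<And>Z'. \<Z> Z' \<Longrightarrow> card Z' \<le> card Z"
      using ex_has_greatest_nat[of \<Z> "{}" card l] by (metis less_imp_le)
    have new: "\<forall>\<^sub>F n in sequentially. \<not> (Z \<subseteq> Range (h n) \<and> y \<in> Range (h n))" if y: "y \<notin> Range g \<union> Z" for y
    proof (rule ccontr)
      assume "\<not> ?thesis"
      then have "\<Z> (insert y Z)"
        using Z y by (auto simp: \<Z>_def frequently_def elim!: contrapos_nn eventually_mono)
      then show False
        using Zmax[of "insert y Z"] Z y by (auto simp: \<Z>_def)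
    qed
    obtain w where w: "\<And>n. w n \<in> sym_inv_monoid" "\<And>n. finite (w n)" "\<And>n. Range (w n) = Range g \<union> Z"
        "limitin S w g sequentially"
      using S.gain_realize[OF gTS[OF gZ[OF Z]] g fin(1)] Z by (auto simp: \<Z>_def)
    have "\<exists>N. (\<forall>j. w n \<union> Id_on {N + j..} \<in> sym_inv_monoid) \<and> limitin S (\<lambda>j. w n \<union> Id_on {N + j..}) (w n) sequentially" for n
      using S.lim_cofinite_ext[OF w(1,2)] by metis
    then obtain N where N: "\<And>n j. w n \<union> Id_on {N n + j..} \<in> sym_inv_monoid"
        "\<And>n. limitin S (\<lambda>j. w n \<union> Id_on {N n + j..}) (w n) sequentially"
      by metis
    obtain j where j: "limitin S (\<lambda>n. w n \<union> Id_on {N n + j n..}) g sequentially"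
      using limitin_diagonal[OF S.metrizable_T w(4) N(2)] by blast
    define P where "P n \<longleftrightarrow> Z \<subseteq> Range (h n)" for n
    \<comment> \<open>Together with \<open>P\<close>, no points other than those of
      \<open>Range g\<close> and \<open>Z\<close> occur below the threshold
      \<open>N i + j i\<close>; from there on the fixed points adjoined to \<open>w i\<close> cover
      everything.\<close>
    define Q where "Q i n \<longleftrightarrow> (\<forall>y\<in>{..<N i + j i} - (Range g \<union> Z). \<not> (Z \<subseteq> Range (h n) \<and> y \<in> Range (h n)))" for i n
    have "\<forall>\<^sub>F n in sequentially. Q i n" for i
      unfolding Q_def by (intro eventually_ball_finite ballI new) auto
    moreover have "\<exists>\<^sub>F n in sequentially. P n"
      using Z by (simp add: P_def \<Z>_def)
    ultimately obtain k :: "nat \<Rightarrow> nat" where k: "strict_mono k" "\<And>i. P (k i)" "\<And>i. Q i (k i)"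
      using subseq_index[of P Q] by metis
    have "limitin S (h \<circ> k) g sequentially"
    proof (rule S.lim_of_Range_subset[OF _ dom_conv_subseq[OF dc k(1)] N(1) j])
      show "(h \<circ> k) n \<in> sym_inv_monoid" for n
        using h by simp
      show "Range ((h \<circ> k) n) \<subseteq> Range (w n \<union> Id_on {N n + j n..})" for n
      proof
        fix y assume y: "y \<in> Range ((h \<circ> k) n)"
        show "y \<in> Range (w n \<union> Id_on {N n + j n..})"
        proof (cases "y < N n + j n")
          case True
          then have "y \<in> Range g \<union> Z"
            using k(2)[of n] k(3)[of n] y by (auto simp: P_def Q_def)
          then have "y \<in> Range (w n)"
            using w(3)[of n] by blast
          then show ?thesis
            by blast
        next
          case False
          then have "(y, y) \<in> Id_on {N n + j n..}"
            by auto
          then show ?thesis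
            by blast
        qed
      qed
    qed
    then show ?thesis
      using \<open>\<And>k. strict_mono k \<Longrightarrow> limitin S (h \<circ> k) g sequentially \<Longrightarrow> thesis\<close> k(1) by blast
  next
    case inf
    have "infinite (Range g)"
      using inf(1) sym_inv_monoid_finite_iff[OF g] by simp
    then obtain R where R: "finite R" "R \<subseteq> Range g" "card R = r"
      using infinite_arbitrarily_large by metis
    \<comment> \<open>A point gained infinitely often would give \<open>gain T r 1\<close> by way of
      \<open>R\<close>. So the inverses converge pointwise too, and \<open>lim_bi_conv\<close> works
      in every topology.\<close>
    have ev: "\<forall>\<^sub>F n in sequentially. y \<notin> Range (h n)" if "y \<notin> Range g" for y
    proof (rule ccontr)
      assume "\<not> ?thesis"
      then have "\<exists>\<^sub>F n in sequentially. {y} \<subseteq> Range (h n)"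
        by (simp add: frequently_def)
      then have "gain T r 1"
        using that by (intro gainI[OF h hg _ _ _ _ R, of "{y}"]) auto
      then show False
        using inf by simp
    qed
    have "dom_conv (\<lambda>n. (h n)\<inverse>) (g\<inverse>)"
    proof (rule dom_convI)
      show "\<forall>\<^sub>F n in sequentially. (y, x) \<in> (h n)\<inverse>" if "(y, x) \<in> g\<inverse>" for x y
        using dom_conv_mem[OF dc, of x y] that by simp
      show "\<forall>\<^sub>F n in sequentially. y \<notin> Domain ((h n)\<inverse>)" if "y \<notin> Domain (g\<inverse>)" for y
        using ev[of y] that by simp
    qed (use h in simp)
    then have "limitin S h g sequentially"
      using dc h g by (intro S.lim_bi_conv) (auto simp: bi_conv_def)
    then show ?thesis
      by (rule id)
  qed
qed

text \<open>Closedness of the complement of \<open>U\<close> in \<open>T\<close> is tested on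
  sequences. Convergence in \<open>S\<close> of a subsequence to the same limit suffices, as the
  complement is closed in \<open>S\<close>.\<close>

lemma opens_subset_of_gain:
  assumes S: "left_topology S" and gTS: "\<And>r l. gain T r l \<Longrightarrow> gain S r l"
  shows "opens S \<subseteq> opens T"
proof
  interpret S: left_topology S
    by fact
  fix U assume "U \<in> opens S"
  then have U: "openin S U"
    by (simp add: opens_def)
  then have sub: "U \<subseteq> sym_inv_monoid"
    using openin_subset by fastforce
  obtain M d where "Metric_space M d" and X: "T = Metric_space.mtopology M d"
    using metrizable_T by (auto simp: metrizable_space_def)
  then interpret Metric_space M d
    by simp
  have M: "M = sym_inv_monoid"
    using topspace_T X by simp
  have "closedin T (sym_inv_monoid - U)"
    unfolding X metric_closedin_iff_sequentially_closed
  proof (intro conjI allI impI)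
    show "sym_inv_monoid - U \<subseteq> M"
      using M by blast
    fix \<sigma> l assume *: "range \<sigma> \<subseteq> sym_inv_monoid - U \<and> limitin mtopology \<sigma> l sequentially"
    then have "\<sigma> n \<in> sym_inv_monoid" for n
      by auto
    then obtain k where k: "strict_mono k" "limitin S (\<sigma> \<circ> k) l sequentially"
      using lim_transfer[OF S gTS] * X by metis
    have "l \<notin> U"
    proof
      assume "l \<in> U"
      have "\<forall>\<^sub>F n in sequentially. (\<sigma> \<circ> k) n \<in> U"
        using limitinD[OF k(2) U \<open>l \<in> U\<close>] .
      then show False
        using * by (auto simp: image_subset_iff)
    qed
    then show "l \<in> sym_inv_monoid - U"
      using S.lim_in[OF k(2)] by blast
  qed
  then have "openin T (sym_inv_monoid - (sym_inv_monoid - U))"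
    by (metis openin_diff openin_topspace topspace_T)
  then show "U \<in> opens T"
    using sub by (simp add: opens_def double_diff)
qed

end

text \<open>Dickson's lemma in two dimensions. If it failed, \<open>l\<close> would be bounded past
  a minimum of \<open>r\<close>, hence constant on an infinite set, and on that set any index after
  a minimum of \<open>r\<close> gives a contradiction.\<close>

lemma nat_pair_wqo:
  fixes r l :: "nat \<Rightarrow> nat"
  obtains i j where "i < j" "r i \<le> r j" "l i \<le> l j"
proof (rule ccontr)
  assume "\<not> thesis"
  then have *: "\<And>i j. i < j \<Longrightarrow> r i \<le> r j \<Longrightarrow> l j < l i"
    using that by (meson not_le)
  obtain n0 where n0: "\<And>n. r n0 \<le> r n"
    using arg_min_nat_le[of "\<lambda>_. True" _ r] by blast
  have "l ` {n0<..} \<subseteq> {..<l n0}"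
    using *[of n0] n0 by auto
  then have "finite (l ` {n0<..})"
    using finite_subset by blast
  moreover have "infinite {n0<..}"
    by (rule infinite_Ioi)
  ultimately obtain a where a: "infinite {n \<in> {n0<..}. l n = l a}"
    using pigeonhole_infinite by blast
  define A where "A = {n \<in> {n0<..}. l n = l a}"
  have "infinite A"
    using a A_def by simp
  then obtain m where m: "m \<in> A" "\<And>n. n \<in> A \<Longrightarrow> r m \<le> r n"
    using arg_min_nat_lemma[of "\<lambda>n. n \<in> A" _ r] by (metis finite.emptyI ex_in_conv)
  obtain n where n: "n \<in> A" "m < n"
    using \<open>infinite A\<close> by (meson finite_nat_set_iff_bounded_le linorder_not_le)
  then show False
    using *[OF n(2) m(2)[OF n(1)]] m(1) by (auto simp: A_def)
qed

text \<open>Every strict step loses a pair of the down-set. A lost pair stays lost, because finer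
  topologies have fewer convergent sequences, so no later lost pair can dominate it. For the same
  reason being left determined passes from \<open>T 0\<close> to the whole chain.\<close>

lemma no_ascending_chain_left:
  assumes T: "\<And>n. T n \<in> polish_semigroup_topologies" and "left_determined (T 0)"
    and asc: "\<And>n. opens (T n) \<subset> opens (T (Suc n))"
  shows False
proof -
  have mono: "opens (T m) \<subseteq> opens (T n)" if "m \<le> n" for m n
    by (rule lift_Suc_mono_le[OF _ that]) (rule psubset_imp_subset[OF asc])
  have topsp: "topspace (T n) = sym_inv_monoid" for n
    using T by (simp add: polish_semigroup_topologies_def)
  have lim: "limitin (T m) h g sequentially" if "m \<le> n" "limitin (T n) h g sequentially" for m n h g
    using that(2) mono[OF that(1)] unfolding limitin_def opens_def topsp by blast
  have left: "left_topology (T n)" for n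
  proof unfold_locales
    show "left_determined (T n)"
      using assms(2) lim[of 0 n] unfolding left_determined_def by blast
  qed (rule T)
  have "\<exists>r l. gain (T n) r l \<and> \<not> gain (T (Suc n)) r l" for n
  proof (rule ccontr)
    assume "\<not> ?thesis"
    then have "opens (T (Suc n)) \<subseteq> opens (T n)"
      using left_topology.opens_subset_of_gain[OF left left] by blast
    then show False
      using asc[of n] by simp
  qed
  then obtain r l where rl: "\<And>n. gain (T n) (r n) (l n)" "\<And>n. \<not> gain (T (Suc n)) (r n) (l n)"
    by metis
  obtain i j where ij: "i < j" "r i \<le> r j" "l i \<le> l j"
    using nat_pair_wqo by blast
  have "gain (T j) (r i) (l i)"
    using left_topology.gain_mono[OF left rl(1)] ij by blast
  then have "gain (T (Suc i)) (r i) (l i)"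
    using lim[of "Suc i" j] ij unfolding gain_def by simp
  then show False
    using rl(2) by blast
qed

lemma no_ascending_chain:
  assumes T: "\<And>n. T n \<in> polish_semigroup_topologies" and asc: "\<And>n. opens (T n) \<subset> opens (T (Suc n))"
  shows False
proof -
  interpret polish_inv_monoid "T 0"
    using T by unfold_locales
  show False
    using left_determined_or
  proof
    assume "left_determined (T 0)"
    then show False
      using no_ascending_chain_left[of T] T asc by blast
  next
    assume "left_determined (converse_topology (T 0))"
    moreover have "opens (converse_topology (T n)) \<subset> opens (converse_topology (T (Suc n)))" for n
      using asc[of n] unfolding less_le_not_le opens_converse_topology_subset .
    ultimately show False
      using no_ascending_chain_left[of "\<lambda>n. converse_topology (T n)"] T converse_topology_polish by blast
  qed
qed

section \<open>Topologies from waning functions\<close>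

text \<open>If \<open>excess h s m\<close> is empty and \<open>k\<close> agrees with
  \<open>h\<close> on the first \<open>s\<close> arguments, then \<open>excess k s m\<close>
  consists precisely of the points below \<open>m\<close> that \<open>k\<close> has gained over
  \<open>h\<close>.\<close>

definition excess :: "(nat \<times> nat) set \<Rightarrow> nat \<Rightarrow> nat \<Rightarrow> nat set" where
  "excess h s m = Range h \<inter> {..<m} - h `` {..<s}"

definition within_bound :: "(nat \<Rightarrow> nat) \<Rightarrow> nat \<Rightarrow> nat \<Rightarrow> (nat \<times> nat) set \<Rightarrow> bool" where
  "within_bound f s m h \<longleftrightarrow> card (excess h s m) \<le> f (card (h `` {..<s}))"

definition waning_nbhd :: "(nat \<Rightarrow> nat) \<Rightarrow> (nat \<times> nat) set \<Rightarrow> nat \<Rightarrow> nat \<Rightarrow> (nat \<times> nat) set set" where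
  "waning_nbhd f h s m = {k \<in> sym_inv_monoid. within_bound f s m k \<and> (\<forall>x<s. k `` {x} = h `` {x})}"

text \<open>Near \<open>h\<close> the first \<open>s\<close> values are frozen and, once these exhaust the image of \<open>h\<close> below \<open>m\<close>,
  at most \<open>f r\<close> new image points below \<open>m\<close> are allowed, where \<open>r\<close> is the number of frozen values.\<close>

definition waning_topology :: "(nat \<Rightarrow> nat) \<Rightarrow> (nat \<times> nat) set topology" where
  "waning_topology f = topology (\<lambda>U. U \<subseteq> sym_inv_monoid \<and>
     (\<forall>h\<in>U. \<exists>s m. excess h s m = {} \<and> waning_nbhd f h s m \<subseteq> U))"

text \<open>By truncated subtraction, \<open>f\<close> strictly decreases until it reaches \<open>0\<close>.\<close>

definition waning :: "(nat \<Rightarrow> nat) \<Rightarrow> bool" where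
  "waning f \<longleftrightarrow> (\<forall>r. f (Suc r) \<le> f r - 1)"

lemma waning_add:
  assumes "waning f"
  shows "f (r + j) \<le> f r - j"
proof (induction j)
  case (Suc j)
  have "f (Suc (r + j)) \<le> f (r + j) - 1"
    using assms by (simp add: waning_def)
  then show ?case
    using Suc by simp
qed simp

lemma waning_antimono: "waning f \<Longrightarrow> r \<le> r' \<Longrightarrow> f r' \<le> f r"
  using waning_add[of f r "r' - r"] by simp

lemma finite_excess [simp]: "finite (excess h s m)"
  by (simp add: excess_def)

lemma finite_Image_lessThan [simp]: "h \<in> sym_inv_monoid \<Longrightarrow> finite (h `` {..<s})"
proof (induction s)
  case (Suc s)
  have "finite (h `` {s})"
  proof (cases "h `` {s} = {}")
    case False
    then obtain y where "h `` {s} = {y}"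
      using sym_inv_monoid_fun[OF Suc.prems] by blast
    then show ?thesis
      by simp
  qed simp
  moreover have "h `` {..<Suc s} = h `` {..<s} \<union> h `` {s}"
    by (auto simp: less_Suc_eq)
  ultimately show ?case
    using Suc by simp
qed simp

lemma excess_mono: "s \<le> s' \<Longrightarrow> m' \<le> m \<Longrightarrow> excess h s' m' \<subseteq> excess h s m"
  by (fastforce simp: excess_def)

lemma excess_empty_ex: "\<exists>s\<ge>s0. excess h s m = {}"
proof -
  have "\<forall>y\<in>Range h \<inter> {..<m}. \<exists>x. (x, y) \<in> h"
    by blast
  then obtain p where p: "\<forall>y\<in>Range h \<inter> {..<m}. (p y, y) \<in> h"
    by metis
  define s where "s = Suc (Max (insert s0 (p ` (Range h \<inter> {..<m}))))"
  have "p y < s" if "y \<in> Range h \<inter> {..<m}" for y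
    using that by (auto simp: s_def less_Suc_eq_le)
  then have "excess h s m = {}"
    using p by (auto simp: excess_def)
  moreover have "s \<ge> s0"
    by (simp add: s_def le_SucI)
  ultimately show ?thesis
    by blast
qed

lemma excess_empty_max: 
  assumes "excess h s m = {}" "excess h s' m' = {}"
  shows "excess h (max s s') (max m m') = {}"
proof -
  have "excess h (max s s') m = {}" "excess h (max s s') m' = {}"
    using assms excess_mono[of s "max s s'" m m h] excess_mono[of s' "max s s'" m' m' h] by auto
  then show ?thesis
    by (simp add: max_def)
qed

lemma agree_Image: "(\<forall>x<s::nat. k `` {x} = h `` {x}) \<Longrightarrow> s' \<le> s \<Longrightarrow> k `` {..<s'} = h `` {..<s'}"
proof -
  assume *: "\<forall>x<s. k `` {x} = h `` {x}" "s' \<le> s"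
  have "r `` {..<s'} = (\<Union>x<s'. r `` {x})" for r :: "(nat \<times> 'a) set"
    by blast
  then show ?thesis
    using * by simp
qed

text \<open>As \<open>h\<close> has no excess, the points in \<open>excess k s m\<close> are new
  compared with \<open>h\<close>, so freezing more values of \<open>h\<close> cannot absorb them:
  the count only grows, while the bound only falls.\<close>

lemma waning_nbhd_mono:
  assumes f: "waning f" and h: "h \<in> sym_inv_monoid" and e: "excess h s m = {}" and le: "s \<le> s'" "m \<le> m'"
  shows "waning_nbhd f h s' m' \<subseteq> waning_nbhd f h s m"
proof
  fix k assume "k \<in> waning_nbhd f h s' m'"
  then have k: "k \<in> sym_inv_monoid" "within_bound f s' m' k" "\<forall>x<s'. k `` {x} = h `` {x}"
    by (auto simp: waning_nbhd_def)
  have s: "k `` {..<s} = h `` {..<s}" and s': "k `` {..<s'} = h `` {..<s'}"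
    using agree_Image[OF k(3)] le by auto
  have "excess k s m \<subseteq> excess k s' m'"
  proof
    fix y assume y: "y \<in> excess k s m"
    then have "y \<notin> Range h"
      using e s by (auto simp: excess_def)
    then have "y \<notin> k `` {..<s'}"
      using s' by blast
    then show "y \<in> excess k s' m'"
      using y le by (auto simp: excess_def)
  qed
  then have "card (excess k s m) \<le> card (excess k s' m')"
    by (intro card_mono) auto
  also have "\<dots> \<le> f (card (k `` {..<s'}))"
    using k(2) by (simp add: within_bound_def)
  also have "\<dots> \<le> f (card (k `` {..<s}))"
    by (rule waning_antimono[OF f]) (use k(1) le in \<open>auto intro!: card_mono\<close>)
  finally show "k \<in> waning_nbhd f h s m"
    using k le by (auto simp: waning_nbhd_def within_bound_def)
qed

lemma openin_waning_topology:
  assumes f: "waning f"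
  shows "openin (waning_topology f) U \<longleftrightarrow> U \<subseteq> sym_inv_monoid \<and>
    (\<forall>h\<in>U. \<exists>s m. excess h s m = {} \<and> waning_nbhd f h s m \<subseteq> U)"
proof -
  let ?P = "\<lambda>U. U \<subseteq> sym_inv_monoid \<and> (\<forall>h\<in>U. \<exists>s m. excess h s m = {} \<and> waning_nbhd f h s m \<subseteq> U)"
  have "istopology ?P"
    unfolding istopology_def
  proof (intro conjI allI impI)
    fix U V assume U: "?P U" and V: "?P V"
    show "\<forall>h\<in>U \<inter> V. \<exists>s m. excess h s m = {} \<and> waning_nbhd f h s m \<subseteq> U \<inter> V"
    proof
      fix h assume h: "h \<in> U \<inter> V"
      obtain s m where 1: "excess h s m = {}" "waning_nbhd f h s m \<subseteq> U"
        using U h by blast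
      obtain s' m' where 2: "excess h s' m' = {}" "waning_nbhd f h s' m' \<subseteq> V"
        using V h by blast
      have "h \<in> sym_inv_monoid"
        using U h by blast
      then have "waning_nbhd f h (max s s') (max m m') \<subseteq> U \<inter> V"
        using waning_nbhd_mono[OF f _ 1(1), of "max s s'" "max m m'"]
          waning_nbhd_mono[OF f _ 2(1), of "max s s'" "max m m'"] 1(2) 2(2) by fastforce
      then show "\<exists>s m. excess h s m = {} \<and> waning_nbhd f h s m \<subseteq> U \<inter> V"
        using excess_empty_max[OF 1(1) 2(1)] by blast
    qed
  next
    fix K assume K: "\<forall>U\<in>K. ?P U"
    show "\<forall>h\<in>\<Union>K. \<exists>s m. excess h s m = {} \<and> waning_nbhd f h s m \<subseteq> \<Union>K"
    proof
      fix h assume "h \<in> \<Union>K"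
      then obtain U where "U \<in> K" "h \<in> U"
        by blast
      then show "\<exists>s m. excess h s m = {} \<and> waning_nbhd f h s m \<subseteq> \<Union>K"
        using K by (meson Sup_upper subset_trans)
    qed
  qed auto
  then show ?thesis
    by (simp add: waning_topology_def topology_inverse')
qed

lemma topspace_waning_topology:
  assumes "waning f"
  shows "topspace (waning_topology f) = sym_inv_monoid"
proof -
  have "openin (waning_topology f) sym_inv_monoid"
    unfolding openin_waning_topology[OF assms]
    by (auto simp: waning_nbhd_def excess_def intro!: exI[of _ 0])
  moreover have "topspace (waning_topology f) \<subseteq> sym_inv_monoid"
    using openin_topspace[of "waning_topology f"] unfolding openin_waning_topology[OF assms] by blast
  ultimately show ?thesis
    using openin_subset by blast
qed

text \<open>Here it matters that \<open>f\<close> drops by at least one with every additional frozen value.\<close>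

lemma waning_nbhd_within_bound:
  assumes f: "waning f" and h: "h \<in> sym_inv_monoid" and b: "within_bound f s m h" and s': "s \<le> s'" "excess h s' m = {}"
    and k: "k \<in> waning_nbhd f h s' m"
  shows "within_bound f s m k"
proof -
  have k: "k \<in> sym_inv_monoid" "within_bound f s' m k" "\<forall>x<s'. k `` {x} = h `` {x}"
    using k by (auto simp: waning_nbhd_def)
  have ks: "k `` {..<s} = h `` {..<s}" and ks': "k `` {..<s'} = h `` {..<s'}"
    using agree_Image[OF k(3)] s' by auto
  let ?j = "card (excess h s m)" and ?c = "card (h `` {..<s})"
  have "excess k s m \<subseteq> excess h s m \<union> excess k s' m"
    using ks ks' by (auto simp: excess_def)
  then have "card (excess k s m) \<le> ?j + card (excess k s' m)"
    by (meson card_Un_le card_mono finite_UnI finite_excess le_trans)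
  also have "card (excess k s' m) \<le> f (card (h `` {..<s'}))"
    using k(2) ks' by (simp add: within_bound_def)
  also have "f (card (h `` {..<s'})) \<le> f (?c + ?j)"
  proof (rule waning_antimono[OF f])
    have "h `` {..<s} \<inter> excess h s m = {}"
      by (auto simp: excess_def)
    then have "?c + ?j = card (h `` {..<s} \<union> excess h s m)"
      by (simp add: card_Un_disjoint h)
    also have "\<dots> \<le> card (h `` {..<s'})"
      using s' h by (intro card_mono) (auto simp: excess_def)
    finally show "?c + ?j \<le> card (h `` {..<s'})" .
  qed
  also have "f (?c + ?j) \<le> f ?c - ?j"
    by (rule waning_add[OF f])
  finally show ?thesis
    using b ks by (simp add: within_bound_def)
qed

text \<open>A member \<open>k\<close> may have excess of its own. Freezing enough arguments to
  exhaust it turns \<open>k\<close> into a centre, and \<open>waning_nbhd_within_bound\<close>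
  ensures that further gains still fit the original bound.\<close>

lemma openin_waning_nbhd:
  assumes f: "waning f"
  shows "openin (waning_topology f) (waning_nbhd f h s m)"
  unfolding openin_waning_topology[OF f]
proof (intro conjI ballI)
  fix k assume k: "k \<in> waning_nbhd f h s m"
  obtain s' where s': "s \<le> s'" "excess k s' m = {}"
    using excess_empty_ex by blast
  have "waning_nbhd f k s' m \<subseteq> waning_nbhd f h s m"
  proof
    fix l assume l: "l \<in> waning_nbhd f k s' m"
    have "within_bound f s m l"
      by (rule waning_nbhd_within_bound[OF f _ _ s' l]) (use k in \<open>auto simp: waning_nbhd_def\<close>)
    then show "l \<in> waning_nbhd f h s m"
      using k l s' by (auto simp: waning_nbhd_def)
  qed
  then show "\<exists>s' m'. excess k s' m' = {} \<and> waning_nbhd f k s' m' \<subseteq> waning_nbhd f h s m"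
    using s' by blast
qed (auto simp: waning_nbhd_def)

lemma waning_nbhd_self: "h \<in> sym_inv_monoid \<Longrightarrow> excess h s m = {} \<Longrightarrow> h \<in> waning_nbhd f h s m"
  by (simp add: waning_nbhd_def within_bound_def)

section \<open>Complete metrizability and separability of the waning topologies\<close>

text \<open>Recording the truth values of the countably many closed conditions \<open>within_bound f s m\<close> makes
  them clopen without losing complete metrizability.\<close>

definition encode :: "(nat \<Rightarrow> nat) \<Rightarrow> (nat \<times> nat) set \<Rightarrow> nat + nat \<times> nat \<Rightarrow> nat" where
  "encode f h i = (case i of
     Inl x \<Rightarrow> if x \<in> Domain h then Suc (THE y. (x, y) \<in> h) else 0
   | Inr (s, m) \<Rightarrow> if within_bound f s m h then 1 else 0)"

definition decode :: "(nat + nat \<times> nat \<Rightarrow> nat) \<Rightarrow> (nat \<times> nat) set" where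
  "decode b = {(x, y). b (Inl x) = Suc y}"

lemma encode_Inl_iff: "h \<in> sym_inv_monoid \<Longrightarrow> encode f h (Inl x) = Suc y \<longleftrightarrow> (x, y) \<in> h"
proof
  assume h: "h \<in> sym_inv_monoid"
  have the: "(THE y. (x, y) \<in> h) = z" if "(x, z) \<in> h" for z
    using that sym_inv_monoid_fun[OF h] by blast
  show "(x, y) \<in> h" if "encode f h (Inl x) = Suc y"
    using that the by (auto simp: encode_def split: if_splits)
  show "encode f h (Inl x) = Suc y" if "(x, y) \<in> h"
    using that the by (auto simp: encode_def)
qed

lemma decode_encode: "h \<in> sym_inv_monoid \<Longrightarrow> decode (encode f h) = h"
  by (auto simp: decode_def encode_Inl_iff)

lemma encode_agree:
  assumes "h \<in> sym_inv_monoid" "k \<in> sym_inv_monoid"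
  shows "encode f k (Inl x) = encode f h (Inl x) \<longleftrightarrow> k `` {x} = h `` {x}"
proof
  assume *: "encode f k (Inl x) = encode f h (Inl x)"
  show "k `` {x} = h `` {x}"
    using encode_Inl_iff[OF assms(1), of f x] encode_Inl_iff[OF assms(2), of f x] * by auto
next
  assume *: "k `` {x} = h `` {x}"
  show "encode f k (Inl x) = encode f h (Inl x)"
  proof (cases "encode f h (Inl x)")
    case 0
    then have "x \<notin> Domain h"
      by (auto simp: encode_def split: if_splits)
    then have "x \<notin> Domain k"
      using * by blast
    then show ?thesis
      using 0 by (simp add: encode_def)
  next
    case (Suc y)
    then have "(x, y) \<in> k"
      using * encode_Inl_iff[OF assms(1)] by blast
    then show ?thesis
      using Suc encode_Inl_iff[OF assms(2)] by simp
  qed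
qed

text \<open>A violation is witnessed by finitely many image points, so it persists as long as the
  values at their preimages and at the first \<open>s\<close> arguments are kept.\<close>

lemma not_within_bound_agree:
  assumes "\<not> within_bound f s m h"
  obtains s' where "\<And>k. (\<And>x. x < s' \<Longrightarrow> k `` {x} = h `` {x}) \<Longrightarrow> \<not> within_bound f s m k"
proof -
  obtain s' where s': "s \<le> s'" "excess h s' m = {}"
    using excess_empty_ex by blast
  have "\<not> within_bound f s m k" if k: "\<And>x. x < s' \<Longrightarrow> k `` {x} = h `` {x}" for k
  proof -
    have ks: "k `` {..<s} = h `` {..<s}" and ks': "k `` {..<s'} = h `` {..<s'}"
      using agree_Image[of s' k h] k s' by auto
    have "excess h s m \<subseteq> excess k s m"
    proof
      fix y assume y: "y \<in> excess h s m"
      then have "y \<in> h `` {..<s'}"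
        using s'(2) by (auto simp: excess_def)
      then have "y \<in> Range k"
        using ks' by blast
      then show "y \<in> excess k s m"
        using y ks by (auto simp: excess_def)
    qed
    then have "card (excess h s m) \<le> card (excess k s m)"
      by (intro card_mono) auto
    then show ?thesis
      using assms ks by (simp add: within_bound_def)
  qed
  then show ?thesis
    using that by blast
qed

lemma completely_metrizable_nat_power:
  "completely_metrizable_space (euclidean :: ('i::countable \<Rightarrow> nat) topology)"
proof -
  have "(euclidean :: nat topology) = discrete_topology UNIV"
    by (simp add: topology_eq open_discrete)
  then have "completely_metrizable_space (euclidean :: nat topology)"
    by (simp add: completely_metrizable_space_discrete_topology)
  then have "completely_metrizable_space (product_topology (\<lambda>i::'i. euclidean :: nat topology) UNIV)"
    by (simp add: completely_metrizable_space_product_topology)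
  then show ?thesis
    by (simp add: euclidean_product_topology)
qed

lemma open_coordinate: "open {b :: 'i::countable \<Rightarrow> nat. P (b i)}"
proof -
  have "open ((\<lambda>b :: 'i \<Rightarrow> nat. b i) -` Collect P)"
    by (intro open_vimage open_discrete continuous_on_product_coordinates)
  then show ?thesis
    by (simp add: vimage_def)
qed

lemma closed_coordinate: "closed {b :: 'i::countable \<Rightarrow> nat. P (b i)}"
proof -
  have eq: "- {b :: 'i \<Rightarrow> nat. P (b i)} = {b. \<not> P (b i)}"
    by auto
  show ?thesis
    unfolding closed_def eq by (rule open_coordinate[of "\<lambda>v. \<not> P v"])
qed

lemma open_agree: "open {b :: nat + nat \<times> nat \<Rightarrow> nat. \<forall>x<s. b (Inl x) = v x}"
proof -
  have "open (\<Inter>x\<in>{..<s}. {b :: nat + nat \<times> nat \<Rightarrow> nat. b (Inl x) = v x})"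
    by (intro open_INT ballI open_coordinate) auto
  moreover have "(\<Inter>x\<in>{..<s}. {b :: nat + nat \<times> nat \<Rightarrow> nat. b (Inl x) = v x}) = {b. \<forall>x<s. b (Inl x) = v x}"
    by auto
  ultimately show ?thesis
    by simp
qed

lemma closed_within_bound: "closed {b. within_bound f s m (decode b)}"
proof -
  have "open {b. \<not> within_bound f s m (decode b)}"
    unfolding open_subopen[of "{b. \<not> within_bound f s m (decode b)}"]
  proof
    fix b assume "b \<in> {b. \<not> within_bound f s m (decode b)}"
    then obtain s' where s': "\<And>k. (\<And>x. x < s' \<Longrightarrow> k `` {x} = decode b `` {x}) \<Longrightarrow> \<not> within_bound f s m k"
      using not_within_bound_agree[of f s m "decode b"] by blast
    have "{c. \<forall>x<s'. c (Inl x) = b (Inl x)} \<subseteq> {b. \<not> within_bound f s m (decode b)}"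
      by (auto intro!: s' simp: decode_def)
    then show "\<exists>T. open T \<and> b \<in> T \<and> T \<subseteq> {b. \<not> within_bound f s m (decode b)}"
      using open_agree[of s' "\<lambda>x. b (Inl x)"] by blast
  qed
  moreover have "- {b. within_bound f s m (decode b)} = {b. \<not> within_bound f s m (decode b)}"
    by auto
  ultimately show ?thesis
    by (simp add: closed_def)
qed

text \<open>Codes are cut out by injectivity, a closed condition, and by the correctness of
  countably many bits. A correct bit is either 1 on a closed set or 0 on its open complement, so
  each of these conditions is the union of a closed and an open set.\<close>

lemma gdelta_encode: "gdelta_in euclidean (encode f ` sym_inv_monoid)"
proof -
  define C where "C = {b :: nat + nat \<times> nat \<Rightarrow> nat. \<forall>x x' y. b (Inl x) = Suc y \<longrightarrow> b (Inl x') = Suc y \<longrightarrow> x = x'}"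
  define G where "G s m = {b. b (Inr (s, m)) = (if within_bound f s m (decode b) then 1 else 0)}" for s m
  have dec: "decode b \<in> sym_inv_monoid \<longleftrightarrow> b \<in> C" for b
    by (auto simp: C_def decode_def sym_inv_monoid_iff)
  have S: "encode f ` sym_inv_monoid = \<Inter>(insert C (range (\<lambda>(s, m). G s m)))"
  proof (intro equalityI subsetI)
    fix b assume "b \<in> encode f ` sym_inv_monoid"
    then obtain h where h: "h \<in> sym_inv_monoid" "b = encode f h"
      by blast
    then have "decode b = h"
      using decode_encode by simp
    then show "b \<in> \<Inter>(insert C (range (\<lambda>(s, m). G s m)))"
      using h dec[of b] by (auto simp: G_def encode_def)
  next
    fix b assume b: "b \<in> \<Inter>(insert C (range (\<lambda>(s, m). G s m)))"
    then have d: "decode b \<in> sym_inv_monoid"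
      using dec by simp
    have "b i = encode f (decode b) i" for i
    proof (cases i)
      case (Inl x)
      have "b (Inl x) = Suc y \<longleftrightarrow> encode f (decode b) (Inl x) = Suc y" for y
        unfolding encode_Inl_iff[OF d] by (simp add: decode_def)
      then show ?thesis
        unfolding Inl by (metis not0_implies_Suc)
    next
      case (Inr p)
      obtain s m where p: "p = (s, m)"
        by (cases p)
      have "b \<in> G s m"
        using b by auto
      then show ?thesis
        by (simp add: Inr p G_def encode_def)
    qed
    then have "b = encode f (decode b)"
      by auto
    then show "b \<in> encode f ` sym_inv_monoid"
      using d by blast
  qed
  have met: "metrizable_space (euclidean :: (nat + nat \<times> nat \<Rightarrow> nat) topology)"
    using completely_metrizable_imp_metrizable_space[OF completely_metrizable_nat_power] .
  have clo: "gdelta_in euclidean A" if "closed A" for A :: "(nat + nat \<times> nat \<Rightarrow> nat) set"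
    using closed_imp_gdelta_in[OF met, of A] that by simp
  have ope: "gdelta_in euclidean A" if "open A" for A :: "(nat + nat \<times> nat \<Rightarrow> nat) set"
    using open_imp_gdelta_in[of euclidean A] that by simp
  have "gdelta_in euclidean (G s m)" for s m
  proof -
    have "G s m = ({b. b (Inr (s, m)) = 1} \<inter> {b. within_bound f s m (decode b)}) \<union>
                  ({b. b (Inr (s, m)) = 0} \<inter> - {b. within_bound f s m (decode b)})"
      by (auto simp: G_def)
    moreover have "open (- {b. within_bound f s m (decode b)})"
      using closed_within_bound by (simp add: closed_def)
    moreover have "gdelta_in euclidean ({b. b (Inr (s, m)) = 1} \<inter> {b. within_bound f s m (decode b)})"
      by (rule clo) (rule closed_Int[OF closed_coordinate[of "\<lambda>v. v = 1"] closed_within_bound])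
    moreover have "gdelta_in euclidean ({b. b (Inr (s, m)) = 0} \<inter> - {b. within_bound f s m (decode b)})"
      by (rule ope) (rule open_Int[OF open_coordinate[of "\<lambda>v. v = 0"] calculation(2)])
    ultimately show ?thesis
      by (simp only: gdelta_in_Un)
  qed
  moreover have "gdelta_in euclidean C"
  proof -
    have "C = (\<Inter>x x' y. {b. b (Inl x) = Suc y \<longrightarrow> b (Inl x') = Suc y \<longrightarrow> x = x'})"
      by (auto simp: C_def)
    moreover have "closed {b :: nat + nat \<times> nat \<Rightarrow> nat. b (Inl x) = Suc y \<longrightarrow> b (Inl x') = Suc y \<longrightarrow> x = x'}" for x x' y
    proof -
      have "{b :: nat + nat \<times> nat \<Rightarrow> nat. b (Inl x) = Suc y \<longrightarrow> b (Inl x') = Suc y \<longrightarrow> x = x'} =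
            {b. b (Inl x) \<noteq> Suc y} \<union> {b. b (Inl x') = Suc y \<longrightarrow> x = x'}"
        by auto
      moreover have "closed ({b :: nat + nat \<times> nat \<Rightarrow> nat. b (Inl x) \<noteq> Suc y} \<union> {b. b (Inl x') = Suc y \<longrightarrow> x = x'})"
        by (rule closed_Un[OF closed_coordinate[of "\<lambda>v. v \<noteq> Suc y"] closed_coordinate[of "\<lambda>v. v = Suc y \<longrightarrow> x = x'"]])
      ultimately show ?thesis
        by simp
    qed
    ultimately have "closed C"
      by (metis (no_types, lifting) closed_INT)
    then show ?thesis
      by (rule clo)
  qed
  ultimately show ?thesis
    unfolding S by (intro gdelta_in_Inter) auto
qed

lemma homeomorphic_encode:
  assumes f: "waning f"
  shows "waning_topology f homeomorphic_space subtopology euclidean (encode f ` sym_inv_monoid)"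
proof -
  let ?T = "waning_topology f"
  note top = topspace_waning_topology[OF f]
  have coord: "continuous_map ?T euclidean (\<lambda>h. encode f h i)" for i
  proof -
    have *: "\<exists>s m. excess h s m = {} \<and> (\<forall>k\<in>waning_nbhd f h s m. encode f k i = encode f h i)" if h: "h \<in> sym_inv_monoid" for h
    proof (cases i)
      case (Inl x)
      have "excess h (Suc x) 0 = {}"
        by (simp add: excess_def)
      moreover have "encode f k i = encode f h i" if "k \<in> waning_nbhd f h (Suc x) 0" for k
        using that encode_agree[OF h, of k f x] unfolding Inl by (auto simp: waning_nbhd_def)
      ultimately show ?thesis
        by blast
    next
      case (Inr p)
      obtain s m where p: "p = (s, m)"
        by (cases p)
      show ?thesis
      proof (cases "within_bound f s m h")
        case True
        obtain s' where s': "s \<le> s'" "excess h s' m = {}"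
          using excess_empty_ex by blast
        have "within_bound f s m k" if "k \<in> waning_nbhd f h s' m" for k
          using waning_nbhd_within_bound[OF f h True s' that] .
        then show ?thesis
          using s' True by (auto simp: Inr p encode_def)
      next
        case False
        then obtain s' where s': "\<And>k. (\<And>x. x < s' \<Longrightarrow> k `` {x} = h `` {x}) \<Longrightarrow> \<not> within_bound f s m k"
          using not_within_bound_agree by blast
        \<comment> \<open>With \<open>m = 0\<close> a neighbourhood bounds nothing and merely
          freezes values.\<close>
        have "\<not> within_bound f s m k" if "k \<in> waning_nbhd f h s' 0" for k
          using that by (intro s') (simp add: waning_nbhd_def)
        moreover have "excess h s' 0 = {}"
          by (simp add: excess_def)
        ultimately show ?thesis
          using False by (auto simp: Inr p encode_def)
      qed
    qed
    show ?thesis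
      unfolding continuous_map_def
    proof (intro conjI allI impI)
      fix U
      show "openin ?T {h \<in> topspace ?T. encode f h i \<in> U}"
        unfolding openin_waning_topology[OF f] top
      proof (intro conjI ballI)
        fix h assume "h \<in> {h \<in> sym_inv_monoid. encode f h i \<in> U}"
        then have h: "h \<in> sym_inv_monoid" "encode f h i \<in> U"
          by auto
        obtain s m where "excess h s m = {}" "\<forall>k\<in>waning_nbhd f h s m. encode f k i = encode f h i"
          using *[OF h(1)] by blast
        then show "\<exists>s m. excess h s m = {} \<and> waning_nbhd f h s m \<subseteq> {h \<in> sym_inv_monoid. encode f h i \<in> U}"
          using h(2) by (intro exI[of _ s] exI[of _ m]) (auto simp: waning_nbhd_def)
      qed auto
    qed auto
  qed
  have cont: "continuous_map ?T euclidean (encode f)"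
  proof -
    have "continuous_map ?T (product_topology (\<lambda>i. euclidean) UNIV) (encode f)"
      unfolding continuous_map_componentwise_UNIV using coord by simp
    then show ?thesis
      by (simp add: euclidean_product_topology)
  qed
  have "homeomorphic_map ?T (subtopology euclidean (encode f ` sym_inv_monoid)) (encode f)"
  proof (rule bijective_open_imp_homeomorphic_map)
    show "continuous_map ?T (subtopology euclidean (encode f ` sym_inv_monoid)) (encode f)"
      using cont by (intro continuous_map_into_subtopology) (auto simp: top)
    show "inj_on (encode f) (topspace ?T)"
      unfolding top by (rule inj_on_inverseI[of _ decode]) (rule decode_encode)
    show "encode f ` topspace ?T = topspace (subtopology euclidean (encode f ` sym_inv_monoid))"
      by (simp add: top)
    show "open_map ?T (subtopology euclidean (encode f ` sym_inv_monoid)) (encode f)"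
      unfolding open_map_def
    proof (intro allI impI)
      fix U assume "openin ?T U"
      then have U: "U \<subseteq> sym_inv_monoid" "\<And>h. h \<in> U \<Longrightarrow> \<exists>s m. excess h s m = {} \<and> waning_nbhd f h s m \<subseteq> U"
        by (auto simp: openin_waning_topology[OF f])
      show "openin (subtopology euclidean (encode f ` sym_inv_monoid)) (encode f ` U)"
        unfolding openin_subopen[of _ "encode f ` U"]
      proof
        fix b assume "b \<in> encode f ` U"
        then obtain h where h: "h \<in> U" "b = encode f h"
          by blast
        then obtain s m where sm: "excess h s m = {}" "waning_nbhd f h s m \<subseteq> U"
          using U(2) by blast
        have hS: "h \<in> sym_inv_monoid"
          using h U(1) by blast
        define V where "V = {c. \<forall>x<s. c (Inl x) = b (Inl x)} \<inter> {c. c (Inr (s, m)) = 1}"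
        have "open V"
          unfolding V_def by (intro open_Int open_agree open_coordinate)
        moreover have "b \<in> V"
          using waning_nbhd_self[OF hS sm(1), of f] h(2) by (simp add: V_def encode_def waning_nbhd_def)
        moreover have "encode f ` sym_inv_monoid \<inter> V \<subseteq> encode f ` U"
        proof
          fix c assume "c \<in> encode f ` sym_inv_monoid \<inter> V"
          then obtain k where k: "k \<in> sym_inv_monoid" "c = encode f k" "c \<in> V"
            by blast
          have "within_bound f s m k"
            using k by (simp add: V_def encode_def split: if_splits)
          moreover have "\<forall>x<s. k `` {x} = h `` {x}"
            using k encode_agree[OF hS k(1), of f] h(2) by (simp add: V_def)
          ultimately have "k \<in> U"
            using sm(2) k(1) by (auto simp: waning_nbhd_def)
          then show "c \<in> encode f ` U"
            using k by blast
        qed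
        ultimately show "\<exists>W. openin (subtopology euclidean (encode f ` sym_inv_monoid)) W \<and> b \<in> W \<and> W \<subseteq> encode f ` U"
          using h hS by (intro exI[of _ "encode f ` sym_inv_monoid \<inter> V"]) (auto simp: openin_open)
      qed
    qed
  qed
  then show ?thesis
    by (rule homeomorphic_map_imp_homeomorphic_space)
qed

lemma separable_waning_topology:
  assumes f: "waning f"
  shows "separable_space (waning_topology f)"
  unfolding separable_space_def
proof (intro exI conjI)
  let ?C = "{h \<in> sym_inv_monoid. finite h}"
  have "countable {h :: (nat \<times> nat) set. finite h}"
    using countable_Collect_finite by blast
  then show "countable ?C"
    by (rule countable_subset[rotated]) auto
  show C: "?C \<subseteq> topspace (waning_topology f)"
    by (auto simp: topspace_waning_topology[OF f])
  show "waning_topology f closure_of ?C = topspace (waning_topology f)"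
  proof (intro equalityI closure_of_subset_topspace subsetI)
    fix h assume h: "h \<in> topspace (waning_topology f)"
    then have hS: "h \<in> sym_inv_monoid"
      by (simp add: topspace_waning_topology[OF f])
    show "h \<in> waning_topology f closure_of ?C"
      unfolding in_closure_of
    proof (intro conjI allI impI h)
      fix U assume "h \<in> U \<and> openin (waning_topology f) U"
      then obtain s m where sm: "excess h s m = {}" "waning_nbhd f h s m \<subseteq> U"
        by (auto simp: openin_waning_topology[OF f])
      define k where "k = h \<inter> {..<s} \<times> UNIV"
      have k: "k \<in> sym_inv_monoid"
        unfolding k_def using sym_inv_monoid_subset[OF hS] by blast
      have "k \<subseteq> {..<s} \<times> h `` {..<s}"
        by (auto simp: k_def)
      then have "finite k"
        by (rule finite_subset) (simp add: hS)
      moreover have "excess k s m = {}"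
        unfolding excess_def k_def by blast
      then have "k \<in> waning_nbhd f h s m"
        using k by (auto simp: waning_nbhd_def within_bound_def k_def)
      ultimately show "\<exists>k. k \<in> ?C \<and> k \<in> U"
        using k sm(2) by blast
    qed
  qed
qed

section \<open>Continuity of multiplication in the waning topologies\<close>

lemma relcomp_Image: "(r O s) `` A = s `` (r `` A)"
  by blast

lemma card_Image_le: 
  assumes "r \<in> sym_inv_monoid" "finite A"
  shows "card (r `` A) \<le> card A" "finite (r `` A)"
proof -
  define \<phi> where "\<phi> x = (THE y. (x, y) \<in> r)" for x
  have "\<phi> x = y" if "(x, y) \<in> r" for x y
    unfolding \<phi>_def using that sym_inv_monoid_fun[OF assms(1)] by blast
  then have sub: "r `` A \<subseteq> \<phi> ` A"
    by blast
  show "finite (r `` A)"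
    using sub assms(2) finite_subset by blast
  show "card (r `` A) \<le> card A"
    using card_mono[OF _ sub] card_image_le[OF assms(2), of \<phi>] assms(2) by fastforce
qed

text \<open>\<open>E\<close> collects the points gained by the product through frozen values of
  \<open>v\<close>. They come from points gained by \<open>u'\<close>, so
  \<open>card E \<le> f r\<close>. As they are values of \<open>v\<close> on frozen arguments
  outside the \<open>r\<close> frozen values of the product, \<open>v\<close> has at least
  \<open>r + card E\<close> frozen values, and \<open>v'\<close> itself gains at most
  \<open>f (r + card E)\<close>, hence at most \<open>f r - card E\<close>. The sum stays within
  \<open>f r\<close>.\<close>

lemma waning_relcomp:
  assumes f: "waning f" and u: "u \<in> sym_inv_monoid" and v: "v \<in> sym_inv_monoid" and e: "excess (u O v) s m = {}"
  obtains s' t where "excess u s' t = {}" "excess v t m = {}"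
    "\<And>u' v'. u' \<in> waning_nbhd f u s' t \<Longrightarrow> v' \<in> waning_nbhd f v t m \<Longrightarrow> u' O v' \<in> waning_nbhd f (u O v) s m"
proof -
  \<comment> \<open>\<open>t\<close> exceeds all frozen values of \<open>u\<close>, so freezing
    \<open>v\<close> below \<open>t\<close> determines the product on the first \<open>s\<close>
    arguments. Only then can \<open>s'\<close> be chosen, as it depends on \<open>t\<close>.\<close>
  obtain t1 where "\<forall>z\<in>u `` {..<s}. z < t1"
    using finite_nat_set_iff_bounded finite_Image_lessThan[OF u] by metis
  moreover obtain t where "t \<ge> t1" "excess v t m = {}"
    using excess_empty_ex by blast
  ultimately have t: "u `` {..<s} \<subseteq> {..<t}" "excess v t m = {}"
    by (meson lessThan_iff less_le_trans subsetI)+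
  obtain s' where s': "s \<le> s'" "excess u s' t = {}"
    using excess_empty_ex by blast
  have "u' O v' \<in> waning_nbhd f (u O v) s m" if u': "u' \<in> waning_nbhd f u s' t" and v': "v' \<in> waning_nbhd f v t m" for u' v'
  proof -
    have U: "u' \<in> sym_inv_monoid" "within_bound f s' t u'" "\<forall>x<s'. u' `` {x} = u `` {x}"
      using u' by (auto simp: waning_nbhd_def)
    have V: "v' \<in> sym_inv_monoid" "within_bound f t m v'" "\<forall>x<t. v' `` {x} = v `` {x}"
      using v' by (auto simp: waning_nbhd_def)
    have us': "u' `` {..<s'} = u `` {..<s'}" and us: "u' `` {..<s} = u `` {..<s}"
      using agree_Image[OF U(3)] s' by auto
    have vt: "v' `` {..<t} = v `` {..<t}"
      using agree_Image[OF V(3)] by auto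
    have vA: "v' `` A = v `` A" if "A \<subseteq> {..<t}" for A
      using V(3) that by blast
    have agree: "(u' O v') `` {x} = (u O v) `` {x}" if "x < s" for x
    proof -
      have "u' `` {x} = u `` {x}"
        using U(3) that s' by simp
      moreover have "u `` {x} \<subseteq> {..<t}"
        using t(1) that by blast
      ultimately show ?thesis
        using vA[of "u `` {x}"] by (simp add: relcomp_Image)
    qed
    have ws: "(u' O v') `` {..<s} = (u O v) `` {..<s}"
      using agree_Image[of s "u' O v'" "u O v" s] agree by simp
    let ?w = "u' O v'"
    define r where "r = card (?w `` {..<s})"
    define E where "E = excess ?w s m - excess v' t m"
    have Esub: "E \<subseteq> v `` excess u' s' t"
    proof
      fix y assume "y \<in> E"
      then have y: "y \<in> Range ?w" "y < m" "y \<notin> (u O v) `` {..<s}" "y \<in> v' `` {..<t}"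
        using ws by (auto simp: E_def excess_def)
      obtain x z where xz: "(x, z) \<in> u'" "(z, y) \<in> v'"
        using y(1) by blast
      obtain z' where z': "z' < t" "(z', y) \<in> v'"
        using y(4) by blast
      have "z' = z"
        using sym_inv_monoid_inj[OF V(1)] z'(2) xz(2) by blast
      then have zt: "z < t"
        using z'(1) by simp
      then have zy: "(z, y) \<in> v"
        using V(3) xz(2) by blast
      have "z \<notin> Range u"
      proof
        assume "z \<in> Range u"
        then have "y \<in> Range (u O v)"
          using zy by blast
        then have "y \<in> (u O v) `` {..<s}"
          using e y(2) unfolding excess_def by blast
        then show False
          using y(3) by simp
      qed
      then have "z \<notin> u' `` {..<s'}"
        using us' by blast
      then have "z \<in> excess u' s' t"
        using xz(1) zt by (auto simp: excess_def)
      then show "y \<in> v `` excess u' s' t"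
        using zy by blast
    qed
    have "card E \<le> card (v `` excess u' s' t)"
      using card_Image_le[OF v] Esub by (simp add: card_mono)
    also have "\<dots> \<le> card (excess u' s' t)"
      using card_Image_le[OF v] by simp
    also have "\<dots> \<le> f (card (u `` {..<s'}))"
      using U(2) us' by (simp add: within_bound_def)
    also have "\<dots> \<le> f r"
    proof (rule waning_antimono[OF f])
      have "r \<le> card (u `` {..<s})"
        unfolding r_def ws unfolding relcomp_Image using card_Image_le(1)[OF v] u by simp
      also have "\<dots> \<le> card (u `` {..<s'})"
        using s' u by (intro card_mono) auto
      finally show "r \<le> card (u `` {..<s'})" .
    qed
    finally have Ef: "card E \<le> f r" .
    have "card (excess v' t m) \<le> f (card (v `` {..<t}))"
      using V(2) vt by (simp add: within_bound_def)
    also have "\<dots> \<le> f (r + card E)"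
    proof (rule waning_antimono[OF f])
      have fin: "finite ((u O v) `` {..<s})" "finite E"
        using sym_inv_monoid_comp[OF u v] by (auto simp: E_def)
      have "(u O v) `` {..<s} \<inter> E = {}"
        using ws by (auto simp: E_def excess_def)
      then have "r + card E = card ((u O v) `` {..<s} \<union> E)"
        using fin by (simp add: r_def ws card_Un_disjoint)
      also have "\<dots> \<le> card (v `` {..<t})"
      proof (rule card_mono)
        show "(u O v) `` {..<s} \<union> E \<subseteq> v `` {..<t}"
          using t(1) Esub by (fastforce simp: relcomp_Image excess_def)
      qed (simp add: v)
      finally show "r + card E \<le> card (v `` {..<t})" .
    qed
    also have "\<dots> \<le> f r - card E"
      by (rule waning_add[OF f])
    \<comment> \<open>Subtraction is truncated, so the separate bound \<open>Ef\<close> on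
      \<open>card E\<close> enters here.\<close>
    finally have "card (excess v' t m) + card E \<le> f r"
      using Ef by simp
    moreover have "card (excess ?w s m) \<le> card (excess v' t m \<union> E)"
      by (intro card_mono) (auto simp: E_def)
    moreover have "card (excess v' t m \<union> E) \<le> card (excess v' t m) + card E"
      by (rule card_Un_le)
    ultimately have "within_bound f s m ?w"
      by (simp add: within_bound_def r_def)
    then show ?thesis
      using agree sym_inv_monoid_comp[OF U(1) V(1)] by (simp add: waning_nbhd_def)
  qed
  then show ?thesis
    using that s'(2) t(2) by blast
qed

lemma waning_topology_polish:
  assumes f: "waning f"
  shows "waning_topology f \<in> polish_semigroup_topologies"
proof -
  let ?T = "waning_topology f"
  note top = topspace_waning_topology[OF f]
  have "completely_metrizable_space (subtopology euclidean (encode f ` sym_inv_monoid))"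
    by (rule completely_metrizable_space_gdelta_in[OF completely_metrizable_nat_power gdelta_encode])
  then have "completely_metrizable_space ?T"
    using homeomorphic_completely_metrizable_space[OF homeomorphic_encode[OF f]] by simp
  moreover have "continuous_map (prod_topology ?T ?T) ?T (\<lambda>(r, s). r O s)"
    unfolding continuous_map_def
  proof (intro conjI allI impI)
    show "(\<lambda>(r, s). r O s) \<in> topspace (prod_topology ?T ?T) \<rightarrow> topspace ?T"
      using sym_inv_monoid_comp by (auto simp: top)
    fix U assume U: "openin ?T U"
    show "openin (prod_topology ?T ?T) {p \<in> topspace (prod_topology ?T ?T). (\<lambda>(r, s). r O s) p \<in> U}"
      unfolding openin_prod_topology_alt
    proof (intro allI impI)
      fix u v assume "(u, v) \<in> {p \<in> topspace (prod_topology ?T ?T). (\<lambda>(r, s). r O s) p \<in> U}"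
      then have uv: "u \<in> sym_inv_monoid" "v \<in> sym_inv_monoid" "u O v \<in> U"
        by (auto simp: top)
      obtain s m where sm: "excess (u O v) s m = {}" "waning_nbhd f (u O v) s m \<subseteq> U"
        using U uv(3) by (auto simp: openin_waning_topology[OF f])
      obtain s' t where st: "excess u s' t = {}" "excess v t m = {}"
        "\<And>u' v'. u' \<in> waning_nbhd f u s' t \<Longrightarrow> v' \<in> waning_nbhd f v t m \<Longrightarrow> u' O v' \<in> waning_nbhd f (u O v) s m"
        using waning_relcomp[OF f uv(1,2) sm(1)] by blast
      show "\<exists>A B. openin ?T A \<and> openin ?T B \<and> u \<in> A \<and> v \<in> B \<and>
          A \<times> B \<subseteq> {p \<in> topspace (prod_topology ?T ?T). (\<lambda>(r, s). r O s) p \<in> U}"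
      proof (intro exI conjI)
        show "u \<in> waning_nbhd f u s' t" "v \<in> waning_nbhd f v t m"
          using st(1,2) uv by (auto intro: waning_nbhd_self)
        show "waning_nbhd f u s' t \<times> waning_nbhd f v t m
            \<subseteq> {p \<in> topspace (prod_topology ?T ?T). (\<lambda>(r, s). r O s) p \<in> U}"
        proof
          fix p assume "p \<in> waning_nbhd f u s' t \<times> waning_nbhd f v t m"
          then obtain a b where ab: "p = (a, b)" "a \<in> waning_nbhd f u s' t" "b \<in> waning_nbhd f v t m"
            by blast
          then have "a O b \<in> U"
            using st(3) sm(2) by blast
          with ab show "p \<in> {p \<in> topspace (prod_topology ?T ?T). (\<lambda>(r, s). r O s) p \<in> U}"
            by (simp add: top waning_nbhd_def)
        qed
      qed (rule openin_waning_nbhd[OF f])+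
    qed
  qed
  ultimately show ?thesis
    using separable_waning_topology[OF f] top
    by (simp add: polish_semigroup_topologies_def polish_topology_def)
qed

text \<open>If \<open>g r > f r\<close>, then near the identity on \<open>r\<close> points
  \<open>g\<close> admits the gain of \<open>g r\<close> points with distant preimages, which the
  \<open>f\<close>-neighbourhood that freezes exactly these \<open>r\<close> values
  excludes.\<close>

lemma opens_waning_topology_subset:
  assumes f: "waning f" and g: "waning g"
  shows "opens (waning_topology f) \<subseteq> opens (waning_topology g) \<longleftrightarrow> (\<forall>r. g r \<le> f r)"
proof
  assume le: "\<forall>r. g r \<le> f r"
  have "waning_nbhd g h s m \<subseteq> waning_nbhd f h s m" for h s m
    using le by (auto simp: waning_nbhd_def within_bound_def intro: order_trans)
  then show "opens (waning_topology f) \<subseteq> opens (waning_topology g)"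
    unfolding opens_def openin_waning_topology[OF f] openin_waning_topology[OF g]
    by (smt (verit) Collect_mono subset_trans)
next
  assume sub: "opens (waning_topology f) \<subseteq> opens (waning_topology g)"
  show "\<forall>r. g r \<le> f r"
  proof (rule allI, rule ccontr)
    fix r assume r: "\<not> g r \<le> f r"
    define h where "h = Id_on {..<r}"
    define U where "U = waning_nbhd f h r (r + g r)"
    have "openin (waning_topology g) U"
      using sub openin_waning_nbhd[OF f, of h r "r + g r"] by (auto simp: opens_def U_def)
    moreover have "h \<in> U"
      unfolding U_def by (rule waning_nbhd_self) (auto simp: h_def excess_def)
    ultimately obtain s m where sm: "excess h s m = {}" "waning_nbhd g h s m \<subseteq> U"
      unfolding openin_waning_topology[OF g] by blast
    define N where "N = r + s"
    define k where "k = h \<union> {(N + j, r + j) |j. j < g r}"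
    have k: "k \<in> sym_inv_monoid"
      unfolding sym_inv_monoid_iff k_def h_def N_def by auto
    have agree: "k `` {x} = h `` {x}" if "x < N" for x
      using that by (auto simp: k_def)
    have hs: "h `` {..<t} = {..<min r t}" for t
      by (auto simp: h_def)
    have ks: "k `` {..<t} = {..<min r t}" if "t \<le> N" for t
      using agree_Image[of N k h t] agree that hs by simp
    have Rk: "Range k = {..<r + g r}"
    proof -
      have "y \<in> Range k" if "y < r + g r" for y
      proof (cases "y < r")
        case False
        then have "(N + (y - r), y) \<in> k"
          using that unfolding k_def by (auto intro!: exI[of _ "y - r"])
        then show ?thesis
          by blast
      qed (auto simp: k_def h_def)
      moreover have "Range k \<subseteq> {..<r + g r}"
        by (auto simp: k_def h_def)
      ultimately show ?thesis
        by auto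
    qed
    have "within_bound g s m k"
    proof (cases "r \<le> s")
      case True
      have "excess k s m \<subseteq> {r..<r + g r}"
        using True ks[of s] by (auto simp: excess_def Rk N_def)
      then have "card (excess k s m) \<le> g r"
        using card_mono[of "{r..<r + g r}" "excess k s m"] by simp
      then show ?thesis
        using True ks[of s] by (simp add: within_bound_def N_def min_def)
    next
      case False
      \<comment> \<open>When fewer than \<open>r\<close> values are frozen, \<open>h\<close> has no
        excess only if \<open>m \<le> s\<close>; all points below \<open>m\<close> are then frozen
        values, and \<open>k\<close> has no excess either.\<close>
      have "\<not> s < m"
      proof
        assume "s < m"
        then have "s \<in> excess h s m"
          using False hs[of s] by (auto simp: excess_def h_def)
        then show False
          using sm(1) by simp
      qed
      then have "excess k s m = {}"
        using False ks[of s] by (auto simp: excess_def N_def)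
      then show ?thesis
        by (simp add: within_bound_def)
    qed
    then have "k \<in> waning_nbhd g h s m"
      using k agree by (simp add: waning_nbhd_def N_def)
    then have "k \<in> U"
      using sm(2) by blast
    then have "within_bound f r (r + g r) k"
      by (simp add: U_def waning_nbhd_def)
    moreover have "excess k r (r + g r) = {r..<r + g r}" "k `` {..<r} = {..<r}"
      using ks[of r] by (auto simp: excess_def Rk N_def)
    ultimately show False
      using r by (simp add: within_bound_def)
  qed
qed

section \<open>Chains and finite orders among the waning topologies\<close>

lemma descending_chain:
  "\<exists>T :: nat \<Rightarrow> (nat \<times> nat) set topology.
     (\<forall>n. T n \<in> polish_semigroup_topologies) \<and> (\<forall>n. opens (T (Suc n)) \<subset> opens (T n))"
proof (intro exI conjI allI)
  fix n :: nat
  have w: "waning (\<lambda>r. n - r)" for n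
    by (auto simp: waning_def)
  show "waning_topology (\<lambda>r. n - r) \<in> polish_semigroup_topologies"
    by (rule waning_topology_polish[OF w])
  show "opens (waning_topology (\<lambda>r. Suc n - r)) \<subset> opens (waning_topology (\<lambda>r. n - r))"
    unfolding less_le_not_le opens_waning_topology_subset[OF w w] by (auto intro!: exI[of _ 0])
qed

text \<open>The map \<open>a \<mapsto> {c. (c, a) \<notin> r}\<close> reverses the order, and the values of a waning function at
  \<open>0, \<dots>, n - 1\<close> leave room for one independent bit each.\<close>

lemma finite_order_embedding:
  assumes "finite A" "partial_order_on A r"
  shows "\<exists>Q f. Q \<subseteq> polish_semigroup_topologies \<and> bij_betw f A Q \<and>
    (\<forall>a\<in>A. \<forall>b\<in>A. (a, b) \<in> r \<longleftrightarrow> opens (f a) \<subseteq> opens (f b))"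
proof -
  note r = partial_order_onD[OF assms(2)]
  define n where "n = card A"
  obtain e where e: "bij_betw e {..<n} A"
    using ex_bij_betw_nat_finite[OF assms(1)] by (auto simp: n_def atLeast0LessThan)
  \<comment> \<open>The leading term falls by 2 at each step, so a change of the bit by 1 still
    leaves a drop of at least 1.\<close>
  define F where "F a j = (if j < n then 2 * (n - j) + (if (e j, a) \<in> r then 0 else 1) else 0)" for a j
  have w: "waning (F a)" for a
    unfolding waning_def F_def by (auto simp: Suc_diff_Suc)
  have iff: "(a, b) \<in> r \<longleftrightarrow> opens (waning_topology (F a)) \<subseteq> opens (waning_topology (F b))" if "a \<in> A" "b \<in> A" for a b
    unfolding opens_waning_topology_subset[OF w w]
  proof
    assume "(a, b) \<in> r"
    then show "\<forall>j. F b j \<le> F a j"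
      using r(2) by (auto simp: F_def dest: transD)
  next
    assume le: "\<forall>j. F b j \<le> F a j"
    have "a \<in> e ` {..<n}"
      using that(1) bij_betw_imp_surj_on[OF e] by simp
    then obtain j where j: "j < n" "e j = a"
      by blast
    \<comment> \<open>At the index of \<open>a\<close> itself the bit of \<open>a\<close> is 0 by
      reflexivity. The inequality forces the bit of \<open>b\<close> there to be 0, which says that
      \<open>a\<close> lies below \<open>b\<close>.\<close>
    have "(a, a) \<in> r"
      using r(1) that(1) by (simp add: refl_on_def)
    then show "(a, b) \<in> r"
      using le[rule_format, of j] j by (auto simp: F_def split: if_splits)
  qed
  have "inj_on (\<lambda>a. waning_topology (F a)) A"
  proof (rule inj_onI)
    fix a b assume "a \<in> A" "b \<in> A" "waning_topology (F a) = waning_topology (F b)"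
    then show "a = b"
      using iff[of a b] iff[of b a] r(3) by (auto dest: antisymD)
  qed
  then have "bij_betw (\<lambda>a. waning_topology (F a)) A ((\<lambda>a. waning_topology (F a)) ` A)"
    by (simp add: bij_betw_def)
  moreover have "(\<lambda>a. waning_topology (F a)) ` A \<subseteq> polish_semigroup_topologies"
    using waning_topology_polish[OF w] by blast
  ultimately show ?thesis
    using iff by blast
qed

theorem theorem2p7:
  shows "(\<exists>T :: nat \<Rightarrow> (nat \<times> nat) set topology.
            (\<forall>n. T n \<in> polish_semigroup_topologies) \<and>
            (\<forall>n. opens (T (Suc n)) \<subset> opens (T n))) \<and>
         \<not> (\<exists>T :: nat \<Rightarrow> (nat \<times> nat) set topology.
            (\<forall>n. T n \<in> polish_semigroup_topologies) \<and>
            (\<forall>n. opens (T n) \<subset> opens (T (Suc n)))) \<and>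
         (\<forall>(A :: 'a set) (r :: ('a \<times> 'a) set). finite A \<and> partial_order_on A r \<longrightarrow>
            (\<exists>Q f. Q \<subseteq> polish_semigroup_topologies \<and> bij_betw f A Q \<and>
              (\<forall>a\<in>A. \<forall>b\<in>A. (a, b) \<in> r \<longleftrightarrow> opens (f a) \<subseteq> opens (f b))))"
  using descending_chain no_ascending_chain finite_order_embedding by blast

end
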